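(* Let $\Omega\subset\mathbb R^n$ be open and let $A=(A^{hk}_{\alpha\beta}(x))$, $1\le h,k\le n$, $1\le\alpha,\beta\le m$, be a bounded measurable complex tensor-valued function on $\Omega$. Then: (i) For any $p\in(1,\infty)$, the strong $p$-ellipticity condition for $A$ implies the integral $p$-ellipticity condition for $A$. (ii) For any $p\in(1,\infty)$, the integral $p$-ellipticity condition for $A$ implies the weak (Legendre-Hadamard) $p$-ellipticity condition for $A$. (iii) When $p=2$, the strong $p$-ellipticity condition is the usual strong ellipticity (Legendre) condition, the integral $p$-ellipticity condition is the usual integral ellipticity condition, and the weak $p$-ellipticity condition is the Legendre-Hadamard condition. (iv) Given $p\in(1,\infty)$, if $A$ satisfies one of the three $p$-ellipticity conditions (strong, integral, weak), then the adjoint $A^*$ satisfies the same condition with $p$ replaced by $p'=p/(p-1)$. If $A$ satisfies the weak $p$-ellipticity condition for some $p\in(1,\infty)$, then it also satisfies the weak $p$-ellipticity condition for $p=2$, and thus the Legendre-Hadamard condition. (v) If $A$ satisfies one of the three conditions (strong, integral, weak) for both exponents $p$ and $q$ in $(1,\infty)$, then there is an open interval containing the points $p$ and $q$ such that $A$ satisfies the same condition for every exponent $r$ in this interval.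
   Context: Summation over repeated indices is used, with $h,k\in\{1,\dots,n\}$ and $\alpha,\beta\in\{1,\dots,m\}$. For $a,b\in\mathbb C^m$, $\langle a,b\rangle=a^\alpha\overline{b^\alpha}$. For $\xi=(\xi^\alpha_h),\eta=(\eta^\alpha_h)\in\mathbb C^{n\times m}$, $\langle A(x)\xi,\eta\rangle=A^{hk}_{\alpha\beta}(x)\,\xi^\beta_k\,\overline{\eta^\alpha_h}$; $\xi_h=(\xi_h^\alpha)_\alpha\in\mathbb C^m$. The adjoint is $(A^* )^{hk}_{\alpha\beta}=\overline{A^{kh}_{\beta\alpha}}$. For $v:\Omega\to\mathbb C^m$, $(\nabla v)^\alpha_h=\partial_hv^\alpha$, and $\frac{v}{|v|}\nabla|v|$ is the tensor with entries $\frac{v^\alpha}{|v|}\partial_h|v|=\frac{v^\alpha}{|v|^2}\Re e\langle v,\partial_hv\rangle$ (taken to be $0$ where $v=0$). For $\xi\in\mathbb C^{n\times m}$ and $\omega\in\mathbb C^m$, define $\xi(\omega)\in\mathbb C^{n\times m}$ by $\xi(\omega)^\alpha_h=\omega^\alpha\,\Re e\langle\omega,\xi_h\rangle$. Strong $p$-ellipticity: there is $C>0$ such that for a.e. $x\in\Omega$, all $\xi\in\mathbb C^{n\times m}$ and all $\omega\in\mathbb C^m$ with $|\omega|=1$, $$\Re e\left\langle A(x)\left(\xi-\left(1-\tfrac2p\right)\xi(\omega)\right),\ \xi+\left(1-\tfrac2p\right)\xi(\omega)\right\rangle\ge C|\xi|^2 .$$ Integral $p$-ellipticity: there is $C>0$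 such that for all $v\in W^{1,2}_0(\Omega;\mathbb C^m)$, $$\Re e\int_\Omega\left\langle A\left(\nabla v-\left(1-\tfrac2p\right)\tfrac{v}{|v|}\nabla|v|\right),\ \nabla v+\left(1-\tfrac2p\right)\tfrac{v}{|v|}\nabla|v|\right\rangle dx\ge C\int_\Omega|\nabla v|^2\,dx .$$ Weak (Legendre-Hadamard) $p$-ellipticity: there is $C>0$ such that for a.e. $x\in\Omega$, all $\eta,\omega\in\mathbb C^m$ with $|\omega|=1$ and all $q\in\mathbb R^n$, $$\Re e\left\langle (A^{hk}(x)q_hq_k)\left(\eta-\left(1-\tfrac2p\right)\omega\,\Re e\langle\omega,\eta\rangle\right),\ \eta+\left(1-\tfrac2p\right)\omega\,\Re e\langle\omega,\eta\rangle\right\rangle\ge C|\eta|^2|q|^2,$$ where $A^{hk}$ is the $m\times m$ matrix $(A^{hk}_{\alpha\beta})_{\alpha,\beta}$ acting by $(A^{hk}\zeta)^\alpha=A^{hk}_{\alpha\beta}\zeta^\beta$. Classical conditions: strong ellipticity (Legendre): $\Re e\langle A(x)\xi,\xi\rangle\ge C|\xi|^2$ for all $\xi\in\mathbb C^{n\times m}$ and a.e. $x$. Integral ellipticity: $\Re e\int_\Omega\langle A\nabla v,\nabla v\rangle dx\ge C\int_\Omega|\nabla v|^2dx$ for all $v\in W^{1,2}_0(\Omega;\mathbb C^m)$. Legendre-Hadamard: $\Re e\langle(A^{hk}(x)q_hq_k)\eta,\eta\rangle\ge C|\eta|^2|q|^2$ for all $\eta\in\mathbb C^m$, $q\in\mathbb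 R^n$ and a.e. $x$. *)

theory Defs
  imports "HOL-Analysis.Analysis"
begin

text \<open>
  The index ranges are finite types: \<open>'n\<close> for the space indices \<open>h, k\<close> and \<open>'m\<close> for the component
  indices \<open>\<alpha>, \<beta>\<close>. An element \<open>\<xi> = (\<xi>\<^sup>\<alpha>\<^sub>h)\<close> of the space of tensors is a vector of type
  \<open>complex^'m^'n\<close> with \<open>\<xi>\<^sup>\<alpha>\<^sub>h = \<xi> $ h $ \<alpha>\<close>, so that \<open>\<xi>\<^sub>h = \<xi> $ h\<close>. The coefficient
  \<open>A\<^sup>h\<^sup>k\<^sub>\<alpha>\<^sub>\<beta>(x)\<close> is \<open>A x $ h $ k $ \<alpha> $ \<beta>\<close>, and \<open>A x $ h $ k\<close> is the matrix \<open>A\<^sup>h\<^sup>k(x)\<close>. The library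
  norms on \<open>complex^'m\<close>, \<open>complex^'m^'n\<close> and \<open>real^'n\<close> are the Euclidean (Hermitian) ones.
\<close>

type_synonym ('n, 'm) coeff = "complex^'m^'m^'n^'n"

definition cinner :: "complex^'m \<Rightarrow> complex^'m \<Rightarrow> complex" where
  "cinner a b = (\<Sum>\<alpha>\<in>UNIV. a $ \<alpha> * cnj (b $ \<alpha>))"

definition tensor_form ::
  "('n::finite, 'm::finite) coeff \<Rightarrow> complex^'m^'n \<Rightarrow> complex^'m^'n \<Rightarrow> complex" where
  "tensor_form B \<xi> \<eta> =
     (\<Sum>h\<in>UNIV. \<Sum>k\<in>UNIV. \<Sum>\<alpha>\<in>UNIV. \<Sum>\<beta>\<in>UNIV. B $ h $ k $ \<alpha> $ \<beta> * \<xi> $ k $ \<beta> * cnj (\<eta> $ h $ \<alpha>))"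

definition adjoint_coeff ::
  "(real^'n \<Rightarrow> ('n::finite, 'm::finite) coeff) \<Rightarrow> real^'n \<Rightarrow> ('n, 'm) coeff" where
  "adjoint_coeff A = (\<lambda>x. \<chi> h k \<alpha> \<beta>. cnj (A x $ k $ h $ \<beta> $ \<alpha>))"

definition symbol_matrix ::
  "('n::finite, 'm::finite) coeff \<Rightarrow> real^'n \<Rightarrow> complex^'m^'m" where
  "symbol_matrix B q = (\<Sum>h\<in>UNIV. \<Sum>k\<in>UNIV. (q $ h * q $ k) *\<^sub>R (B $ h $ k))"

definition tensor_at :: "complex^'m^'n \<Rightarrow> complex^'m \<Rightarrow> complex^'m^'n" where
  "tensor_at \<xi> \<omega> = (\<chi> h \<alpha>. \<omega> $ \<alpha> * complex_of_real (Re (cinner \<omega> (\<xi> $ h))))"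

text \<open>
  The value of the tensor \<open>(v/|v|) \<nabla>|v|\<close> at a point where \<open>v\<close> has the value \<open>w\<close> and \<open>\<nabla>v\<close> the
  value \<open>\<xi>\<close>, that is, with entries \<open>v\<^sup>\<alpha>/|v|\<^sup>2 Re \<langle>v, \<partial>\<^sub>h v\<rangle>\<close>.
\<close>

definition modulus_tensor :: "complex^'m \<Rightarrow> complex^'m^'n \<Rightarrow> complex^'m^'n" where
  "modulus_tensor w \<xi> =
     (if w = 0 then 0
      else \<chi> h \<alpha>. w $ \<alpha> / complex_of_real ((norm w)\<^sup>2) * complex_of_real (Re (cinner w (\<xi> $ h))))"

text \<open>\<open>C_k k f\<close>: all iterated directional derivatives of \<open>f\<close> up to order \<open>k\<close> exist and are
  continuous (for \<open>j < k\<close> those of order \<open>j\<close> are even Frechet differentiable).\<close>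

primrec C_k :: "nat \<Rightarrow> ('a::real_normed_vector \<Rightarrow> 'b::real_normed_vector) \<Rightarrow> bool" where
  "C_k 0 f \<longleftrightarrow> continuous_on UNIV f"
| "C_k (Suc k) f \<longleftrightarrow>
     (\<forall>x. f differentiable (at x)) \<and> (\<forall>u. C_k k (\<lambda>x. frechet_derivative f (at x) u))"

definition test_functions ::
  "(real^'n) set \<Rightarrow> (real^'n \<Rightarrow> 'b::real_normed_vector) set" where
  "test_functions \<Omega> =
     {\<phi>. (\<forall>k. C_k k \<phi>) \<and> compact (closure {x. \<phi> x \<noteq> 0}) \<and> closure {x. \<phi> x \<noteq> 0} \<subseteq> \<Omega>}"

definition partial_deriv :: "'n \<Rightarrow> (real^'n \<Rightarrow> 'b::real_normed_vector) \<Rightarrow> real^'n \<Rightarrow> 'b" where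
  "partial_deriv h f x = frechet_derivative f (at x) (axis h 1)"

definition gradient :: "(real^'n \<Rightarrow> complex^'m) \<Rightarrow> real^'n \<Rightarrow> complex^'m^'n" where
  "gradient f x = (\<chi> h. partial_deriv h f x)"

definition L2_on :: "(real^'n) set \<Rightarrow> (real^'n \<Rightarrow> 'b::euclidean_space) \<Rightarrow> bool" where
  "L2_on \<Omega> f \<longleftrightarrow> f \<in> borel_measurable (lebesgue_on \<Omega>) \<and>
     integrable (lebesgue_on \<Omega>) (\<lambda>x. (norm (f x))\<^sup>2)"

text \<open>\<open>v\<close> belongs to \<open>W\<^sup>1\<^sup>,\<^sup>2(\<Omega>)\<close> and \<open>G\<close> represents its weak gradient. Functions are not identified when
  equal almost everywhere, so \<open>G\<close> is determined by \<open>v\<close> only up to a null set.\<close>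

definition has_weak_gradient ::
  "(real^'n) set \<Rightarrow> (real^'n \<Rightarrow> complex^'m) \<Rightarrow> (real^'n \<Rightarrow> complex^'m^'n) \<Rightarrow> bool" where
  "has_weak_gradient \<Omega> v G \<longleftrightarrow> L2_on \<Omega> v \<and> L2_on \<Omega> G \<and>
     (\<forall>(\<phi> :: real^'n \<Rightarrow> real) \<in> test_functions \<Omega>. \<forall>h.
        (LINT x|lebesgue_on \<Omega>. partial_deriv h \<phi> x *\<^sub>R v x) =
        - (LINT x|lebesgue_on \<Omega>. \<phi> x *\<^sub>R (G x $ h)))"

definition W12_0 :: "(real^'n) set \<Rightarrow> (real^'n \<Rightarrow> complex^'m) set" where
  "W12_0 \<Omega> = {v. \<exists>G. has_weak_gradient \<Omega> v G \<and>
     (\<exists>\<phi> :: nat \<Rightarrow> real^'n \<Rightarrow> complex^'m. (\<forall>j. \<phi> j \<in> test_functions \<Omega>) \<and>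
        (\<lambda>j. LINT x|lebesgue_on \<Omega>.
           (norm (\<phi> j x - v x))\<^sup>2 + (norm (gradient (\<phi> j) x - G x))\<^sup>2) \<longlonglongrightarrow> 0)}"

definition strong_p_elliptic ::
  "(real^'n) set \<Rightarrow> (real^'n \<Rightarrow> ('n::finite, 'm::finite) coeff) \<Rightarrow> real \<Rightarrow> bool" where
  "strong_p_elliptic \<Omega> A p \<longleftrightarrow>
     (\<exists>C>0. AE x in lebesgue_on \<Omega>. \<forall>\<xi> :: complex^'m^'n. \<forall>\<omega> :: complex^'m. norm \<omega> = 1 \<longrightarrow>
        Re (tensor_form (A x) (\<xi> - (1 - 2/p) *\<^sub>R tensor_at \<xi> \<omega>) (\<xi> + (1 - 2/p) *\<^sub>R tensor_at \<xi> \<omega>))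
          \<ge> C * (norm \<xi>)\<^sup>2)"

definition integral_p_elliptic ::
  "(real^'n) set \<Rightarrow> (real^'n \<Rightarrow> ('n::finite, 'm::finite) coeff) \<Rightarrow> real \<Rightarrow> bool" where
  "integral_p_elliptic \<Omega> A p \<longleftrightarrow>
     (\<exists>C>0. \<forall>v \<in> W12_0 \<Omega>. \<forall>G. has_weak_gradient \<Omega> v G \<longrightarrow>
        Re (LINT x|lebesgue_on \<Omega>.
              tensor_form (A x) (G x - (1 - 2/p) *\<^sub>R modulus_tensor (v x) (G x))
                                (G x + (1 - 2/p) *\<^sub>R modulus_tensor (v x) (G x)))
          \<ge> C * (LINT x|lebesgue_on \<Omega>. (norm (G x))\<^sup>2))"

definition weak_p_elliptic ::
  "(real^'n) set \<Rightarrow> (real^'n \<Rightarrow> ('n::finite, 'm::finite) coeff) \<Rightarrow> real \<Rightarrow> bool" where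
  "weak_p_elliptic \<Omega> A p \<longleftrightarrow>
     (\<exists>C>0. AE x in lebesgue_on \<Omega>. \<forall>(\<eta> :: complex^'m) (\<omega> :: complex^'m) (q :: real^'n).
        norm \<omega> = 1 \<longrightarrow>
        Re (cinner (symbol_matrix (A x) q *v (\<eta> - ((1 - 2/p) * Re (cinner \<omega> \<eta>)) *\<^sub>R \<omega>))
                   (\<eta> + ((1 - 2/p) * Re (cinner \<omega> \<eta>)) *\<^sub>R \<omega>))
          \<ge> C * (norm \<eta>)\<^sup>2 * (norm q)\<^sup>2)"

definition strongly_elliptic ::
  "(real^'n) set \<Rightarrow> (real^'n \<Rightarrow> ('n::finite, 'm::finite) coeff) \<Rightarrow> bool" where
  "strongly_elliptic \<Omega> A \<longleftrightarrow>
     (\<exists>C>0. AE x in lebesgue_on \<Omega>. \<forall>\<xi> :: complex^'m^'n.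
        Re (tensor_form (A x) \<xi> \<xi>) \<ge> C * (norm \<xi>)\<^sup>2)"

definition integrally_elliptic ::
  "(real^'n) set \<Rightarrow> (real^'n \<Rightarrow> ('n::finite, 'm::finite) coeff) \<Rightarrow> bool" where
  "integrally_elliptic \<Omega> A \<longleftrightarrow>
     (\<exists>C>0. \<forall>v \<in> W12_0 \<Omega>. \<forall>G. has_weak_gradient \<Omega> v G \<longrightarrow>
        Re (LINT x|lebesgue_on \<Omega>. tensor_form (A x) (G x) (G x))
          \<ge> C * (LINT x|lebesgue_on \<Omega>. (norm (G x))\<^sup>2))"

definition legendre_hadamard ::
  "(real^'n) set \<Rightarrow> (real^'n \<Rightarrow> ('n::finite, 'm::finite) coeff) \<Rightarrow> bool" where
  "legendre_hadamard \<Omega> A \<longleftrightarrow>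
     (\<exists>C>0. AE x in lebesgue_on \<Omega>. \<forall>(\<eta> :: complex^'m) (q :: real^'n).
        Re (cinner (symbol_matrix (A x) q *v \<eta>) \<eta>) \<ge> C * (norm \<eta>)\<^sup>2 * (norm q)\<^sup>2)"

end

theory Submission
  imports Defs
begin

text \<open>
  Put \<open>s = 1 - 2/p\<close>; this number runs through \<open>(-1, 1)\<close> as \<open>p\<close> runs through \<open>(1, \<infinity>)\<close>, it vanishes for
  \<open>p = 2\<close>, and passing to the conjugate exponent changes its sign. For a vector \<open>\<omega>\<close> of norm at most 1
  write \<open>T \<xi>\<close> for the tensor \<open>\<xi>(\<omega>)\<close>. All three conditions ask for a lower bound on the real part of
  \<open>\<langle>A (\<xi> - s T \<xi>), \<xi> + s T \<xi>\<rangle>\<close>, called \<open>p_form\<close> below: the strong condition for all \<open>\<xi>\<close> and all unit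
  vectors \<open>\<omega>\<close>, the weak one for the rank-one tensors \<open>\<xi> = q \<otimes> \<eta>\<close> only, and the integral one on average for
  \<open>\<xi> = \<nabla>v\<close> and \<open>\<omega> = sgn v\<close>. With \<open>sgn 0 = 0\<close> the last description is also correct at the zeros of \<open>v\<close>.

  Strong implies integral. Where \<open>v \<noteq> 0\<close> the pointwise inequality is the hypothesis. Where \<open>v = 0\<close> the
  inequality for \<open>s = 0\<close> is needed, and it follows by averaging: substituting \<open>\<zeta> = (1 - s T) \<xi>\<close> makes the
  form equal to \<open>\<langle>A \<zeta>, \<zeta>\<rangle> + t \<langle>A \<zeta>, T \<zeta>\<rangle>\<close> with \<open>t = 2 s / (1 - s) = p - 2 > -1\<close>, and the projections \<open>T\<close> that
  belong to a real orthonormal basis of \<open>\<complex>\<^sup>m\<close> add up to the identity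
  (\<open>p_form_coercive_imp_coercive\<close>).

  Integral implies weak. Test the integral condition with \<open>v = \<psi> (\<omega> + \<delta> sin(q \<bullet> x / \<delta>\<^sup>2 + \<theta>) \<eta>)\<close> for a smooth cutoff
  \<open>\<psi> \<ge> 0\<close>. As \<open>\<delta> \<rightarrow> 0\<close> the direction of \<open>v\<close> tends to \<open>\<omega>\<close>, while \<open>\<delta> \<nabla>v\<close> differs from
  \<open>\<psi> cos(\<dots>) q \<otimes> \<eta>\<close> by a term of size \<open>\<delta>\<close>. Adding the inequalities for the phases \<open>\<theta> = 0\<close> and \<open>\<theta> = \<pi>/2\<close>
  replaces the squared cosine by 1, and in the limit the integral of \<open>\<psi>\<^sup>2 H\<close> is nonnegative, where \<open>H\<close> is the
  difference of the two sides of the weak condition (\<open>oscillation_inequality\<close>). Since this holds for all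
  cutoffs, \<open>H \<ge> 0\<close> almost everywhere (\<open>AE_nonneg_of_test_functions\<close>); a countable dense set of
  parameters \<open>(\<eta>, \<omega>, q)\<close> then yields one null set that serves all of them. The test functions used here must be
  shown to exist (the flat function \<open>exp(-1/t)\<close>) and to belong to \<open>W\<^sup>1\<^sup>,\<^sup>2\<^sub>0\<close> with their classical
  gradient, that is, to admit integration by parts.

  Weak implies Legendre-Hadamard: \<open>\<omega> = i \<eta> / |\<eta>|\<close> is orthogonal to \<open>\<eta>\<close> in the real sense, so that \<open>T \<xi> = 0\<close>
  for \<open>\<xi> = q \<otimes> \<eta>\<close>.

  Intervals of exponents. As a function of \<open>s\<close> the form is \<open>a + b s - d s\<^sup>2\<close> with
  \<open>d = Re \<langle>A T \<xi>, T \<xi>\<rangle>\<close>. The tensor \<open>T \<xi>\<close> has rank one with a real first factor, hence \<open>d \<ge> 0\<close>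
  by the Legendre-Hadamard condition, which each of the three conditions implies. Concavity gives the bound
  between the two given exponents, and the boundedness of \<open>A\<close> extends it slightly beyond them
  (\<open>concave_quadratic_margin\<close>). For the integral condition the same argument is applied to the integrals of
  \<open>a\<close>, \<open>b\<close> and \<open>d\<close>.
\<close>

section \<open>The coefficient form and its p-dependent perturbation\<close>

lemma Re_cinner: "Re (cinner a b) = inner a b"
  by (simp add: cinner_def inner_vec_def inner_complex_def)

lemma tensor_at_eq: "tensor_at \<xi> \<omega> = (\<chi> h. inner \<omega> (\<xi> $ h) *\<^sub>R \<omega>)"
  unfolding tensor_at_def Re_cinner vec_eq_iff
  by (simp add: scaleR_conv_of_real[where 'a = complex])

text \<open>
  Because \<open>sgn 0 = 0\<close>, the convention at the zeros of \<open>v\<close> needs no separate case, provided that vectors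
  \<open>\<omega>\<close> of norm at most 1, and not only unit vectors, are admitted in the estimates below.
\<close>

lemma modulus_tensor_eq: "modulus_tensor w \<xi> = tensor_at \<xi> (sgn w)"
proof (cases "w = 0")
  case True
  then show ?thesis by (simp add: modulus_tensor_def tensor_at_eq flip: zero_vec_def)
next
  case False
  then show ?thesis
    unfolding modulus_tensor_def tensor_at_eq Re_cinner vec_eq_iff
    by (simp add: sgn_div_norm scaleR_conv_of_real[where 'a = complex] power2_eq_square divide_inverse)
qed

lemma tensor_at_zero [simp]: "tensor_at \<xi> 0 = 0"
  by (simp add: tensor_at_eq vec_eq_iff)

lemma tensor_at_diff: "tensor_at (\<xi> - \<zeta>) \<omega> = tensor_at \<xi> \<omega> - tensor_at \<zeta> \<omega>"
  by (simp add: tensor_at_eq vec_eq_iff inner_diff_right algebra_simps)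

lemma tensor_at_add: "tensor_at (\<xi> + \<zeta>) \<omega> = tensor_at \<xi> \<omega> + tensor_at \<zeta> \<omega>"
  by (simp add: tensor_at_eq vec_eq_iff inner_add_right algebra_simps)

lemma tensor_at_scaleR: "tensor_at (c *\<^sub>R \<xi>) \<omega> = c *\<^sub>R tensor_at \<xi> \<omega>"
  by (simp add: tensor_at_eq vec_eq_iff)

lemma tensor_at_idem: "norm \<omega> = 1 \<Longrightarrow> tensor_at (tensor_at \<xi> \<omega>) \<omega> = tensor_at \<xi> \<omega>"
  by (simp add: tensor_at_eq vec_eq_iff norm_eq_1)

lemma norm_vec_le:
  fixes x :: "'a::real_normed_vector^'n::finite" and y :: "'b::real_normed_vector^'n"
  assumes "c \<ge> 0" "\<And>h. norm (x $ h) \<le> c * norm (y $ h)"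
  shows "norm x \<le> c * norm y"
  unfolding norm_vec_def L2_set_right_distrib[OF \<open>c \<ge> 0\<close>]
  by (rule L2_set_mono) (use assms in auto)

text \<open>
  For a unit vector \<open>\<omega>\<close> the map \<open>\<xi> \<mapsto> \<xi>(\<omega>)\<close> is the projection of every row onto the real line through
  \<open>\<omega>\<close>, orthogonal for the real inner product.
\<close>

lemma norm_tensor_at_le:
  assumes "norm \<omega> \<le> 1" shows "norm (tensor_at \<xi> \<omega>) \<le> norm \<xi>"
proof -
  have "norm (tensor_at \<xi> \<omega> $ h) \<le> 1 * norm (\<xi> $ h)" for h
  proof -
    have "norm (tensor_at \<xi> \<omega> $ h) \<le> (norm \<omega> * norm (\<xi> $ h)) * norm \<omega>"
      unfolding tensor_at_eq by (simp add: mult_right_mono Cauchy_Schwarz_ineq2)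
    also have "\<dots> \<le> (1 * norm (\<xi> $ h)) * 1"
      using assms by (intro mult_mono) auto
    finally show ?thesis by simp
  qed
  from norm_vec_le[OF _ this] show ?thesis by simp
qed

lemma norm_tensor_at_diff_le:
  assumes "norm \<omega> \<le> 1" "norm \<omega>' \<le> 1"
  shows "norm (tensor_at \<xi> \<omega> - tensor_at \<xi> \<omega>') \<le> 2 * (norm (\<omega> - \<omega>') * norm \<xi>)"
  unfolding mult.assoc[symmetric]
proof (rule norm_vec_le)
  fix h
  have eq: "(tensor_at \<xi> \<omega> - tensor_at \<xi> \<omega>') $ h
    = inner (\<omega> - \<omega>') (\<xi> $ h) *\<^sub>R \<omega> + inner \<omega>' (\<xi> $ h) *\<^sub>R (\<omega> - \<omega>')"
    by (simp add: tensor_at_eq inner_diff_left algebra_simps)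
  have "norm (inner (\<omega> - \<omega>') (\<xi> $ h) *\<^sub>R \<omega>) \<le> (norm (\<omega> - \<omega>') * norm (\<xi> $ h)) * 1"
    unfolding norm_scaleR real_norm_def using assms by (intro mult_mono Cauchy_Schwarz_ineq2) auto
  moreover have "norm (inner \<omega>' (\<xi> $ h) *\<^sub>R (\<omega> - \<omega>')) \<le> (1 * norm (\<xi> $ h)) * norm (\<omega> - \<omega>')"
    unfolding norm_scaleR real_norm_def using assms
    by (intro mult_right_mono order_trans[OF Cauchy_Schwarz_ineq2]) auto
  ultimately show "norm ((tensor_at \<xi> \<omega> - tensor_at \<xi> \<omega>') $ h) \<le> 2 * norm (\<omega> - \<omega>') * norm (\<xi> $ h)"
    unfolding eq by (intro norm_triangle_le) (simp add: mult_ac)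
qed simp

text \<open>
  The linear map \<open>\<xi> \<mapsto> A \<xi>\<close> behind \<open>tensor_form\<close>. Factoring the form through it makes the library on
  bounded bilinear maps applicable, and turns its real part into a real inner product.
\<close>

definition coeff_app :: "('n::finite, 'm::finite) coeff \<Rightarrow> complex^'m^'n \<Rightarrow> complex^'m^'n" where
  "coeff_app B \<xi> = (\<chi> h. \<Sum>k\<in>UNIV. B $ h $ k *v \<xi> $ k)"

definition tensor_cinner :: "complex^'m^'n \<Rightarrow> complex^'m^'n \<Rightarrow> complex" where
  "tensor_cinner \<xi> \<eta> = (\<Sum>h\<in>UNIV. cinner (\<xi> $ h) (\<eta> $ h))"

lemma tensor_form_eq: "tensor_form B \<xi> \<eta> = tensor_cinner (coeff_app B \<xi>) \<eta>"
proof -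
  have "(\<Sum>k\<in>UNIV. \<Sum>\<alpha>\<in>UNIV. \<Sum>\<beta>\<in>UNIV. B $ h $ k $ \<alpha> $ \<beta> * \<xi> $ k $ \<beta> * cnj (\<eta> $ h $ \<alpha>))
    = (\<Sum>\<alpha>\<in>UNIV. (\<Sum>k\<in>UNIV. \<Sum>\<beta>\<in>UNIV. B $ h $ k $ \<alpha> $ \<beta> * \<xi> $ k $ \<beta>) * cnj (\<eta> $ h $ \<alpha>))" for h
    unfolding sum_distrib_right by (rule sum.swap)
  then show ?thesis
    unfolding tensor_form_def tensor_cinner_def coeff_app_def cinner_def matrix_vector_mult_def
    by simp
qed

lemma Re_tensor_form: "Re (tensor_form B \<xi> \<eta>) = inner (coeff_app B \<xi>) \<eta>"
  by (simp add: tensor_form_eq tensor_cinner_def Re_cinner inner_vec_def[of "coeff_app B \<xi>"])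

lemma bounded_bilinear_coeff_app:
  "bounded_bilinear (coeff_app :: ('n::finite, 'm::finite) coeff \<Rightarrow> complex^'m^'n \<Rightarrow> complex^'m^'n)"
  unfolding bilinear_conv_bounded_bilinear[symmetric] bilinear_def
  by (intro conjI allI linearI)
    (simp_all add: coeff_app_def vec_eq_iff matrix_vector_mult_def sum.distrib distrib_left distrib_right
      scaleR_sum_right)

lemma bounded_bilinear_tensor_cinner:
  "bounded_bilinear (tensor_cinner :: complex^'m::finite^'n::finite \<Rightarrow> complex^'m^'n \<Rightarrow> complex)"
  unfolding bilinear_conv_bounded_bilinear[symmetric] bilinear_def
  by (intro conjI allI linearI)
    (simp_all add: tensor_cinner_def cinner_def sum.distrib distrib_left distrib_right
      scaleR_sum_right)

interpretation coeff_app: bounded_bilinear coeff_app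
  by (rule bounded_bilinear_coeff_app)

interpretation tensor_cinner: bounded_bilinear tensor_cinner
  by (rule bounded_bilinear_tensor_cinner)

lemma tensor_form_bound:
  obtains K where "K > 0"
    "\<And>(B :: ('n::finite, 'm::finite) coeff) \<xi> \<eta>. norm (tensor_form B \<xi> \<eta>) \<le> K * norm B * norm \<xi> * norm \<eta>"
proof -
  obtain K1 where K1: "K1 > 0"
    "\<And>(B :: ('n, 'm) coeff) \<xi>. norm (coeff_app B \<xi>) \<le> norm B * norm \<xi> * K1"
    using coeff_app.pos_bounded by blast
  obtain K2 where K2: "K2 > 0"
    "\<And>(\<xi> :: complex^'m^'n) \<eta>. norm (tensor_cinner \<xi> \<eta>) \<le> norm \<xi> * norm \<eta> * K2"
    using tensor_cinner.pos_bounded by blast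
  have "norm (tensor_form B \<xi> \<eta>) \<le> (K1 * K2) * norm B * norm \<xi> * norm \<eta>"
    for B :: "('n, 'm) coeff" and \<xi> \<eta>
  proof -
    have "norm (tensor_form B \<xi> \<eta>) \<le> norm (coeff_app B \<xi>) * norm \<eta> * K2"
      unfolding tensor_form_eq by (rule K2)
    also have "\<dots> \<le> (norm B * norm \<xi> * K1) * norm \<eta> * K2"
      using K1 K2 by (intro mult_right_mono) auto
    finally show ?thesis by (simp add: mult_ac)
  qed
  then show ?thesis using that[of "K1 * K2"] K1 K2 by simp
qed

lemma tensor_form_simps:
  "tensor_form B (\<xi> + \<zeta>) \<eta> = tensor_form B \<xi> \<eta> + tensor_form B \<zeta> \<eta>"
  "tensor_form B (\<xi> - \<zeta>) \<eta> = tensor_form B \<xi> \<eta> - tensor_form B \<zeta> \<eta>"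
  "tensor_form B (c *\<^sub>R \<xi>) \<eta> = c *\<^sub>R tensor_form B \<xi> \<eta>"
  "tensor_form B \<xi> (\<zeta> + \<eta>) = tensor_form B \<xi> \<zeta> + tensor_form B \<xi> \<eta>"
  "tensor_form B \<xi> (\<zeta> - \<eta>) = tensor_form B \<xi> \<zeta> - tensor_form B \<xi> \<eta>"
  "tensor_form B \<xi> (c *\<^sub>R \<eta>) = c *\<^sub>R tensor_form B \<xi> \<eta>"
  by (simp_all add: tensor_form_eq coeff_app.add_right coeff_app.diff_right coeff_app.scaleR_right
      tensor_cinner.add_left tensor_cinner.add_right tensor_cinner.diff_left tensor_cinner.diff_right
      tensor_cinner.scaleR_left tensor_cinner.scaleR_right)

lemma tensor_form_adjoint:
  fixes A :: "real^'a::finite \<Rightarrow> ('a, 'b::finite) coeff"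
  shows
  "tensor_form (adjoint_coeff A x) \<xi> \<eta> = cnj (tensor_form (A x) \<eta> \<xi>)"
proof -
  have swap: "(\<Sum>h\<in>UNIV. \<Sum>k\<in>UNIV. \<Sum>\<alpha>\<in>UNIV. \<Sum>\<beta>\<in>UNIV. f h k \<alpha> \<beta>)
    = (\<Sum>k\<in>UNIV. \<Sum>h\<in>UNIV. \<Sum>\<beta>\<in>UNIV. \<Sum>\<alpha>\<in>UNIV. f h k \<alpha> \<beta>)"
    for f :: "'a \<Rightarrow> 'a \<Rightarrow> 'b \<Rightarrow> 'b \<Rightarrow> complex"
  proof -
    have inner: "(\<Sum>\<alpha>\<in>UNIV. \<Sum>\<beta>\<in>UNIV. f h k \<alpha> \<beta>) = (\<Sum>\<beta>\<in>UNIV. \<Sum>\<alpha>\<in>UNIV. f h k \<alpha> \<beta>)" for h k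
      by (rule sum.swap)
    show ?thesis unfolding inner by (rule sum.swap)
  qed
  have "tensor_form (adjoint_coeff A x) \<xi> \<eta>
    = (\<Sum>k\<in>UNIV. \<Sum>h\<in>UNIV. \<Sum>\<beta>\<in>UNIV. \<Sum>\<alpha>\<in>UNIV.
        cnj (A x $ k $ h $ \<beta> $ \<alpha>) * \<xi> $ k $ \<beta> * cnj (\<eta> $ h $ \<alpha>))"
    unfolding tensor_form_def by (subst swap) (simp add: adjoint_coeff_def)
  also have "\<dots> = cnj (tensor_form (A x) \<eta> \<xi>)"
    unfolding tensor_form_def by (simp add: mult_ac)
  finally show ?thesis .
qed

text \<open>
  The integrand of all three conditions. The exponent enters through \<open>s = 1 - 2/p\<close>, and \<open>\<omega>\<close> is the
  direction of the function whose gradient is \<open>\<xi>\<close>.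
\<close>

definition p_form :: "('n::finite, 'm::finite) coeff \<Rightarrow> real \<Rightarrow> complex^'m \<Rightarrow> complex^'m^'n \<Rightarrow> complex" where
  "p_form B s \<omega> \<xi> = tensor_form B (\<xi> - s *\<^sub>R tensor_at \<xi> \<omega>) (\<xi> + s *\<^sub>R tensor_at \<xi> \<omega>)"

text \<open>
  The tensor \<open>q \<otimes> \<eta>\<close> with a real first factor: the gradient of a function that varies in the direction
  \<open>q\<close> only.
\<close>

definition rank_one :: "real^'n \<Rightarrow> 'b::real_normed_vector \<Rightarrow> 'b^'n" where
  "rank_one q \<eta> = (\<chi> h. q $ h *\<^sub>R \<eta>)"

lemma norm_rank_one: "norm (rank_one q \<eta>) = norm q * norm \<eta>"
proof -
  have "norm (rank_one q \<eta>) = L2_set (\<lambda>h. norm (q $ h) * norm \<eta>) UNIV"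
    by (simp add: rank_one_def norm_vec_def[of "\<chi> h. q $ h *\<^sub>R \<eta>"])
  also have "\<dots> = norm q * norm \<eta>"
    by (simp add: norm_vec_def[of q] L2_set_left_distrib)
  finally show ?thesis .
qed

lemma tensor_at_rank_one: "tensor_at (rank_one q \<eta>) \<omega> = rank_one q (inner \<omega> \<eta> *\<^sub>R \<omega>)"
  by (simp add: tensor_at_eq rank_one_def vec_eq_iff)

lemma tensor_at_conv_rank_one: "tensor_at \<xi> \<omega> = rank_one (\<chi> h. inner \<omega> (\<xi> $ h)) \<omega>"
  by (simp add: tensor_at_eq rank_one_def vec_eq_iff)

lemma rank_one_add: "rank_one q (\<eta> + \<zeta>) = rank_one q \<eta> + rank_one q \<zeta>"
  by (simp add: rank_one_def vec_eq_iff scaleR_add_right)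

lemma rank_one_diff: "rank_one q (\<eta> - \<zeta>) = rank_one q \<eta> - rank_one q \<zeta>"
  by (simp add: rank_one_def vec_eq_iff scaleR_diff_right)

lemma rank_one_scaleR: "rank_one q (c *\<^sub>R \<zeta>) = c *\<^sub>R rank_one q \<zeta>"
  by (simp add: rank_one_def vec_eq_iff)

text \<open>
  The symbol of \<open>A\<close> is the restriction of the form to rank-one tensors; this turns the weak condition
  into the strong one with a smaller set of tensors.
\<close>

lemma Re_cinner_symbol_matrix:
  fixes B :: "('a::finite, 'b::finite) coeff"
  shows
  "Re (cinner (symbol_matrix B q *v \<eta>) \<zeta>) = Re (tensor_form B (rank_one q \<eta>) (rank_one q \<zeta>))"
proof -
  have lin: "linear (\<lambda>M :: complex^'b^'b. M *v \<eta>)"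
    by (rule linearI)
       (simp_all add: matrix_vector_mult_def vec_eq_iff sum.distrib distrib_right scaleR_sum_right)
  have lin': "M *v (c *\<^sub>R \<eta>) = c *\<^sub>R (M *v \<eta>)" for M :: "complex^'b^'b" and c
    by (simp add: matrix_vector_mult_def vec_eq_iff scaleR_sum_right)
  have "symbol_matrix B q *v \<eta> = (\<Sum>h\<in>UNIV. \<Sum>k\<in>UNIV. (q $ h * q $ k) *\<^sub>R (B $ h $ k *v \<eta>))"
    unfolding symbol_matrix_def linear_sum[OF lin] linear_scale[OF lin] ..
  also have "\<dots> = (\<Sum>h\<in>UNIV. q $ h *\<^sub>R (coeff_app B (rank_one q \<eta>) $ h))"
    by (simp add: coeff_app_def rank_one_def lin' scaleR_sum_right)
  finally show ?thesis
    unfolding Re_cinner Re_tensor_form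
    by (simp add: inner_sum_left inner_vec_def[of "coeff_app _ _"] rank_one_def)
qed

text \<open>
  The polynomial in \<open>s\<close> whose concavity yields the intervals of exponents: its leading coefficient is minus
  the energy of \<open>\<xi>(\<omega>)\<close>.
\<close>

lemma p_form_expand:
  "Re (p_form B s \<omega> \<xi>) = Re (tensor_form B \<xi> \<xi>)
     + s * (Re (tensor_form B \<xi> (tensor_at \<xi> \<omega>)) - Re (tensor_form B (tensor_at \<xi> \<omega>) \<xi>))
     - s\<^sup>2 * Re (tensor_form B (tensor_at \<xi> \<omega>) (tensor_at \<xi> \<omega>))"
  by (simp add: p_form_def tensor_form_simps power2_eq_square algebra_simps)

lemma p_form_scaleR: "Re (p_form B s \<omega> (c *\<^sub>R \<xi>)) = c\<^sup>2 * Re (p_form B s \<omega> \<xi>)"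
  by (simp add: p_form_expand tensor_at_scaleR tensor_form_simps power2_eq_square algebra_simps)

lemma p_form_zero: "p_form B 0 \<omega> \<xi> = tensor_form B \<xi> \<xi>"
  by (simp add: p_form_def)

lemma p_form_adjoint: "p_form (adjoint_coeff A x) (- s) \<omega> \<xi> = cnj (p_form (A x) s \<omega> \<xi>)"
  by (simp add: p_form_def tensor_form_adjoint)

text \<open>
  The quadratic form is stable under changes of the tensor and of the direction. The factor \<open>norm \<xi>'\<close> next to
  \<open>norm (\<omega> - \<omega>')\<close> makes the estimate useful at the zeros of \<open>v\<close>, where the directions are far apart.
\<close>

lemma p_form_lipschitz:
  obtains K where "K > 0"
    "\<And>(B :: ('n::finite, 'm::finite) coeff) s \<omega> \<xi> \<omega>' \<xi>'.
      \<bar>s\<bar> \<le> 1 \<Longrightarrow> norm \<omega> \<le> 1 \<Longrightarrow> norm \<omega>' \<le> 1 \<Longrightarrow>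
      norm (p_form B s \<omega> \<xi> - p_form B s \<omega>' \<xi>')
        \<le> K * norm B * (norm \<xi> + norm \<xi>') * (norm (\<xi> - \<xi>') + norm (\<omega> - \<omega>') * norm \<xi>')"
proof -
  obtain K where K: "K > 0"
    "\<And>(B :: ('n, 'm) coeff) \<xi> \<eta>. norm (tensor_form B \<xi> \<eta>) \<le> K * norm B * norm \<xi> * norm \<eta>"
    using tensor_form_bound by blast
  have "norm (p_form B s \<omega> \<xi> - p_form B s \<omega>' \<xi>')
        \<le> (4 * K) * norm B * (norm \<xi> + norm \<xi>') * (norm (\<xi> - \<xi>') + norm (\<omega> - \<omega>') * norm \<xi>')"
    if s: "\<bar>s\<bar> \<le> 1" and w: "norm \<omega> \<le> 1" "norm \<omega>' \<le> 1"
    for B :: "('n, 'm) coeff" and s \<omega> \<xi> \<omega>' \<xi>'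
  proof -
    let ?T = "tensor_at \<xi> \<omega>" and ?T' = "tensor_at \<xi>' \<omega>'"
    let ?a = "\<xi> - s *\<^sub>R ?T" and ?b = "\<xi> + s *\<^sub>R ?T"
    let ?a' = "\<xi>' - s *\<^sub>R ?T'" and ?b' = "\<xi>' + s *\<^sub>R ?T'"
    let ?E = "norm (\<xi> - \<xi>') + norm (\<omega> - \<omega>') * norm \<xi>'"
    have sT: "norm (s *\<^sub>R x) \<le> norm x" for x :: "complex^'m^'n"
      using s by (simp add: mult_left_le_one_le)
    have TT: "norm (?T - ?T') \<le> norm (\<xi> - \<xi>') + 2 * (norm (\<omega> - \<omega>') * norm \<xi>')"
    proof -
      have "?T - ?T' = tensor_at (\<xi> - \<xi>') \<omega> + (tensor_at \<xi>' \<omega> - tensor_at \<xi>' \<omega>')"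
        by (simp add: tensor_at_diff)
      then show ?thesis
        using norm_tensor_at_le[OF w(1), of "\<xi> - \<xi>'"] norm_tensor_at_diff_le[OF w, of \<xi>']
        by (simp only:) (rule norm_triangle_le, linarith)
    qed
    have b: "norm ?b \<le> 2 * norm \<xi>"
      using norm_triangle_ineq[of \<xi> "s *\<^sub>R ?T"] sT[of ?T] norm_tensor_at_le[OF w(1), of \<xi>] by linarith
    have a': "norm ?a' \<le> 2 * norm \<xi>'"
      using norm_triangle_ineq4[of \<xi>' "s *\<^sub>R ?T'"] sT[of ?T'] norm_tensor_at_le[OF w(2), of \<xi>'] by linarith
    have aa: "norm (?a - ?a') \<le> 2 * ?E"
    proof -
      have eq: "?a - ?a' = (\<xi> - \<xi>') - s *\<^sub>R (?T - ?T')" by (simp add: algebra_simps)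
      show ?thesis unfolding eq distrib_left
        using norm_triangle_ineq4[of "\<xi> - \<xi>'" "s *\<^sub>R (?T - ?T')"] sT[of "?T - ?T'"] TT by linarith
    qed
    have bb: "norm (?b - ?b') \<le> 2 * ?E"
    proof -
      have eq: "?b - ?b' = (\<xi> - \<xi>') + s *\<^sub>R (?T - ?T')" by (simp add: algebra_simps)
      show ?thesis unfolding eq distrib_left
        using norm_triangle_ineq[of "\<xi> - \<xi>'" "s *\<^sub>R (?T - ?T')"] sT[of "?T - ?T'"] TT by linarith
    qed
    have KB: "0 \<le> K * norm B" using K by simp
    have "norm (p_form B s \<omega> \<xi> - p_form B s \<omega>' \<xi>')
      = norm (tensor_form B (?a - ?a') ?b + tensor_form B ?a' (?b - ?b'))"
      unfolding p_form_def tensor_form_simps(2)[of B ?a ?a'] tensor_form_simps(5)[of B ?a' ?b ?b'] by simp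
    also have "\<dots> \<le> K * norm B * norm (?a - ?a') * norm ?b + K * norm B * norm ?a' * norm (?b - ?b')"
      by (rule norm_triangle_le) (intro add_mono K(2))
    also have "\<dots> \<le> K * norm B * (2 * ?E) * (2 * norm \<xi>) + K * norm B * (2 * norm \<xi>') * (2 * ?E)"
      using K(1) KB a' b aa bb by (intro add_mono mult_mono mult_left_mono mult_nonneg_nonneg) auto
    also have "\<dots> = (4 * K) * norm B * (norm \<xi> + norm \<xi>') * ?E"
      by (simp add: algebra_simps)
    finally show ?thesis .
  qed
  then show ?thesis using that[of "4 * K"] K by simp
qed

lemma p_form_bound:
  obtains K where "K > 0"
    "\<And>(B :: ('n::finite, 'm::finite) coeff) s \<omega> \<xi>.
      \<bar>s\<bar> \<le> 1 \<Longrightarrow> norm \<omega> \<le> 1 \<Longrightarrow> norm (p_form B s \<omega> \<xi>) \<le> K * norm B * (norm \<xi>)\<^sup>2"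
proof -
  obtain K where K: "K > 0" "\<And>(B :: ('n::finite, 'm::finite) coeff) s \<omega> \<xi> \<omega>' \<xi>'.
      \<bar>s\<bar> \<le> 1 \<Longrightarrow> norm \<omega> \<le> 1 \<Longrightarrow> norm \<omega>' \<le> 1 \<Longrightarrow>
      norm (p_form B s \<omega> \<xi> - p_form B s \<omega>' \<xi>')
        \<le> K * norm B * (norm \<xi> + norm \<xi>') * (norm (\<xi> - \<xi>') + norm (\<omega> - \<omega>') * norm \<xi>')"
    using p_form_lipschitz by blast
  show ?thesis
  proof (rule that[OF K(1)])
    fix B :: "('n::finite, 'm::finite) coeff" and s :: real and \<omega> :: "complex^'m" and \<xi>
    assume "\<bar>s\<bar> \<le> 1" "norm \<omega> \<le> 1"
    from K(2)[OF this(1) this(2) this(2), of B \<xi> 0]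
    show "norm (p_form B s \<omega> \<xi>) \<le> K * norm B * (norm \<xi>)\<^sup>2"
      by (simp add: p_form_def tensor_at_eq tensor_form_eq coeff_app.zero_right tensor_cinner.zero_left
          power2_eq_square mult_ac flip: zero_vec_def)
  qed
qed

text \<open>
  Averaging over the directions. Substituting \<open>\<zeta> = (1 - s T) \<xi>\<close> turns the form into
  \<open>\<langle>A \<zeta>, \<zeta>\<rangle> + t \<langle>A \<zeta>, T \<zeta>\<rangle>\<close> with \<open>t = 2 s / (1 - s)\<close>. Summed over a real orthonormal basis of \<open>D\<close> vectors
  this is \<open>(D + t) \<langle>A \<zeta>, \<zeta>\<rangle>\<close>, where \<open>t > -1\<close> and \<open>D \<ge> 1\<close>.
\<close>

lemma p_form_coercive_imp_coercive:
  fixes B :: "('n::finite, 'm::finite) coeff"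
  assumes s: "\<bar>s\<bar> < 1" and C: "C > 0"
    and coer: "\<And>\<xi> \<omega>. norm \<omega> = 1 \<Longrightarrow> Re (p_form B s \<omega> \<xi>) \<ge> C * (norm \<xi>)\<^sup>2"
  shows "Re (tensor_form B \<zeta> \<zeta>) \<ge> C / (4 * (1 + 2 / (1 - s))) * (norm \<zeta>)\<^sup>2"
proof -
  define D where "D = real (DIM(complex^'m))"
  have D: "D \<ge> 1" unfolding D_def using DIM_positive[where 'a = "complex^'m"] by linarith
  define t where "t = 2 * s / (1 - s)"
  have t: "t > -1" "t \<le> 2 / (1 - s)" using s
    by (auto simp: t_def intro!: divide_right_mono) (simp add: field_simps)
  have each: "C / 4 * (norm \<zeta>)\<^sup>2 \<le> inner (coeff_app B \<zeta>) \<zeta> + t * inner (coeff_app B \<zeta>) (tensor_at \<zeta> \<omega>)"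
    if \<omega>: "\<omega> \<in> Basis" for \<omega> :: "complex^'m"
  proof -
    have n1: "norm \<omega> = 1" using \<omega> by simp
    \<comment> \<open>\<open>T\<close> is a projection, so the inverse of \<open>1 - s T\<close> is \<open>1 + (s / (1 - s)) T\<close>.\<close>
    define \<xi> where "\<xi> = \<zeta> + (s / (1 - s)) *\<^sub>R tensor_at \<zeta> \<omega>"
    have T: "tensor_at \<xi> \<omega> = (1 / (1 - s)) *\<^sub>R tensor_at \<zeta> \<omega>"
    proof -
      have "1 + s / (1 - s) = 1 / (1 - s)" using s by (simp add: field_simps)
      then show ?thesis
        by (simp add: \<xi>_def tensor_at_add tensor_at_scaleR tensor_at_idem[OF n1] flip: scaleR_left_distrib)
           (metis scaleR_left_distrib scaleR_one)
    qed
    have m: "\<xi> - s *\<^sub>R tensor_at \<xi> \<omega> = \<zeta>"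
      unfolding T by (simp add: \<xi>_def)
    have p: "\<xi> + s *\<^sub>R tensor_at \<xi> \<omega> = \<zeta> + t *\<^sub>R tensor_at \<zeta> \<omega>"
    proof -
      have "s / (1 - s) + s * (1 / (1 - s)) = t" by (simp add: t_def)
      then show ?thesis
        unfolding T scaleR_scaleR by (simp only: \<xi>_def add.assoc scaleR_left_distrib[symmetric])
    qed
    have "norm \<zeta> \<le> norm \<xi> + norm (s *\<^sub>R tensor_at \<xi> \<omega>)"
      using norm_triangle_ineq4[of \<xi> "s *\<^sub>R tensor_at \<xi> \<omega>"] unfolding m .
    also have "\<dots> \<le> norm \<xi> + 1 * norm \<xi>"
      using s n1 norm_tensor_at_le[of \<omega> \<xi>] unfolding norm_scaleR by (intro add_left_mono mult_mono) auto
    finally have "(norm \<zeta>)\<^sup>2 \<le> (2 * norm \<xi>)\<^sup>2" by (intro power_mono) auto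
    then have "C / 4 * (norm \<zeta>)\<^sup>2 \<le> C * (norm \<xi>)\<^sup>2" using C by (simp add: power_mult_distrib)
    also have "\<dots> \<le> Re (p_form B s \<omega> \<xi>)" by (rule coer[OF n1])
    also have "\<dots> = inner (coeff_app B \<zeta>) (\<zeta> + t *\<^sub>R tensor_at \<zeta> \<omega>)"
      unfolding p_form_def m p Re_tensor_form ..
    finally show ?thesis by (simp add: inner_add_right)
  qed
  have repr: "(\<Sum>\<omega>\<in>Basis. tensor_at \<zeta> \<omega>) = \<zeta>"
  proof -
    have "(\<Sum>\<omega>\<in>Basis. inner \<omega> y *\<^sub>R \<omega>) = y" for y :: "complex^'m"
      unfolding inner_commute[of _ y] by (rule euclidean_representation)
    then show ?thesis by (simp add: vec_eq_iff tensor_at_eq)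
  qed
  have "D * (C / 4 * (norm \<zeta>)\<^sup>2) = (\<Sum>\<omega>\<in>(Basis :: (complex^'m) set). C / 4 * (norm \<zeta>)\<^sup>2)"
    by (simp add: D_def)
  also have "\<dots> \<le> (\<Sum>\<omega>\<in>Basis. inner (coeff_app B \<zeta>) \<zeta> + t * inner (coeff_app B \<zeta>) (tensor_at \<zeta> \<omega>))"
    by (rule sum_mono) (rule each)
  also have "\<dots> = D * inner (coeff_app B \<zeta>) \<zeta> + t * inner (coeff_app B \<zeta>) \<zeta>"
    by (simp add: sum.distrib D_def repr flip: sum_distrib_left inner_sum_right)
  finally have 1: "C / 4 * (D * (norm \<zeta>)\<^sup>2) \<le> (D + t) * inner (coeff_app B \<zeta>) \<zeta>"
    by (simp add: algebra_simps)
  define u where "u = 1 + 2 / (1 - s)"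
  have u: "u > 0" using s by (simp add: u_def add_pos_pos)
  have pos: "D + t > 0" using D t by simp
  have "0 \<le> C / 4 * (D * (norm \<zeta>)\<^sup>2)" using C D by simp
  with 1 have nn: "0 \<le> inner (coeff_app B \<zeta>) \<zeta>"
    using pos by (meson order_trans zero_le_mult_iff not_le)
  have "D + t \<le> D * u"
  proof -
    have "1 * (2 / (1 - s)) \<le> D * (2 / (1 - s))"
      using D s by (intro mult_right_mono) auto
    with t have "t \<le> D * (2 / (1 - s))" by linarith
    then show ?thesis by (simp add: u_def algebra_simps)
  qed
  from mult_right_mono[OF this nn] 1
  have "D * (C / 4 * (norm \<zeta>)\<^sup>2) \<le> D * (u * inner (coeff_app B \<zeta>) \<zeta>)" by (simp add: mult_ac)
  then have "C / 4 * (norm \<zeta>)\<^sup>2 \<le> u * inner (coeff_app B \<zeta>) \<zeta>" using D by simp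
  then show ?thesis using u unfolding Re_tensor_form u_def[symmetric]
    by (simp add: field_simps)
qed

section \<open>Smooth functions and bumps\<close>

lemma C_k_SucI:
  assumes "\<And>x. (f has_derivative f' x) (at x)" "\<And>u. C_k k (\<lambda>x. f' x u)"
  shows "C_k (Suc k) f"
proof -
  have "f' = (\<lambda>x. frechet_derivative f (at x))"
    using frechet_derivative_at[OF assms(1)] by blast
  then show ?thesis using assms by (auto simp: differentiable_def)
qed

lemma C_k_SucD:
  assumes "C_k (Suc k) f"
  shows "(f has_derivative frechet_derivative f (at x)) (at x)" "C_k k (\<lambda>x. frechet_derivative f (at x) u)"
  using assms by (auto simp: frechet_derivative_works)

text \<open>
  Not immediate from the recursive definition, in which the class of order 0 is the only one that mentions
  continuity.
\<close>

lemma C_k_mono_Suc: "C_k (Suc k) f \<Longrightarrow> C_k k f"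
proof (induction k arbitrary: f)
  case 0
  then show ?case
    by (auto simp: continuous_on_eq_continuous_at differentiable_imp_continuous_within)
next
  case (Suc k)
  show ?case
    by (rule C_k_SucI[OF C_k_SucD(1)[OF Suc.prems]]) (intro Suc.IH C_k_SucD(2) Suc.prems)
qed

lemma C_k_imp_continuous: "C_k k f \<Longrightarrow> continuous_on UNIV f"
proof (induction k)
  case (Suc k)
  then show ?case using C_k_mono_Suc by blast
qed simp

lemma C_k_const: "C_k k (\<lambda>x. c)"
proof (induction k arbitrary: c)
  case (Suc k)
  show ?case by (rule C_k_SucI[where f' = "\<lambda>x u. 0"]) (auto intro: Suc)
qed simp

lemma C_k_add: "C_k k f \<Longrightarrow> C_k k g \<Longrightarrow> C_k k (\<lambda>x. f x + g x)"
proof (induction k arbitrary: f g)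
  case 0
  then show ?case by (simp add: continuous_on_add)
next
  case (Suc k)
  show ?case
    by (rule C_k_SucI[OF has_derivative_add[OF C_k_SucD(1)[OF Suc.prems(1)] C_k_SucD(1)[OF Suc.prems(2)]]])
       (intro Suc.IH C_k_SucD(2) Suc.prems)
qed

lemma C_k_bounded_linear: "bounded_linear L \<Longrightarrow> C_k k f \<Longrightarrow> C_k k (\<lambda>x. L (f x))"
proof (induction k arbitrary: f)
  case 0
  then show ?case by (simp add: bounded_linear.continuous_on)
next
  case (Suc k)
  show ?case
    by (rule C_k_SucI[OF bounded_linear.has_derivative[OF Suc.prems(1) C_k_SucD(1)[OF Suc.prems(2)]]])
       (intro Suc.IH C_k_SucD(2) Suc.prems)
qed

lemma C_k_bounded_bilinear:
  assumes B: "bounded_bilinear B"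
  shows "C_k k f \<Longrightarrow> C_k k g \<Longrightarrow> C_k k (\<lambda>x. B (f x) (g x))"
proof (induction k arbitrary: f g)
  case 0
  then show ?case using bounded_bilinear.continuous_on[OF B] by auto
next
  case (Suc k)
  show ?case
    by (rule C_k_SucI[OF bounded_bilinear.FDERIV[OF B C_k_SucD(1)[OF Suc.prems(1)] C_k_SucD(1)[OF Suc.prems(2)]]])
       (intro C_k_add Suc.IH C_k_SucD(2)[OF Suc.prems(1)] C_k_SucD(2)[OF Suc.prems(2)]
          C_k_mono_Suc[OF Suc.prems(1)] C_k_mono_Suc[OF Suc.prems(2)])
qed

lemma C_k_id: "C_k k (\<lambda>x. x)"
proof (cases k)
  case (Suc j)
  show ?thesis unfolding Suc by (rule C_k_SucI[OF has_derivative_ident]) (rule C_k_const)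
qed simp

text \<open>
  Induction on the order of differentiability needs a family that is closed under differentiation. A recursion
  with two terms covers both families used below: the shifts of the sine by multiples of \<open>\<pi>/2\<close>
  (coefficients 1 and 0) and \<open>exp_flat\<close> (coefficients \<open>- i\<close> and 1).
\<close>

lemma C_k_real_family:
  fixes f :: "nat \<Rightarrow> real \<Rightarrow> real" and u :: "'a::real_normed_vector \<Rightarrow> real"
  assumes der: "\<And>i t. (f i has_real_derivative a i * f (i + 1) t + b i * f (i + 2) t) (at t)"
  shows "C_k k u \<Longrightarrow> C_k k (\<lambda>x. f i (u x))"
proof (induction k arbitrary: i)
  case 0
  have "continuous_on UNIV (f i)"
    using der by (intro DERIV_continuous_on) (blast intro: has_field_derivative_at_within)
  then show ?case using 0 by (auto intro: continuous_on_compose2)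
next
  case (Suc k)
  let ?u' = "\<lambda>x. frechet_derivative u (at x)"
  have d: "((\<lambda>x. f i (u x)) has_derivative (\<lambda>h. ?u' x h * (a i * f (i + 1) (u x) + b i * f (i + 2) (u x)))) (at x)" for x
    using DERIV_compose_FDERIV[OF der C_k_SucD(1)[OF Suc.prems]] .
  show ?case
    by (rule C_k_SucI[OF d])
       (intro C_k_bounded_bilinear[OF bounded_bilinear_mult] C_k_add C_k_const Suc.IH
          C_k_SucD(2)[OF Suc.prems] C_k_mono_Suc[OF Suc.prems])
qed

definition smooth :: "('a::real_normed_vector \<Rightarrow> 'b::real_normed_vector) \<Rightarrow> bool" where
  "smooth f \<longleftrightarrow> (\<forall>k. C_k k f)"

lemma smooth_const: "smooth (\<lambda>x. c)"
  by (simp add: smooth_def C_k_const)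

lemma smooth_id: "smooth (\<lambda>x. x)"
  by (simp add: smooth_def C_k_id)

lemma smooth_add: "smooth f \<Longrightarrow> smooth g \<Longrightarrow> smooth (\<lambda>x. f x + g x)"
  by (simp add: smooth_def C_k_add)

lemma smooth_bounded_linear: "bounded_linear L \<Longrightarrow> smooth f \<Longrightarrow> smooth (\<lambda>x. L (f x))"
  by (simp add: smooth_def C_k_bounded_linear)

lemma smooth_scaleR:
  shows "smooth f \<Longrightarrow> smooth g \<Longrightarrow> smooth (\<lambda>x. f x *\<^sub>R g x)"
  by (simp add: smooth_def C_k_bounded_bilinear[OF bounded_bilinear_scaleR])

lemma smooth_mult:
  fixes f g :: "'a::real_normed_vector \<Rightarrow> 'b::real_normed_algebra"
  shows "smooth f \<Longrightarrow> smooth g \<Longrightarrow> smooth (\<lambda>x. f x * g x)"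
  by (simp add: smooth_def C_k_bounded_bilinear[OF bounded_bilinear_mult])

lemma smooth_inner:
  shows "smooth f \<Longrightarrow> smooth g \<Longrightarrow> smooth (\<lambda>x. inner (f x) (g x))"
  by (simp add: smooth_def C_k_bounded_bilinear[OF bounded_bilinear_inner])

lemma smooth_diff: "smooth f \<Longrightarrow> smooth g \<Longrightarrow> smooth (\<lambda>x. f x - g x)"
  using smooth_add[OF _ smooth_bounded_linear[OF bounded_linear_minus[OF bounded_linear_ident]], of f g] by simp

lemma smooth_power:
  fixes f :: "'a::real_normed_vector \<Rightarrow> real"
  shows "smooth f \<Longrightarrow> smooth (\<lambda>x. f x ^ n)"
  by (induction n) (auto intro: smooth_const smooth_mult)

lemma smooth_prod:
  fixes f :: "'i \<Rightarrow> 'a::real_normed_vector \<Rightarrow> real"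
  assumes "\<And>i. i \<in> I \<Longrightarrow> smooth (f i)"
  shows "smooth (\<lambda>x. \<Prod>i\<in>I. f i x)"
  using assms by (induction I rule: infinite_finite_induct) (auto intro: smooth_const smooth_mult)

lemma smooth_sin:
  fixes u :: "'a::real_normed_vector \<Rightarrow> real"
  assumes "smooth u" shows "smooth (\<lambda>x. sin (u x))"
proof -
  define f where "f i t = sin (t + real i * (pi / 2))" for i t
  have "(f i has_real_derivative 1 * f (i + 1) t + 0 * f (i + 2) t) (at t)" for i t
  proof -
    have "f (i + 1) t = sin ((t + real i * (pi / 2)) + pi / 2)"
      unfolding f_def by (simp only: of_nat_add of_nat_1 distrib_right add.assoc mult_1)
    also have "\<dots> = cos (t + real i * (pi / 2))" by (simp only: sin_add cos_pi_half sin_pi_half mult_0_right mult_1_right add_0)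
    finally show ?thesis unfolding f_def[of i] by (auto intro!: derivative_eq_intros)
  qed
  then have "C_k k (\<lambda>x. f 0 (u x))" for k
    using C_k_real_family[where f = f, of "\<lambda>i. 1" "\<lambda>i. 0" k u 0] assms unfolding smooth_def by blast
  then show ?thesis by (simp add: smooth_def f_def)
qed

text \<open>
  The functions \<open>t\<^sup>-\<^sup>i exp(-1/t)\<close>, extended by 0 to \<open>t \<le> 0\<close>. Every derivative of the classical flat
  function \<open>exp_flat 0\<close> is a linear combination of them.
\<close>

definition exp_flat :: "nat \<Rightarrow> real \<Rightarrow> real" where
  "exp_flat i t = (if t > 0 then (1 / t) ^ i * exp (- (1 / t)) else 0)"

lemma exp_flat_tendsto_0: "(exp_flat i \<longlongrightarrow> 0) (at_right 0)"
proof -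
  have "((\<lambda>t. inverse t ^ i / exp (inverse t)) \<longlongrightarrow> 0) (at_right (0::real))"
    by (rule filterlim_compose[OF tendsto_power_div_exp_0 filterlim_inverse_at_top_right])
  moreover have "\<forall>\<^sub>F t in at_right 0. inverse t ^ i / exp (inverse t) = exp_flat i t"
    using eventually_at_right_less[of 0]
    by eventually_elim (simp only: exp_flat_def exp_minus divide_inverse mult_1 if_True)
  ultimately show ?thesis by (rule Lim_transform_eventually)
qed

lemma exp_flat_deriv:
  "(exp_flat i has_real_derivative - real i * exp_flat (i + 1) t + 1 * exp_flat (i + 2) t) (at t)"
proof -
  consider "t > 0" | "t < 0" | "t = 0" by linarith
  then show ?thesis
  proof cases
    case 1
    define y where "y = 1 / t"
    have d: "((\<lambda>t. 1 / t) has_real_derivative - y\<^sup>2) (at t)"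
      using 1 by (auto intro!: derivative_eq_intros simp: y_def power2_eq_square)
    have "((\<lambda>t. (1 / t) ^ i * exp (- (1 / t))) has_real_derivative
        real i * (- y\<^sup>2 * y ^ (i - Suc 0)) * exp (- y) + exp (- y) * y\<^sup>2 * y ^ i) (at t)"
      using DERIV_mult[OF DERIV_power[OF d, of i] DERIV_fun_exp[OF DERIV_minus[OF d]]]
      by (simp add: y_def[symmetric] mult_ac)
    moreover have "real i * (- y\<^sup>2 * y ^ (i - Suc 0)) * exp (- y) + exp (- y) * y\<^sup>2 * y ^ i
        = - real i * exp_flat (i + 1) t + 1 * exp_flat (i + 2) t"
    proof (cases "i = 0")
      case False
      then have "y\<^sup>2 * y ^ (i - Suc 0) = y ^ (i + 1)"
        by (cases i) (simp_all add: power2_eq_square)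
      then show ?thesis using 1 by (simp add: exp_flat_def flip: y_def) (simp add: power2_eq_square mult_ac)
    qed (use 1 in \<open>simp add: exp_flat_def y_def power2_eq_square mult_ac\<close>)
    ultimately have "((\<lambda>t. (1 / t) ^ i * exp (- (1 / t))) has_real_derivative
        - real i * exp_flat (i + 1) t + 1 * exp_flat (i + 2) t) (at t)"
      by simp
    then show ?thesis
      by (rule has_field_derivative_transform_within_open[where S = "{0<..}"])
         (use 1 in \<open>auto simp: exp_flat_def\<close>)
  next
    case 2
    have "((\<lambda>t. 0) has_real_derivative - real i * exp_flat (i + 1) t + 1 * exp_flat (i + 2) t) (at t)"
      using 2 by (simp add: exp_flat_def)
    then show ?thesis
      by (rule has_field_derivative_transform_within_open[where S = "{..<0}"])
         (use 2 in \<open>auto simp: exp_flat_def\<close>)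
  next
    case 3
    have R: "((\<lambda>h. (exp_flat i (0 + h) - exp_flat i 0) / h) \<longlongrightarrow> 0) (at_right 0)"
      by (rule Lim_transform_eventually[OF exp_flat_tendsto_0[of "Suc i"]],
          use eventually_at_right_less[of 0] in eventually_elim) (simp add: exp_flat_def)
    have L: "((\<lambda>h. (exp_flat i (0 + h) - exp_flat i 0) / h) \<longlongrightarrow> 0) (at_left 0)"
      by (rule Lim_transform_eventually[OF tendsto_const],
          simp add: eventually_at_filter exp_flat_def)
    show ?thesis unfolding 3 DERIV_def
      using filterlim_split_at_real[OF L R] by (simp add: exp_flat_def)
  qed
qed

text \<open>
  Using the square of the distance keeps the argument of \<open>exp_flat 0\<close> a polynomial, hence smooth also
  at the centre.
\<close>

definition bump :: "'a::euclidean_space \<Rightarrow> real \<Rightarrow> 'a \<Rightarrow> real" where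
  "bump a r x = exp_flat 0 (r * r - inner (x - a) (x - a))"

lemma smooth_bump: "smooth (bump a r)"
proof -
  have "smooth (\<lambda>x. r * r - inner (x - a) (x - a))"
    by (intro smooth_diff smooth_const smooth_inner smooth_id)
  then have "C_k k (\<lambda>x. exp_flat 0 (r * r - inner (x - a) (x - a)))" for k
    by (intro C_k_real_family[where f = exp_flat, OF exp_flat_deriv]) (simp add: smooth_def)
  then show ?thesis by (simp add: smooth_def bump_def[abs_def])
qed

lemma bump_pos_iff: "r > 0 \<Longrightarrow> bump a r x > 0 \<longleftrightarrow> x \<in> ball a r"
  using norm_lt_square[of "x - a" r]
  by (auto simp: bump_def exp_flat_def dist_norm norm_minus_commute power2_eq_square)

lemma bump_range: "0 \<le> bump a r x" "bump a r x < 1"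
  by (simp_all add: bump_def exp_flat_def)

section \<open>Test functions and integration by parts\<close>

lemma test_functionsI:
  assumes "smooth \<phi>" "compact K" "K \<subseteq> \<Omega>" "\<And>x. x \<notin> K \<Longrightarrow> \<phi> x = 0"
  shows "\<phi> \<in> test_functions \<Omega>"
proof -
  have "closure {x. \<phi> x \<noteq> 0} \<subseteq> K"
    using assms by (intro closure_minimal compact_imp_closed) auto
  moreover from this have "compact (closure {x. \<phi> x \<noteq> 0})"
    using assms(2) closed_closure compact_Int_closed by (metis inf.absorb2)
  ultimately show ?thesis using assms by (auto simp: test_functions_def smooth_def)
qed

lemma test_functionsE:
  assumes "\<phi> \<in> test_functions \<Omega>"
  obtains K where "smooth \<phi>" "compact K" "K \<subseteq> \<Omega>" "\<forall>x. x \<notin> K \<longrightarrow> \<phi> x = 0"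
proof (rule that[of "closure {x. \<phi> x \<noteq> 0}"])
  show "\<forall>x. x \<notin> closure {x. \<phi> x \<noteq> 0} \<longrightarrow> \<phi> x = 0"
    using closure_subset[of "{x. \<phi> x \<noteq> 0}"] by auto
qed (use assms in \<open>auto simp: test_functions_def smooth_def\<close>)

lemma test_functions_scaleR:
  assumes "\<psi> \<in> test_functions \<Omega>" "smooth f"
  shows "(\<lambda>x. \<psi> x *\<^sub>R f x) \<in> test_functions \<Omega>"
proof -
  obtain K where K0: "smooth \<psi>" "compact K" "K \<subseteq> \<Omega>" "\<forall>x. x \<notin> K \<longrightarrow> \<psi> x = 0"
    using assms(1) by (rule test_functionsE)
  note K = K0(1-3) K0(4)[rule_format]
  show ?thesis using K assms(2) by (intro test_functionsI[of _ K] smooth_scaleR) auto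
qed

lemma smooth_has_derivative:
  "smooth f \<Longrightarrow> (f has_derivative frechet_derivative f (at x)) (at x)"
  unfolding smooth_def using C_k_SucD(1) by blast

lemma smooth_continuous_on: "smooth f \<Longrightarrow> continuous_on S f"
  unfolding smooth_def using C_k_imp_continuous continuous_on_subset subset_UNIV by blast

lemma smooth_partial_deriv: "smooth f \<Longrightarrow> smooth (partial_deriv h f)"
  unfolding smooth_def partial_deriv_def[abs_def] using C_k_SucD(2) by blast

lemma frechet_derivative_zero_outside:
  assumes "compact K" "\<And>x. x \<notin> K \<Longrightarrow> \<phi> x = 0" "x \<notin> K"
  shows "frechet_derivative \<phi> (at x) u = 0"
proof -
  have "((\<lambda>_. 0) has_derivative (\<lambda>_. 0)) (at x)" by simp
  then have "(\<phi> has_derivative (\<lambda>_. 0)) (at x)"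
    by (rule has_derivative_transform_within_open[where s = "- K"])
       (use assms in \<open>auto simp: compact_imp_closed open_Compl\<close>)
  from frechet_derivative_at[OF this, symmetric] show ?thesis by simp
qed

lemma test_functions_partial_deriv:
  assumes "\<phi> \<in> test_functions \<Omega>"
  shows "partial_deriv h \<phi> \<in> test_functions \<Omega>"
proof -
  obtain K where K0: "smooth \<phi>" "compact K" "K \<subseteq> \<Omega>" "\<forall>x. x \<notin> K \<longrightarrow> \<phi> x = 0"
    using assms by (rule test_functionsE)
  note K = K0(1-3) K0(4)[rule_format]
  have "partial_deriv h \<phi> x = 0" if "x \<notin> K" for x
    unfolding partial_deriv_def using frechet_derivative_zero_outside[OF K(2) _ that] K(4) by blast
  then show ?thesis using K by (intro test_functionsI[of _ K] smooth_partial_deriv) auto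
qed

lemma integrable_lborel_compact_support:
  fixes f :: "'a::euclidean_space \<Rightarrow> 'b::euclidean_space"
  assumes "continuous_on UNIV f" "compact K" "\<And>x. x \<notin> K \<Longrightarrow> f x = 0"
  shows "integrable lborel f"
proof -
  have "integrable lborel (\<lambda>x. indicator K x *\<^sub>R f x)"
    using assms(1,2) continuous_on_subset by (intro borel_integrable_compact) blast+
  moreover have "(\<lambda>x. indicator K x *\<^sub>R f x) = f"
    using assms(3) by (auto simp: indicator_def)
  ultimately show ?thesis by simp
qed

lemma lebesgue_on_compact_support:
  fixes f :: "'a::euclidean_space \<Rightarrow> 'b::euclidean_space"
  assumes "open \<Omega>" "continuous_on UNIV f" "compact K" "K \<subseteq> \<Omega>"
    and z: "\<And>x. x \<notin> K \<Longrightarrow> f x = 0"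
  shows "integrable (lebesgue_on \<Omega>) f" "(LINT x|lebesgue_on \<Omega>. f x) = (LINT x|lborel. f x)"
proof -
  have \<Omega>: "\<Omega> \<inter> space lebesgue \<in> sets lebesgue" using assms(1) by auto
  have eq: "(\<lambda>x. indicator \<Omega> x *\<^sub>R f x) = f"
  proof
    show "indicator \<Omega> x *\<^sub>R f x = f x" for x
      using assms(4) z[of x] by (cases "x \<in> \<Omega>") auto
  qed
  have i: "integrable lborel f" by (rule integrable_lborel_compact_support[OF assms(2,3) z])
  then have "integrable lebesgue f" by (simp add: integrable_completion[OF borel_measurable_integrable[OF i]])
  then show "integrable (lebesgue_on \<Omega>) f"
    unfolding integrable_restrict_space[OF \<Omega>] eq .
  have "(LINT x|lebesgue_on \<Omega>. f x) = (LINT x|lebesgue. f x)"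
    unfolding integral_restrict_space[OF \<Omega>] eq ..
  also have "\<dots> = (LINT x|lborel. f x)"
    by (rule integral_completion[OF borel_measurable_integrable[OF i]])
  finally show "(LINT x|lebesgue_on \<Omega>. f x) = (LINT x|lborel. f x)" .
qed

text \<open>
  The difference quotients in the direction of a coordinate axis have integral 0, because Lebesgue measure is
  invariant under translations. They converge to the partial derivative and, by the mean value theorem, stay
  below a constant multiple of the indicator of a ball, so that the integrals converge as well.
\<close>

lemma integral_partial_deriv_eq_0:
  fixes f :: "real^'n::finite \<Rightarrow> 'b::euclidean_space"
  assumes "f \<in> test_functions \<Omega>"
  shows "(LINT x|lborel. partial_deriv h f x) = 0"
proof -
  obtain K where K0: "smooth f" "compact K" "K \<subseteq> \<Omega>" "\<forall>x. x \<notin> K \<longrightarrow> f x = 0"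
    using assms by (rule test_functionsE)
  note K = K0(1-3) K0(4)[rule_format]
  obtain K' where K'0: "smooth (partial_deriv h f)" "compact K'" "\<forall>x. x \<notin> K' \<longrightarrow> partial_deriv h f x = 0"
    using test_functions_partial_deriv[OF assms] by (rule test_functionsE)
  note K' = K'0(1,2) K'0(3)[rule_format]
  obtain R where R: "\<And>x. x \<in> K \<Longrightarrow> norm x \<le> R"
    using compact_imp_bounded[OF K(2)] by (auto simp: bounded_iff)
  have "bounded (partial_deriv h f ` K')"
    by (intro compact_imp_bounded compact_continuous_image K' smooth_continuous_on)
  then obtain B where B: "\<And>x. x \<in> K' \<Longrightarrow> norm (partial_deriv h f x) \<le> B"
    by (auto simp: bounded_iff)
  \<comment> \<open>If the support is empty, \<open>B\<close> may be negative.\<close>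
  define C where "C = max B 0"
  have C: "norm (partial_deriv h f x) \<le> C" for x
    using B[of x] K'(3)[of x] by (cases "x \<in> K'") (auto simp: C_def)
  define e :: "real^'n" where "e = axis h 1"
  have e: "norm e = 1" by (simp add: e_def norm_axis_1)
  define t where "t j = inverse (real (Suc j))" for j
  have t: "0 < t j" "t j \<le> 1" for j by (auto simp: t_def divide_simps)
  have t0: "t \<longlonglongrightarrow> 0" unfolding t_def by (rule LIMSEQ_inverse_real_of_nat)
  let ?D = "\<lambda>x. frechet_derivative f (at x)"
  define g where "g j x = (f (x + t j *\<^sub>R e) - f x) /\<^sub>R t j" for j x
  have cf: "continuous_on UNIV f" by (rule smooth_continuous_on[OF K(1)])
  have cft: "continuous_on UNIV (\<lambda>x. f (x + c))" for c
    by (rule continuous_on_compose2[OF cf]) (auto intro!: continuous_intros)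
  have lim: "(\<lambda>j. g j x) \<longlonglongrightarrow> partial_deriv h f x" for x
  proof -
    have D: "((\<lambda>y. norm (f (x + y) - f x - ?D x y) / norm y) \<longlongrightarrow> 0) (at 0)"
      using smooth_has_derivative[OF K(1), of x] unfolding has_derivative_at by blast
    have "filterlim (\<lambda>j. t j *\<^sub>R e) (at 0) sequentially"
      using tendsto_scaleR[OF t0 tendsto_const[of e]] t(1) e
      by (auto simp: filterlim_at less_imp_neq[THEN not_sym] intro!: always_eventually)
    from filterlim_compose[OF D this]
    have "(\<lambda>j. norm (f (x + t j *\<^sub>R e) - f x - ?D x (t j *\<^sub>R e)) / norm (t j *\<^sub>R e)) \<longlonglongrightarrow> 0" .
    moreover have "norm (f (x + t j *\<^sub>R e) - f x - ?D x (t j *\<^sub>R e)) / norm (t j *\<^sub>R e)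
        = norm (g j x - partial_deriv h f x)" for j
    proof -
      have "linear (?D x)"
        using smooth_has_derivative[OF K(1), of x] by (rule has_derivative_linear)
      then have "?D x (t j *\<^sub>R e) = t j *\<^sub>R partial_deriv h f x"
        by (simp add: linear_scale partial_deriv_def e_def)
      then have "g j x - partial_deriv h f x = (f (x + t j *\<^sub>R e) - f x - ?D x (t j *\<^sub>R e)) /\<^sub>R t j"
        using t(1)[of j] by (simp add: g_def scaleR_diff_right)
      then show ?thesis using t(1)[of j] e by (simp add: divide_inverse mult.commute)
    qed
    ultimately have "(\<lambda>j. norm (g j x - partial_deriv h f x)) \<longlonglongrightarrow> 0" by simp
    then show ?thesis by (simp add: tendsto_norm_zero_iff LIM_zero_iff)
  qed
  have bound: "norm (g j x) \<le> C * indicator (cball 0 (R + 1)) x" for j x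
  proof (cases "x \<in> cball 0 (R + 1)")
    case True
    let ?l = "\<lambda>s. f (x + s *\<^sub>R e)"
    have "norm (?l (t j) - ?l 0) \<le> C * norm (t j - 0)"
    proof (rule differentiable_bound[where S = UNIV and f' = "\<lambda>s r. r *\<^sub>R partial_deriv h f (x + s *\<^sub>R e)"])
      fix s :: real
      have "(?l has_derivative (\<lambda>r. ?D (x + s *\<^sub>R e) (r *\<^sub>R e))) (at s)"
        by (rule has_derivative_compose[OF _ smooth_has_derivative[OF K(1)]])
           (auto intro!: derivative_eq_intros)
      moreover have "linear (?D (x + s *\<^sub>R e))"
        using smooth_has_derivative[OF K(1)] by (rule has_derivative_linear)
      ultimately show "(?l has_derivative (\<lambda>r. r *\<^sub>R partial_deriv h f (x + s *\<^sub>R e))) (at s within UNIV)"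
        by (simp add: linear_scale partial_deriv_def e_def)
      show "onorm (\<lambda>r. r *\<^sub>R partial_deriv h f (x + s *\<^sub>R e)) \<le> C"
        using C[of "x + s *\<^sub>R e"] by (intro onorm_le) (simp add: mult.commute[of C] mult_left_mono)
    qed auto
    then show ?thesis using True t[of j] by (simp add: g_def divide_simps mult.commute)
  next
    case False
    then have n: "norm x > R + 1" by simp
    have "norm (x + t j *\<^sub>R e) \<ge> norm x - norm (t j *\<^sub>R e)" by (rule norm_diff_ineq)
    then have "norm (x + t j *\<^sub>R e) > R" using n t[of j] e by simp
    then have "f (x + t j *\<^sub>R e) = 0" "f x = 0" using R K(4) n by (force simp: not_le)+
    then show ?thesis by (simp add: g_def C_def)
  qed
  have int_g: "(LINT x|lborel. g j x) = 0" for j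
  proof -
    have i: "integrable lborel f" by (rule integrable_lborel_compact_support[OF cf K(2,4)])
    have i': "integrable lborel (\<lambda>x. f (x + t j *\<^sub>R e))"
    proof (rule integrable_lborel_compact_support[OF cft])
      show "compact ((\<lambda>y. y - t j *\<^sub>R e) ` K)"
        by (intro compact_continuous_image K(2) continuous_intros)
      show "f (x + t j *\<^sub>R e) = 0" if "x \<notin> (\<lambda>y. y - t j *\<^sub>R e) ` K" for x
        using that by (intro K(4)) (metis add_diff_cancel image_eqI)
    qed
    have "(LINT x|lborel. f x) = (LINT x|distr lborel borel ((+) (t j *\<^sub>R e)). f x)"
      by (simp add: lborel_distr_plus)
    also have "\<dots> = (LINT x|lborel. f (t j *\<^sub>R e + x))"
      using borel_measurable_continuous_onI[OF cf] by (intro integral_distr) auto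
    finally show ?thesis
      unfolding g_def using i i' by (simp add: add.commute)
  qed
  have "(\<lambda>j. LINT x|lborel. g j x) \<longlonglongrightarrow> (LINT x|lborel. partial_deriv h f x)"
  proof (rule integral_dominated_convergence[where w = "\<lambda>x. C * indicator (cball 0 (R + 1)) x"])
    show "partial_deriv h f \<in> borel_measurable lborel"
      using borel_measurable_continuous_onI[OF smooth_continuous_on[OF K'(1)]] by simp
    show "g j \<in> borel_measurable lborel" for j
    proof -
      have "g j \<in> borel_measurable borel"
        unfolding g_def[abs_def] by (intro borel_measurable_continuous_onI continuous_intros cft cf)
      then show ?thesis by simp
    qed
    show "integrable lborel (\<lambda>x :: real^'n. C * indicator (cball 0 (R + 1)) x)"
      by (intro integrable_mult_right integrable_real_indicator)
         (use emeasure_bounded_finite[OF bounded_cball[of "0 :: real^'n" "R + 1"]] in auto)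
  qed (use lim bound in auto)
  then show ?thesis by (simp add: int_g LIMSEQ_const_iff)
qed

lemma frechet_derivative_scaleR:
  assumes "smooth \<phi>" "smooth v"
  shows "frechet_derivative (\<lambda>x. \<phi> x *\<^sub>R v x) (at x) u
    = \<phi> x *\<^sub>R frechet_derivative v (at x) u + frechet_derivative \<phi> (at x) u *\<^sub>R v x"
  using frechet_derivative_at[OF has_derivative_scaleR[OF smooth_has_derivative[OF assms(1)]
      smooth_has_derivative[OF assms(2)]], of x, symmetric] by simp

lemma gradient_component: "gradient v x $ h = partial_deriv h v x"
  by (simp add: gradient_def)

text \<open>
  Integration by parts is the vanishing of the integral of \<open>\<partial>\<^sub>h (\<phi> v)\<close>.
\<close>

lemma has_weak_gradient_gradient:
  assumes "open \<Omega>" "v \<in> test_functions \<Omega>"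
  shows "has_weak_gradient \<Omega> v (gradient v)"
proof -
  obtain K where K0: "smooth v" "compact K" "K \<subseteq> \<Omega>" "\<forall>x. x \<notin> K \<longrightarrow> v x = 0"
    using assms(2) by (rule test_functionsE)
  note K = K0(1-3) K0(4)[rule_format]
  have g0: "gradient v x = 0" if "x \<notin> K" for x
    using frechet_derivative_zero_outside[of K v, OF K(2,4) that]
    by (simp add: vec_eq_iff gradient_component partial_deriv_def)
  have cg: "continuous_on UNIV (gradient v)"
    unfolding gradient_def[abs_def]
    by (intro continuous_on_vec_lambda smooth_continuous_on smooth_partial_deriv K)
  have cv: "continuous_on UNIV v" by (rule smooth_continuous_on[OF K(1)])
  have meas: "f \<in> borel_measurable (lebesgue_on \<Omega>)" if "continuous_on UNIV f" for f :: "real^'a \<Rightarrow> 'z::euclidean_space"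
    using that by (intro continuous_imp_measurable_on_sets_lebesgue continuous_on_subset[OF that]) (use assms in auto)
  have L2: "L2_on \<Omega> f" if "continuous_on UNIV f" "\<And>x. x \<notin> K \<Longrightarrow> f x = 0" for f :: "real^'a \<Rightarrow> 'z::euclidean_space"
    unfolding L2_on_def
    using that by (intro conjI meas lebesgue_on_compact_support(1)[OF assms(1) _ K(2,3)] continuous_intros) auto
  show ?thesis
    unfolding has_weak_gradient_def
  proof (intro conjI ballI allI)
    show "L2_on \<Omega> v" by (rule L2[OF cv K(4)])
    show "L2_on \<Omega> (gradient v)" by (rule L2[OF cg g0])
    fix \<phi> :: "real^'a \<Rightarrow> real" and h
    assume \<phi>: "\<phi> \<in> test_functions \<Omega>"
    then have s\<phi>: "smooth \<phi>" by (rule test_functionsE)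
    let ?a = "\<lambda>x. partial_deriv h \<phi> x *\<^sub>R v x" and ?b = "\<lambda>x. \<phi> x *\<^sub>R (gradient v x $ h)"
    have c: "continuous_on UNIV ?a" "continuous_on UNIV ?b"
      by (intro continuous_intros smooth_continuous_on smooth_partial_deriv s\<phi> K cg)+
    have z: "\<And>x. x \<notin> K \<Longrightarrow> ?a x = 0" "\<And>x. x \<notin> K \<Longrightarrow> ?b x = 0"
      using K(4) g0 by auto
    note i = integrable_lborel_compact_support[OF c(1) K(2) z(1)] integrable_lborel_compact_support[OF c(2) K(2) z(2)]
    have "partial_deriv h (\<lambda>x. \<phi> x *\<^sub>R v x) = (\<lambda>x. ?a x + ?b x)"
      by (simp add: fun_eq_iff partial_deriv_def gradient_component frechet_derivative_scaleR[OF s\<phi> K(1)])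
    with integral_partial_deriv_eq_0[OF test_functions_scaleR[OF \<phi> K(1)], of h]
    have "(LINT x|lborel. ?a x) + (LINT x|lborel. ?b x) = 0" using i by simp
    moreover have "(LINT x|lebesgue_on \<Omega>. ?a x) = (LINT x|lborel. ?a x)"
      by (rule lebesgue_on_compact_support(2)[OF assms(1) c(1) K(2,3) z(1)])
    moreover have "(LINT x|lebesgue_on \<Omega>. ?b x) = (LINT x|lborel. ?b x)"
      by (rule lebesgue_on_compact_support(2)[OF assms(1) c(2) K(2,3) z(2)])
    ultimately show "(LINT x|lebesgue_on \<Omega>. ?a x) = - (LINT x|lebesgue_on \<Omega>. ?b x)"
      by (simp only: eq_neg_iff_add_eq_0)
  qed
qed

lemma test_functions_subset_W12_0:
  assumes "open \<Omega>" "v \<in> test_functions \<Omega>"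
  shows "v \<in> W12_0 \<Omega>"
  unfolding W12_0_def
  using has_weak_gradient_gradient[OF assms] assms(2)
  by (auto intro!: exI[of _ "gradient v"] exI[of _ "\<lambda>_. v"])

section \<open>Test functions detect the sign of a bounded function\<close>

lemma test_functions_mono: "U \<subseteq> \<Omega> \<Longrightarrow> test_functions U \<subseteq> test_functions \<Omega>"
  by (auto simp: test_functions_def)

text \<open>
  Write \<open>U\<close> as a countable union of balls whose closures lie in \<open>U\<close>, and let \<open>\<chi>\<^sub>i\<close> be the bump of the
  \<open>i\<close>-th ball. The function \<open>1 - (\<Prod>i<N. (1 - \<chi>\<^sub>i)\<^sup>N)\<close> vanishes off the first \<open>N\<close> balls; at a point of the
  \<open>i\<close>-th ball the product is at most \<open>(1 - \<chi>\<^sub>i)\<^sup>N\<close> for \<open>N > i\<close> and hence tends to 0. The powers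
  force this limit although the bumps stay below 1.
\<close>

lemma open_indicator_test_limit:
  fixes U :: "(real^'n::finite) set"
  assumes "open U"
  obtains \<Psi> :: "nat \<Rightarrow> real^'n \<Rightarrow> real"
  where "\<And>N. \<Psi> N \<in> test_functions U" "\<And>N x. 0 \<le> \<Psi> N x" "\<And>N x. \<Psi> N x \<le> 1"
    "\<And>x. x \<in> U \<Longrightarrow> (\<lambda>N. \<Psi> N x) \<longlonglongrightarrow> 1"
proof -
  define F where "F = {ball x r | x r. r > 0 \<and> cball x r \<subseteq> U}"
  have "\<Union>F = U"
  proof
    show "\<Union>F \<subseteq> U" by (auto simp: F_def subset_iff)
    show "U \<subseteq> \<Union>F"
    proof
      fix x assume "x \<in> U"
      then obtain r where "r > 0" "cball x r \<subseteq> U"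
        using assms open_contains_cball by blast
      then show "x \<in> \<Union>F" unfolding F_def by (intro UnionI[of "ball x r"]) auto
    qed
  qed
  obtain F' where F': "F' \<subseteq> F" "countable F'" "\<Union>F' = U"
  proof (rule Lindelof[of F])
    show "open S" if "S \<in> F" for S using that by (auto simp: F_def)
  qed (use \<open>\<Union>F = U\<close> in auto)
  show ?thesis
  proof (cases "F' = {}")
    case True
    show ?thesis
      by (rule that[of "\<lambda>N x. 0"])
         (use F' True in \<open>auto intro!: test_functionsI[of _ "{}"] smooth_const\<close>)
  next
    case False
    have "\<exists>c r. from_nat_into F' i = ball c r \<and> r > 0 \<and> cball c r \<subseteq> U" for i
      using from_nat_into[OF False, of i] F'(1) by (auto simp: F_def)
    then obtain c r where cr: "\<And>i. from_nat_into F' i = ball (c i) (r i)" "\<And>i. r i > 0"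
      "\<And>i. cball (c i) (r i) \<subseteq> U"
      by metis
    have U: "U = (\<Union>i. ball (c i) (r i))"
      using F'(3) range_from_nat_into[OF False F'(2)] by (simp flip: cr(1))
    define f where "f N i x = (1 - bump (c i) (r i) x) ^ N" for N i x
    have f01: "0 \<le> f N i x" "f N i x \<le> 1" for N i x
      using bump_range[of "c i" "r i" x] by (auto simp: f_def power_le_one)
    define \<Psi> where "\<Psi> N x = 1 - (\<Prod>i<N. f N i x)" for N x
    have le1: "(\<Prod>i<N. f N i x) \<le> 1" for N x
      using f01 by (intro prod_le_1) auto
    show ?thesis
    proof (rule that[of \<Psi>])
      fix N x
      show "0 \<le> \<Psi> N x" "\<Psi> N x \<le> 1"
        using le1[of N x] prod_nonneg[of "{..<N}" "\<lambda>i. f N i x"] f01 by (auto simp: \<Psi>_def)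
    next
      fix N
      show "\<Psi> N \<in> test_functions U"
      proof (rule test_functionsI[of _ "\<Union>i<N. cball (c i) (r i)"])
        show "smooth (\<Psi> N)"
          unfolding \<Psi>_def[abs_def] f_def
          by (intro smooth_diff smooth_const smooth_prod smooth_power smooth_bump)
        show "\<Psi> N x = 0" if "x \<notin> (\<Union>i<N. cball (c i) (r i))" for x
        proof -
          have "f N i x = 1" if "i < N" for i
          proof -
            have "x \<notin> ball (c i) (r i)" using \<open>x \<notin> _\<close> that ball_subset_cball by blast
            then have "bump (c i) (r i) x = 0"
              using bump_pos_iff[OF cr(2)[of i], of "c i" x] bump_range(1)[of "c i" "r i" x] by linarith
            then show ?thesis by (simp add: f_def)
          qed
          then show ?thesis by (simp add: \<Psi>_def)
        qed
      qed (use cr(3) in auto)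
    next
      fix x assume "x \<in> U"
      then obtain i where i: "x \<in> ball (c i) (r i)" unfolding U by blast
      define y where "y = 1 - bump (c i) (r i) x"
      have y: "0 < y" "y < 1"
        using i bump_pos_iff[OF cr(2)[of i], of "c i" x] bump_range(2)[of "c i" "r i" x]
        by (auto simp: y_def)
      have "(\<lambda>N. \<Prod>i<N. f N i x) \<longlonglongrightarrow> 0"
      proof (rule tendsto_sandwich[of "\<lambda>_. 0" _ _ "\<lambda>N. y ^ N"])
        show "\<forall>\<^sub>F N in sequentially. (\<Prod>i<N. f N i x) \<le> y ^ N"
          using eventually_gt_at_top[of i]
        proof eventually_elim
          case (elim N)
          have "(\<Prod>i<N. f N i x) = f N i x * (\<Prod>i\<in>{..<N} - {i}. f N i x)"
            using elim by (intro prod.remove) auto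
          also have "\<dots> \<le> f N i x * 1"
            using f01 by (intro mult_left_mono prod_le_1) auto
          finally show ?case by (simp add: f_def y_def)
        qed
        show "(\<lambda>N. y ^ N) \<longlonglongrightarrow> 0" using y by (intro LIMSEQ_power_zero) auto
      qed (use f01 in \<open>auto intro!: always_eventually prod_nonneg\<close>)
      from tendsto_diff[OF tendsto_const[of 1] this] show "(\<lambda>N. \<Psi> N x) \<longlonglongrightarrow> 1"
        by (simp add: \<Psi>_def)
    qed
  qed
qed

lemma integrable_lebesgue_on_bounded_support:
  fixes f :: "'a::euclidean_space \<Rightarrow> real"
  assumes \<Omega>: "\<Omega> \<in> sets lebesgue" and f: "f \<in> borel_measurable (lebesgue_on \<Omega>)" and S: "S \<in> lmeasurable"
    and le: "\<And>x. x \<in> \<Omega> \<Longrightarrow> \<bar>f x\<bar> \<le> M * indicator S x"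
  shows "integrable (lebesgue_on \<Omega>) f"
proof (rule Bochner_Integration.integrable_bound[OF _ f])
  have \<Omega>': "\<Omega> \<inter> space lebesgue \<in> sets lebesgue" using \<Omega> by simp
  have "integrable lebesgue (\<lambda>x. M * indicator (\<Omega> \<inter> S) x)"
    using fmeasurable_Int_fmeasurable[OF S \<Omega>]
    by (intro integrable_mult_right integrable_real_indicator) (auto simp: fmeasurable_def Int_commute)
  then show "integrable (lebesgue_on \<Omega>) (\<lambda>x. M * indicator S x :: real)"
    unfolding integrable_restrict_space[OF \<Omega>']
    by (simp add: indicator_inter_arith mult_ac)
  show "AE x in lebesgue_on \<Omega>. norm (f x) \<le> norm (M * indicator S x)"
    using le by (intro AE_I2) (force simp: space_restrict_space)
qed

text \<open>
  For a bounded open set in place of \<open>E\<close> this follows by dominated convergence, since the indicator of the set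
  is a bounded limit of squares of test functions. Outer regularity of Lebesgue measure and the bound on \<open>H\<close>
  carry the result over to measurable sets.
\<close>

lemma integral_indicator_nonneg_of_test_functions:
  fixes H :: "real^'n::finite \<Rightarrow> real"
  assumes "open \<Omega>" and H: "H \<in> borel_measurable (lebesgue_on \<Omega>)"
    and bd: "\<And>x. x \<in> \<Omega> \<Longrightarrow> \<bar>H x\<bar> \<le> M"
    and test: "\<And>\<psi>. \<psi> \<in> test_functions \<Omega> \<Longrightarrow> (\<And>x. 0 \<le> \<psi> x) \<Longrightarrow>
      0 \<le> (LINT x|lebesgue_on \<Omega>. (\<psi> x)\<^sup>2 * H x)"
    and E: "E \<in> sets lebesgue" "E \<subseteq> \<Omega>" "bounded E"
  shows "0 \<le> (LINT x|lebesgue_on \<Omega>. indicator E x * H x)"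
proof -
  let ?L = "lebesgue_on \<Omega>"
  have \<Omega>: "\<Omega> \<in> sets lebesgue" using assms(1) by simp
  have ind: "(indicator S :: _ \<Rightarrow> real) \<in> borel_measurable ?L" if "S \<in> sets lebesgue" for S
    using that by (intro measurable_restrict_space1) simp
  have int: "integrable ?L (\<lambda>x. indicator S x * H x)" if "S \<in> lmeasurable" for S
    using that bd
    by (intro integrable_lebesgue_on_bounded_support[OF \<Omega> _ that, of _ M] borel_measurable_times H ind)
       (auto simp: indicator_def fmeasurable_def)
  have M: "0 \<le> M" if "x \<in> \<Omega>" for x using bd[OF that] by linarith
  have opn: "0 \<le> (LINT x|?L. indicator U x * H x)" if U: "open U" "U \<subseteq> \<Omega>" "bounded U" for U
  proof -
    obtain \<Psi> :: "nat \<Rightarrow> real^'n \<Rightarrow> real"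
      where \<Psi>: "\<And>N. \<Psi> N \<in> test_functions U" "\<And>N x. 0 \<le> \<Psi> N x" "\<And>N x. \<Psi> N x \<le> 1"
        "\<And>x. x \<in> U \<Longrightarrow> (\<lambda>N. \<Psi> N x) \<longlonglongrightarrow> 1"
      using open_indicator_test_limit[OF U(1)] by blast
    have \<Psi>0: "\<Psi> N x = 0" if "x \<notin> U" for N x
    proof -
      obtain K where "smooth (\<Psi> N)" "compact K" "K \<subseteq> U" "\<forall>x. x \<notin> K \<longrightarrow> \<Psi> N x = 0"
        using \<Psi>(1) by (rule test_functionsE)
      then show ?thesis using that by blast
    qed
    have lm: "U \<in> lmeasurable" using U by (simp add: lmeasurable_open)
    have "(\<lambda>N. LINT x|?L. (\<Psi> N x)\<^sup>2 * H x) \<longlonglongrightarrow> (LINT x|?L. indicator U x * H x)"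
    proof (rule integral_dominated_convergence[where w = "\<lambda>x. M * indicator U x"])
      show "(\<lambda>x. indicator U x * H x) \<in> borel_measurable ?L"
        using U by (intro borel_measurable_times H ind) auto
      show "(\<lambda>x. (\<Psi> N x)\<^sup>2 * H x) \<in> borel_measurable ?L" for N
      proof -
        have "smooth (\<Psi> N)" using \<Psi>(1) by (rule test_functionsE)
        then show ?thesis using \<Omega>
          by (intro borel_measurable_times H borel_measurable_power
              continuous_imp_measurable_on_sets_lebesgue smooth_continuous_on)
      qed
      show "integrable ?L (\<lambda>x. M * indicator U x)"
      proof (rule integrable_lebesgue_on_bounded_support[OF \<Omega> _ lm, of _ M])
        show "(\<lambda>x. M * indicator U x) \<in> borel_measurable ?L"
          using U by (intro borel_measurable_times ind) auto
      qed (use M in \<open>auto simp: indicator_def\<close>)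
      show "AE x in ?L. (\<lambda>N. (\<Psi> N x)\<^sup>2 * H x) \<longlonglongrightarrow> indicator U x * H x"
      proof (rule AE_I2)
        fix x
        show "(\<lambda>N. (\<Psi> N x)\<^sup>2 * H x) \<longlonglongrightarrow> indicator U x * H x"
        proof (cases "x \<in> U")
          case True
          have "(\<lambda>N. (\<Psi> N x)\<^sup>2 * H x) \<longlonglongrightarrow> 1\<^sup>2 * H x"
            by (intro tendsto_intros \<Psi>(4) True)
          then show ?thesis using True by simp
        qed (simp add: \<Psi>0)
      qed
      show "AE x in ?L. norm ((\<Psi> N x)\<^sup>2 * H x) \<le> M * indicator U x" for N
      proof (rule AE_I2)
        fix x assume "x \<in> space ?L"
        then have x: "x \<in> \<Omega>" by (simp add: space_restrict_space)
        have "(\<Psi> N x)\<^sup>2 \<le> 1" using \<Psi>(2,3)[of N x] by (simp add: power_le_one)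
        then have "(\<Psi> N x)\<^sup>2 * \<bar>H x\<bar> \<le> 1 * M" using bd[OF x] by (intro mult_mono) auto
        then show "norm ((\<Psi> N x)\<^sup>2 * H x) \<le> M * indicator U x"
          using \<Psi>0[of x N] by (cases "x \<in> U") (auto simp: abs_mult)
      qed
    qed
    moreover have "0 \<le> (LINT x|?L. (\<Psi> N x)\<^sup>2 * H x)" for N
      using test_functions_mono[OF U(2)] \<Psi>(1) by (intro test \<Psi>(2)) blast
    ultimately show ?thesis by (intro LIMSEQ_le_const) auto
  qed
  show ?thesis
  proof (rule field_le_epsilon)
    fix e :: real assume e: "e > 0"
    define d where "d = e / (\<bar>M\<bar> + 1)"
    have d: "d > 0" using e by (simp add: d_def)
    obtain T where T: "open T" "E \<subseteq> T" "T - E \<in> lmeasurable" "emeasure lebesgue (T - E) < ennreal d"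
      using sets_lebesgue_outer_open[OF E(1) d] by blast
    obtain R where R: "E \<subseteq> ball 0 R" using bounded_subset_ballD[OF E(3), of 0] by blast
    define U where "U = T \<inter> \<Omega> \<inter> ball 0 R"
    have U: "open U" "U \<subseteq> \<Omega>" "bounded U" "E \<subseteq> U"
      using T assms(1) E R bounded_subset[OF bounded_ball, of U 0 R] by (auto simp: U_def)
    have lm: "U \<in> lmeasurable" "E \<in> lmeasurable" "U - E \<in> lmeasurable"
      using U E by (auto simp: lmeasurable_open bounded_set_imp_lmeasurable fmeasurable_Diff)
    have m: "measure lebesgue (U - E) \<le> d"
    proof -
      have "measure lebesgue (U - E) \<le> measure lebesgue (T - E)"
        using lm T(3) by (intro measure_mono_fmeasurable) (auto simp: U_def)
      also have "\<dots> \<le> d" using T(4) unfolding emeasure_eq_measure2[OF T(3)]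
        by (simp add: ennreal_less_iff)
      finally show ?thesis .
    qed
    have "0 \<le> (LINT x|?L. indicator U x * H x)" by (rule opn[OF U(1-3)])
    also have "\<dots> = (LINT x|?L. indicator E x * H x + indicator (U - E) x * H x)"
      using U(4) by (intro Bochner_Integration.integral_cong) (auto simp: indicator_def)
    also have "\<dots> = (LINT x|?L. indicator E x * H x) + (LINT x|?L. indicator (U - E) x * H x)"
      using lm by (intro Bochner_Integration.integral_add int)
    finally have 1: "0 \<le> (LINT x|?L. indicator E x * H x) + (LINT x|?L. indicator (U - E) x * H x)" .
    have "(LINT x|?L. indicator (U - E) x * H x) \<le> (LINT x|?L. \<bar>M\<bar> * indicator (U - E) x)"
    proof (rule integral_mono[OF int[OF lm(3)]])
      show "integrable ?L (\<lambda>x. \<bar>M\<bar> * indicator (U - E) x)"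
      proof (rule integrable_lebesgue_on_bounded_support[OF \<Omega> _ lm(3), of _ "\<bar>M\<bar>"])
        show "(\<lambda>x. \<bar>M\<bar> * indicator (U - E) x) \<in> borel_measurable ?L"
          using lm by (intro borel_measurable_times ind) auto
      qed (auto simp: indicator_def)
    next
      fix x assume "x \<in> space ?L"
      then show "indicator (U - E) x * H x \<le> \<bar>M\<bar> * indicator (U - E) x"
        using bd[of x] by (auto simp: indicator_def space_restrict_space)
    qed
    also have "\<dots> = \<bar>M\<bar> * measure lebesgue (U - E)"
    proof -
      have sub: "U - E \<subseteq> \<Omega>" using U(2) by blast
      then show ?thesis using \<Omega>
        by (simp add: measure_restrict_space space_restrict_space Int_absorb2)
    qed
    also have "\<dots> \<le> \<bar>M\<bar> * d" using m by (intro mult_left_mono) auto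
    also have "\<dots> \<le> e" using e by (simp add: d_def field_simps)
    finally show "0 \<le> (LINT x|?L. indicator E x * H x) + e" using 1 by linarith
  qed
qed

text \<open>
  Apply the preceding lemma to the bounded parts of the set where \<open>H < 0\<close>. The squares appear because the
  cutoff enters a quadratic form.
\<close>

lemma AE_nonneg_of_test_functions:
  fixes H :: "real^'n::finite \<Rightarrow> real"
  assumes "open \<Omega>" and H: "H \<in> borel_measurable (lebesgue_on \<Omega>)"
    and bd: "\<And>x. x \<in> \<Omega> \<Longrightarrow> \<bar>H x\<bar> \<le> M"
    and test: "\<And>\<psi>. \<psi> \<in> test_functions \<Omega> \<Longrightarrow> (\<And>x. 0 \<le> \<psi> x) \<Longrightarrow>
      0 \<le> (LINT x|lebesgue_on \<Omega>. (\<psi> x)\<^sup>2 * H x)"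
  shows "AE x in lebesgue_on \<Omega>. 0 \<le> H x"
proof -
  let ?L = "lebesgue_on \<Omega>"
  have \<Omega>: "\<Omega> \<in> sets lebesgue" using assms(1) by simp
  define E where "E R = {x \<in> \<Omega>. H x < 0} \<inter> ball 0 (real R)" for R
  have "AE x in ?L. x \<notin> E R" for R
  proof -
    have "{x \<in> space ?L. H x < 0} \<in> sets ?L" by (intro borel_measurable_less H borel_measurable_const)
    then have N: "{x \<in> \<Omega>. H x < 0} \<in> sets lebesgue"
      using \<Omega> unfolding space_restrict_space by (subst (asm) sets_restrict_space_iff) auto
    have E1: "E R \<in> sets lebesgue" unfolding E_def by (rule sets.Int[OF N]) simp
    have E2: "E R \<subseteq> \<Omega>" unfolding E_def by blast
    have E3: "bounded (E R)" unfolding E_def by (intro bounded_Int disjI2 bounded_ball)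
    note E = E1 E2 E3
    from E have lm: "E R \<in> lmeasurable" by (simp add: bounded_set_imp_lmeasurable)
    let ?f = "\<lambda>x. - (indicator (E R) x * H x)"
    have ind: "(indicator (E R) :: _ \<Rightarrow> real) \<in> borel_measurable ?L"
      using E(1) by (intro measurable_restrict_space1) simp
    have i: "integrable ?L ?f"
      using bd by (intro integrable_lebesgue_on_bounded_support[OF \<Omega> _ lm, of _ M] borel_measurable_uminus
          borel_measurable_times H ind) (auto simp: indicator_def)
    \<comment> \<open>On \<open>E R\<close> the function \<open>H\<close> is negative, so its integral over that set is both nonnegative and nonpositive.\<close>
    have nn: "AE x in ?L. 0 \<le> ?f x" by (auto simp: indicator_def E_def)
    have "0 \<le> (LINT x|?L. indicator (E R) x * H x)"
      by (intro integral_indicator_nonneg_of_test_functions[of \<Omega> H M "E R"] assms(1) H bd test E)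
    moreover have "0 \<le> (LINT x|?L. ?f x)" by (rule integral_nonneg_AE[OF nn])
    ultimately have "(LINT x|?L. ?f x) = 0" by simp
    then have "AE x in ?L. ?f x = 0"
      using integral_nonneg_eq_0_iff_AE[OF i nn] by blast
    then show ?thesis
    proof eventually_elim
      case (elim x)
      show ?case
      proof
        assume x: "x \<in> E R"
        with elim have "H x = 0" by simp
        moreover have "H x < 0" using x unfolding E_def by blast
        ultimately show False by simp
      qed
    qed
  qed
  then have "AE x in ?L. \<forall>R. x \<notin> E R" unfolding AE_all_countable by blast
  moreover have "AE x in ?L. x \<in> \<Omega>" by (rule AE_I2) (simp add: space_restrict_space)
  ultimately show ?thesis
  proof eventually_elim
    case (elim x)
    obtain R :: nat where "norm x < real R" using reals_Archimedean2 by blast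
    moreover have "x \<notin> E R" using elim(1) by blast
    ultimately show ?case using elim(2) unfolding E_def by (simp add: not_less)
  qed
qed

section \<open>Measurability and integrability of the energy density\<close>

lemma continuous_on_tensor_at [continuous_intros]:
  "continuous_on S f \<Longrightarrow> continuous_on S g \<Longrightarrow> continuous_on S (\<lambda>x. tensor_at (f x) (g x))"
  unfolding tensor_at_eq by (intro continuous_intros continuous_on_vec_lambda)

lemma continuous_on_tensor_form [continuous_intros]:
  fixes B :: "'z::topological_space \<Rightarrow> ('n::finite, 'm::finite) coeff"
  shows "continuous_on S B \<Longrightarrow> continuous_on S f \<Longrightarrow> continuous_on S g \<Longrightarrow>
    continuous_on S (\<lambda>x. tensor_form (B x) (f x) (g x))"
  unfolding tensor_form_eq by (intro tensor_cinner.continuous_on coeff_app.continuous_on)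

lemma continuous_on_p_form [continuous_intros]:
  fixes B :: "'z::topological_space \<Rightarrow> ('n::finite, 'm::finite) coeff"
  shows "continuous_on S B \<Longrightarrow> continuous_on S f \<Longrightarrow> continuous_on S g \<Longrightarrow>
    continuous_on S (\<lambda>x. p_form (B x) s (f x) (g x))"
  unfolding p_form_def by (intro continuous_intros)

lemma borel_measurable_tensor_form:
  fixes B :: "'z \<Rightarrow> ('n::finite, 'm::finite) coeff"
  assumes "B \<in> borel_measurable M" "f \<in> borel_measurable M" "g \<in> borel_measurable M"
  shows "(\<lambda>x. tensor_form (B x) (f x) (g x)) \<in> borel_measurable M"
proof -
  have "(\<lambda>x. coeff_app (B x) (f x)) \<in> borel_measurable M"
    by (rule borel_measurable_continuous_Pair[OF assms(1,2)])
       (intro coeff_app.continuous_on continuous_intros)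
  then show ?thesis unfolding tensor_form_eq
    by (rule borel_measurable_continuous_Pair[OF _ assms(3)])
       (intro tensor_cinner.continuous_on continuous_intros)
qed

lemma borel_measurable_tensor_at:
  assumes "f \<in> borel_measurable M" "v \<in> borel_measurable M"
  shows "(\<lambda>x. tensor_at (f x :: complex^'m::finite^'n::finite) (v x)) \<in> borel_measurable M"
  by (rule borel_measurable_continuous_Pair[OF assms]) (intro continuous_intros)

lemma borel_measurable_sgn_vec:
  fixes v :: "'z \<Rightarrow> 'a::euclidean_space"
  assumes "v \<in> borel_measurable M"
  shows "(\<lambda>x. sgn (v x)) \<in> borel_measurable M"
  unfolding sgn_div_norm
  by (intro borel_measurable_scaleR borel_measurable_inverse assms
      measurable_compose[OF assms borel_measurable_continuous_onI[OF continuous_on_norm_id]])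

lemma borel_measurable_p_form:
  fixes B :: "'z \<Rightarrow> ('n::finite, 'm::finite) coeff"
  assumes "B \<in> borel_measurable M" "f \<in> borel_measurable M" "g \<in> borel_measurable M"
  shows "(\<lambda>x. p_form (B x) s (f x) (g x)) \<in> borel_measurable M"
  unfolding p_form_def
  by (intro borel_measurable_tensor_form borel_measurable_diff borel_measurable_add borel_measurable_scaleR
      borel_measurable_const borel_measurable_tensor_at assms)

lemma norm_sgn_le_1: "norm (sgn (w :: 'a::real_normed_vector)) \<le> 1"
  by (simp add: norm_sgn)

lemma integrable_tensor_form:
  fixes A :: "real^'n::finite \<Rightarrow> ('n, 'm::finite) coeff"
  assumes A: "A \<in> borel_measurable (lebesgue_on \<Omega>)" "\<And>x. x \<in> \<Omega> \<Longrightarrow> norm (A x) \<le> MA"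
    and \<Omega>: "open \<Omega>"
    and f: "f \<in> borel_measurable (lebesgue_on \<Omega>)" "\<And>x. norm (f x) \<le> a * norm (G x)"
    and g: "g \<in> borel_measurable (lebesgue_on \<Omega>)" "\<And>x. norm (g x) \<le> b * norm (G x)"
    and G: "integrable (lebesgue_on \<Omega>) (\<lambda>x. (norm (G x))\<^sup>2)"
  shows "integrable (lebesgue_on \<Omega>) (\<lambda>x. tensor_form (A x) (f x) (g x))"
proof -
  obtain K where K: "K > 0"
    "\<And>(B :: ('n, 'm) coeff) \<xi> \<eta>. norm (tensor_form B \<xi> \<eta>) \<le> K * norm B * norm \<xi> * norm \<eta>"
    using tensor_form_bound by blast
  show ?thesis
  proof (rule Bochner_Integration.integrable_bound)
    show "integrable (lebesgue_on \<Omega>) (\<lambda>x. (K * MA * a * b) * (norm (G x))\<^sup>2)"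
      by (intro integrable_mult_right G)
    show "(\<lambda>x. tensor_form (A x) (f x) (g x)) \<in> borel_measurable (lebesgue_on \<Omega>)"
      by (intro borel_measurable_tensor_form A f g)
    show "AE x in lebesgue_on \<Omega>. norm (tensor_form (A x) (f x) (g x)) \<le> norm ((K * MA * a * b) * (norm (G x))\<^sup>2)"
    proof (rule AE_I2)
      fix x assume "x \<in> space (lebesgue_on \<Omega>)"
      then have x: "norm (A x) \<le> MA" using A(2) by (simp add: space_restrict_space)
      then have MA: "0 \<le> MA" using norm_ge_zero order_trans by blast
      have "norm (tensor_form (A x) (f x) (g x)) \<le> K * norm (A x) * norm (f x) * norm (g x)"
        by (rule K(2))
      also have "\<dots> = (K * norm (A x)) * (norm (f x) * norm (g x))" by simp
      also have "\<dots> \<le> (K * MA) * ((a * norm (G x)) * (b * norm (G x)))"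
      proof (rule mult_mono)
        show "norm (f x) * norm (g x) \<le> (a * norm (G x)) * (b * norm (G x))"
          by (rule mult_mono[OF f(2) g(2) order_trans[OF norm_ge_zero f(2)]]) simp
      qed (use x K(1) MA in auto)
      also have "\<dots> = (K * MA * a * b) * (norm (G x))\<^sup>2" by (simp add: power2_eq_square mult_ac)
      finally show "norm (tensor_form (A x) (f x) (g x)) \<le> norm ((K * MA * a * b) * (norm (G x))\<^sup>2)"
        by simp
    qed
  qed
qed

lemma norm_scaleR_le_norm:
  fixes x :: "'a::real_normed_vector"
  assumes "\<bar>s\<bar> \<le> 1" shows "norm (s *\<^sub>R x) \<le> norm x"
  using assms by (simp add: mult_left_le_one_le)

text \<open>
  Needed in every comparison of integrals below: the Bochner integral of a function that is not integrable
  is 0 by definition, and would not reflect pointwise inequalities.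
\<close>

lemma integrable_p_form:
  fixes A :: "real^'n::finite \<Rightarrow> ('n, 'm::finite) coeff"
  assumes A: "A \<in> borel_measurable (lebesgue_on \<Omega>)" "\<And>x. x \<in> \<Omega> \<Longrightarrow> norm (A x) \<le> MA"
    and \<Omega>: "open \<Omega>" and s: "\<bar>s\<bar> \<le> 1"
    and v: "v \<in> borel_measurable (lebesgue_on \<Omega>)" and G: "L2_on \<Omega> G"
  shows "integrable (lebesgue_on \<Omega>) (\<lambda>x. p_form (A x) s (sgn (v x)) (G x))"
  unfolding p_form_def
proof (rule integrable_tensor_form[OF A \<Omega>, of _ 2 G _ 2])
  have T: "norm (s *\<^sub>R tensor_at (G x) (sgn (v x))) \<le> norm (G x)" for x
    using norm_scaleR_le_norm[OF s] norm_tensor_at_le[OF norm_sgn_le_1] order_trans by blast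
  show "norm (G x - s *\<^sub>R tensor_at (G x) (sgn (v x))) \<le> 2 * norm (G x)" for x
    using norm_triangle_ineq4[of "G x" "s *\<^sub>R tensor_at (G x) (sgn (v x))"] T[of x] by linarith
  show "norm (G x + s *\<^sub>R tensor_at (G x) (sgn (v x))) \<le> 2 * norm (G x)" for x
    using norm_triangle_ineq[of "G x" "s *\<^sub>R tensor_at (G x) (sgn (v x))"] T[of x] by linarith
  have m: "G \<in> borel_measurable (lebesgue_on \<Omega>)" using G by (simp add: L2_on_def)
  show "(\<lambda>x. G x - s *\<^sub>R tensor_at (G x) (sgn (v x))) \<in> borel_measurable (lebesgue_on \<Omega>)"
    "(\<lambda>x. G x + s *\<^sub>R tensor_at (G x) (sgn (v x))) \<in> borel_measurable (lebesgue_on \<Omega>)"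
    by (intro borel_measurable_diff borel_measurable_add borel_measurable_scaleR
        borel_measurable_const borel_measurable_tensor_at borel_measurable_sgn_vec m v)+
  show "integrable (lebesgue_on \<Omega>) (\<lambda>x. (norm (G x))\<^sup>2)" using G by (simp add: L2_on_def)
qed

text \<open>
  Go from \<open>sgn w\<close> to \<open>\<omega>\<close> through \<open>w\<close>: the distance of \<open>w\<close> from its normalization is
  \<open>\<bar>norm w - 1\<bar>\<close>, which \<open>norm (w - \<omega>)\<close> dominates. This includes the case \<open>w = 0\<close>.
\<close>

lemma norm_sgn_diff_le:
  fixes w :: "'a::real_normed_vector"
  assumes "norm \<omega> = 1"
  shows "norm (sgn w - \<omega>) \<le> 2 * norm (w - \<omega>)"
proof -
  have "norm (sgn w - w) \<le> norm (w - \<omega>)"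
  proof (cases "w = 0")
    case False
    have "sgn w - w = (1 / norm w - 1) *\<^sub>R w"
      by (simp add: sgn_div_norm scaleR_diff_left divide_inverse)
    then have "norm (sgn w - w) = \<bar>1 / norm w - 1\<bar> * norm w" by simp
    also have "\<dots> = \<bar>(1 / norm w - 1) * norm w\<bar>" by (simp add: abs_mult)
    also have "(1 / norm w - 1) * norm w = norm \<omega> - norm w" using False assms by (simp add: left_diff_distrib)
    also have "\<bar>norm \<omega> - norm w\<bar> \<le> norm (\<omega> - w)" by (rule norm_triangle_ineq3)
    finally show ?thesis by (simp add: norm_minus_commute)
  qed (use assms in simp)
  moreover have "norm (sgn w - \<omega>) \<le> norm (sgn w - w) + norm (w - \<omega>)"
    using norm_triangle_ineq[of "sgn w - w" "w - \<omega>"] by simp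
  ultimately show ?thesis by linarith
qed

text \<open>
  The amplitude \<open>\<delta>\<close> keeps the direction of the function close to \<open>\<omega>\<close>, and the frequency \<open>1/\<delta>\<^sup>2\<close> is so much
  higher that the gradient of the oscillation, of size \<open>1/\<delta>\<close>, dominates the gradient of the cutoff.
  Multiplying the gradient by \<open>\<delta>\<close> normalizes the leading term.
\<close>

lemma oscillation_gradient:
  fixes \<psi> :: "real^'n::finite \<Rightarrow> real" and \<omega> \<eta> :: "complex^'m::finite"
    and q :: "real^'n" and \<theta> :: real
  assumes \<psi>: "\<psi> \<in> test_functions \<Omega>" and \<delta>: "\<delta> > 0"
  defines "w \<equiv> \<lambda>x. \<omega> + (\<delta> * sin (inner q x / \<delta>\<^sup>2 + \<theta>)) *\<^sub>R \<eta>"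
  shows "(\<lambda>x. \<psi> x *\<^sub>R w x) \<in> test_functions \<Omega>"
    and "\<delta> *\<^sub>R gradient (\<lambda>x. \<psi> x *\<^sub>R w x) x
      = (\<psi> x * cos (inner q x / \<delta>\<^sup>2 + \<theta>)) *\<^sub>R rank_one q \<eta>
        + \<delta> *\<^sub>R rank_one (\<chi> h. partial_deriv h \<psi> x) (w x)"
proof -
  have s\<psi>: "smooth \<psi>" using \<psi> by (rule test_functionsE)
  have bl: "bounded_linear (\<lambda>x. inner q x / \<delta>\<^sup>2)"
    using bounded_linear_compose[OF bounded_linear_divide bounded_linear_inner_right] .
  then have sw: "smooth w"
    unfolding w_def
    by (intro smooth_add smooth_const smooth_scaleR smooth_mult smooth_sin
        smooth_bounded_linear[where L = "\<lambda>x. inner q x / \<delta>\<^sup>2"] smooth_id)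
  show "(\<lambda>x. \<psi> x *\<^sub>R w x) \<in> test_functions \<Omega>"
    by (rule test_functions_scaleR[OF \<psi> sw])
  have "(w has_derivative (\<lambda>u. (\<delta> * (cos (inner q x / \<delta>\<^sup>2 + \<theta>) * (inner q u / \<delta>\<^sup>2))) *\<^sub>R \<eta>)) (at x)"
  proof -
    define L where "L y = inner q y / \<delta>\<^sup>2" for y
    have "(L has_derivative L) (at x)"
      using bl unfolding L_def[abs_def] by (rule bounded_linear_imp_has_derivative)
    then show ?thesis unfolding w_def L_def[symmetric]
      by (auto intro!: derivative_eq_intros simp: mult_ac)
  qed
  from frechet_derivative_at[OF this, symmetric]
  have "partial_deriv h w x = (cos (inner q x / \<delta>\<^sup>2 + \<theta>) * q $ h / \<delta>) *\<^sub>R \<eta>" for h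
    using \<delta> by (simp add: partial_deriv_def inner_axis power2_eq_square)
  then have "partial_deriv h (\<lambda>x. \<psi> x *\<^sub>R w x) x
      = \<psi> x *\<^sub>R ((cos (inner q x / \<delta>\<^sup>2 + \<theta>) * q $ h / \<delta>) *\<^sub>R \<eta>) + partial_deriv h \<psi> x *\<^sub>R w x" for h
    unfolding partial_deriv_def frechet_derivative_scaleR[OF s\<psi> sw] by simp
  then show "\<delta> *\<^sub>R gradient (\<lambda>x. \<psi> x *\<^sub>R w x) x
      = (\<psi> x * cos (inner q x / \<delta>\<^sup>2 + \<theta>)) *\<^sub>R rank_one q \<eta>
        + \<delta> *\<^sub>R rank_one (\<chi> h. partial_deriv h \<psi> x) (w x)"
    using \<delta> by (simp add: vec_eq_iff gradient_component rank_one_def scaleR_add_right mult_ac)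
qed

section \<open>Localization by oscillating test functions\<close>

text \<open>
  Test the integral condition with the functions of \<open>oscillation_gradient\<close>. Up to an error of order \<open>\<delta>\<close>,
  supported in the support of \<open>\<psi>\<close>, the rescaled integrand is \<open>\<psi>\<^sup>2 cos\<^sup>2 H\<close>. The two phases \<open>0\<close> and \<open>\<pi>/2\<close>
  together replace the oscillating factor by 1.
\<close>

lemma oscillation_inequality:
  fixes A :: "real^'n::finite \<Rightarrow> ('n, 'm::finite) coeff" and \<omega> \<eta> :: "complex^'m" and q :: "real^'n"
  assumes \<Omega>: "open \<Omega>" and A: "A \<in> borel_measurable (lebesgue_on \<Omega>)" "\<And>x. x \<in> \<Omega> \<Longrightarrow> norm (A x) \<le> MA"
    and s: "\<bar>s\<bar> \<le> 1" and \<omega>: "norm \<omega> = 1"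
    and ell: "\<And>v. v \<in> test_functions \<Omega> \<Longrightarrow>
      C * (LINT x|lebesgue_on \<Omega>. (norm (gradient v x))\<^sup>2)
        \<le> Re (LINT x|lebesgue_on \<Omega>. p_form (A x) s (sgn (v x)) (gradient v x))"
    and \<psi>: "\<psi> \<in> test_functions \<Omega>" "\<And>x. 0 \<le> \<psi> x"
  defines "H \<equiv> \<lambda>x. Re (p_form (A x) s \<omega> (rank_one q \<eta>)) - C * (norm (rank_one q \<eta>))\<^sup>2"
  shows "0 \<le> (LINT x|lebesgue_on \<Omega>. (\<psi> x)\<^sup>2 * H x)"
proof -
  let ?L = "lebesgue_on \<Omega>" and ?X = "rank_one q \<eta>"
  obtain K where K0: "smooth \<psi>" "compact K" "K \<subseteq> \<Omega>" "\<forall>x. x \<notin> K \<longrightarrow> \<psi> x = 0"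
    using \<psi>(1) by (rule test_functionsE)
  define D where "D x = (\<chi> h. partial_deriv h \<psi> x)" for x
  have D0: "D x = 0" if "x \<notin> K" for x
    using frechet_derivative_zero_outside[of K \<psi> x, OF K0(2) K0(4)[rule_format] that]
    by (simp add: D_def partial_deriv_def vec_eq_iff)
  have cont: "continuous_on UNIV \<psi>" "continuous_on UNIV D"
    unfolding D_def by (intro continuous_on_vec_lambda smooth_continuous_on smooth_partial_deriv K0)+
  have "bounded (\<psi> ` K)" "bounded (D ` K)"
    using cont by (auto intro!: compact_imp_bounded compact_continuous_image K0(2) intro: continuous_on_subset)
  then obtain N0 N1 where "\<And>x. x \<in> K \<Longrightarrow> norm (\<psi> x) \<le> N0" "\<And>x. x \<in> K \<Longrightarrow> norm (D x) \<le> N1"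
    unfolding bounded_iff by blast
  then have N: "\<bar>\<psi> x\<bar> \<le> N0" "norm (D x) \<le> N1" if "x \<in> K" for x using that by auto
  obtain Kp where Kp: "Kp > 0" "\<And>(B :: ('n::finite, 'm::finite) coeff) s \<omega> \<xi> \<omega>' \<xi>'.
      \<bar>s\<bar> \<le> 1 \<Longrightarrow> norm \<omega> \<le> 1 \<Longrightarrow> norm \<omega>' \<le> 1 \<Longrightarrow>
      norm (p_form B s \<omega> \<xi> - p_form B s \<omega>' \<xi>')
        \<le> Kp * norm B * (norm \<xi> + norm \<xi>') * (norm (\<xi> - \<xi>') + norm (\<omega> - \<omega>') * norm \<xi>')"
    using p_form_lipschitz by blast
  \<comment> \<open>\<open>E1\<close> bounds the sizes of the tensors to be compared, \<open>\<delta> * E2\<close> their difference and that of the directions.\<close>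
  define E1 where "E1 = 2 * (N0 * norm ?X + N1)"
  define E2 where "E2 = 2 * N1 + 2 * norm \<eta> * (N0 * norm ?X)"
  define E where "E = (Kp * MA + \<bar>C\<bar>) * E1 * E2"
  define c where "c \<theta> \<delta> x = cos (inner q x / \<delta>\<^sup>2 + \<theta>)" for \<theta> \<delta> x
  define w where "w \<theta> \<delta> x = \<omega> + (\<delta> * sin (inner q x / \<delta>\<^sup>2 + \<theta>)) *\<^sub>R \<eta>" for \<theta> \<delta> x
  define v where "v \<theta> \<delta> x = \<psi> x *\<^sub>R w \<theta> \<delta> x" for \<theta> \<delta> x
  define G where "G \<theta> \<delta> x = \<delta> *\<^sub>R gradient (v \<theta> \<delta>) x" for \<theta> \<delta> x
  define \<Phi> where "\<Phi> \<theta> \<delta> x = Re (p_form (A x) s (sgn (v \<theta> \<delta> x)) (G \<theta> \<delta> x)) - C * (norm (G \<theta> \<delta> x))\<^sup>2" for \<theta> \<delta> x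
  have v: "v \<theta> \<delta> \<in> test_functions \<Omega>"
    and G: "G \<theta> \<delta> x = (\<psi> x * c \<theta> \<delta> x) *\<^sub>R ?X + \<delta> *\<^sub>R rank_one (D x) (w \<theta> \<delta> x)"
    if "\<delta> > 0" for \<theta> \<delta> x
    using oscillation_gradient[OF \<psi>(1) that, of \<omega> q \<theta> \<eta>]
    unfolding v_def[abs_def] G_def w_def c_def D_def by blast+
  have pointwise: "\<Phi> \<theta> \<delta> x \<le> (\<psi> x * c \<theta> \<delta> x)\<^sup>2 * H x + \<delta> * E * indicator K x"
    if \<delta>: "\<delta> > 0" "\<delta> \<le> 1" "\<delta> * norm \<eta> \<le> 1" and x: "x \<in> \<Omega>" for \<theta> \<delta> x
  proof (cases "x \<in> K")
    case False
    then have "G \<theta> \<delta> x = 0" "\<psi> x = 0"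
      using K0(4) D0 by (auto simp: G[OF \<delta>(1)] rank_one_def vec_eq_iff)
    then show ?thesis using False
      by (simp add: \<Phi>_def p_form_expand tensor_form_eq coeff_app.zero_right tensor_cinner.zero_left)
        (simp add: tensor_at_eq coeff_app.zero_right tensor_cinner.zero_left flip: zero_vec_def)
  next
    case True
    let ?\<xi> = "(\<psi> x * c \<theta> \<delta> x) *\<^sub>R ?X" and ?G = "G \<theta> \<delta> x" and ?\<sigma> = "sgn (v \<theta> \<delta> x)"
    have MA: "0 \<le> MA" using A(2)[OF x] norm_ge_zero order_trans by blast
    have N1: "0 \<le> N1" using N(2)[OF True] norm_ge_zero order_trans by blast
    have N0: "0 \<le> N0" using N(1)[OF True] by linarith
    have n\<xi>: "norm ?\<xi> \<le> N0 * norm ?X"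
    proof -
      have "\<bar>\<psi> x\<bar> * \<bar>c \<theta> \<delta> x\<bar> \<le> N0 * 1"
        using N(1)[OF True] N0 by (intro mult_mono) (auto simp: c_def)
      then show ?thesis by (simp add: abs_mult mult_right_mono)
    qed
    have sn: "\<bar>\<delta> * sin (inner q x / \<delta>\<^sup>2 + \<theta>)\<bar> * norm \<eta> \<le> \<delta> * norm \<eta>"
    proof -
      have "\<bar>\<delta>\<bar> * \<bar>sin (inner q x / \<delta>\<^sup>2 + \<theta>)\<bar> \<le> \<delta> * 1"
        using \<delta>(1) by (intro mult_mono) auto
      then show ?thesis by (simp add: abs_mult mult_right_mono)
    qed
    have w\<omega>: "norm (w \<theta> \<delta> x - \<omega>) \<le> \<delta> * norm \<eta>"
      using sn by (simp add: w_def)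
    have "norm (w \<theta> \<delta> x) \<le> norm (w \<theta> \<delta> x - \<omega>) + norm \<omega>"
      using norm_triangle_ineq[of "w \<theta> \<delta> x - \<omega>" \<omega>] by simp
    then have nw: "norm (w \<theta> \<delta> x) \<le> 2" using w\<omega> \<delta>(3) \<omega> by linarith
    have dG: "norm (?G - ?\<xi>) \<le> \<delta> * (2 * N1)"
    proof -
      have "norm (D x) * norm (w \<theta> \<delta> x) \<le> N1 * 2"
        using N(2)[OF True] nw N1 by (intro mult_mono) auto
      then show ?thesis using \<delta>(1)
        by (simp add: G[OF \<delta>(1)] norm_rank_one mult.commute[of 2])
    qed
    have nG: "norm ?G \<le> N0 * norm ?X + 2 * N1"
    proof -
      have "norm ?G \<le> norm ?\<xi> + norm (?G - ?\<xi>)"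
        using norm_triangle_ineq[of ?\<xi> "?G - ?\<xi>"] by simp
      moreover have "\<delta> * (2 * N1) \<le> 1 * (2 * N1)" using \<delta>(2) N1 by (intro mult_right_mono) auto
      ultimately show ?thesis using dG n\<xi> by linarith
    qed
    have e1: "norm ?G + norm ?\<xi> \<le> E1" using nG n\<xi> unfolding E1_def distrib_left by linarith
    have d\<sigma>: "norm (?\<sigma> - \<omega>) * norm ?\<xi> \<le> \<delta> * (2 * norm \<eta> * (N0 * norm ?X))"
    proof (cases "\<psi> x = 0")
      case True
      then show ?thesis using \<delta>(1) N0 by simp
    next
      case False
      then have "?\<sigma> = sgn (w \<theta> \<delta> x)"
        using \<psi>(2)[of x] by (simp add: v_def sgn_scaleR)
      then have "norm (?\<sigma> - \<omega>) \<le> \<delta> * (2 * norm \<eta>)"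
        using norm_sgn_diff_le[OF \<omega>, of "w \<theta> \<delta> x"] w\<omega> by simp
      from mult_mono[OF this n\<xi>] show ?thesis using \<delta>(1) by (simp add: mult_ac)
    qed
    have e2: "norm (?G - ?\<xi>) + norm (?\<sigma> - \<omega>) * norm ?\<xi> \<le> \<delta> * E2"
      using dG d\<sigma> unfolding E2_def distrib_left by linarith
    have E1: "0 \<le> E1" using e1 norm_ge_zero[of ?G] norm_ge_zero[of ?\<xi>] by linarith
    have E2': "0 \<le> \<delta> * E2"
      using e2 norm_ge_zero[of "?G - ?\<xi>"] mult_nonneg_nonneg[OF norm_ge_zero[of "?\<sigma> - \<omega>"] norm_ge_zero[of ?\<xi>]]
      by linarith
    have "norm (p_form (A x) s ?\<sigma> ?G - p_form (A x) s \<omega> ?\<xi>)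
      \<le> Kp * norm (A x) * (norm ?G + norm ?\<xi>) * (norm (?G - ?\<xi>) + norm (?\<sigma> - \<omega>) * norm ?\<xi>)"
      using \<omega> by (intro Kp(2) s norm_sgn_le_1) simp
    also have "\<dots> \<le> Kp * MA * E1 * (\<delta> * E2)"
      using Kp(1) A(2)[OF x] MA E1 E2' e1 e2 by (intro mult_mono) auto
    finally have 1: "norm (p_form (A x) s ?\<sigma> ?G - p_form (A x) s \<omega> ?\<xi>) \<le> Kp * MA * E1 * (\<delta> * E2)" .
    have "\<bar>norm ?G - norm ?\<xi>\<bar> \<le> \<delta> * E2"
      using norm_triangle_ineq3[of ?G ?\<xi>] e2 mult_nonneg_nonneg[OF norm_ge_zero[of "?\<sigma> - \<omega>"] norm_ge_zero[of ?\<xi>]]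
      by linarith
    then have "\<bar>norm ?G + norm ?\<xi>\<bar> * \<bar>norm ?G - norm ?\<xi>\<bar> \<le> E1 * (\<delta> * E2)"
      using e1 E1 by (intro mult_mono) auto
    moreover have "(norm ?G)\<^sup>2 - (norm ?\<xi>)\<^sup>2 = (norm ?G + norm ?\<xi>) * (norm ?G - norm ?\<xi>)"
      by (simp add: power2_eq_square algebra_simps)
    ultimately have "\<bar>(norm ?G)\<^sup>2 - (norm ?\<xi>)\<^sup>2\<bar> \<le> E1 * (\<delta> * E2)" by (simp only: abs_mult)
    then have "\<bar>C\<bar> * \<bar>(norm ?G)\<^sup>2 - (norm ?\<xi>)\<^sup>2\<bar> \<le> \<bar>C\<bar> * (E1 * (\<delta> * E2))"
      by (intro mult_left_mono) auto
    then have 2: "\<bar>C * (norm ?G)\<^sup>2 - C * (norm ?\<xi>)\<^sup>2\<bar> \<le> \<bar>C\<bar> * (E1 * (\<delta> * E2))"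
      by (simp only: abs_mult[symmetric] right_diff_distrib)
    have "\<bar>Re (p_form (A x) s ?\<sigma> ?G) - Re (p_form (A x) s \<omega> ?\<xi>)\<bar> \<le> Kp * MA * E1 * (\<delta> * E2)"
      using 1 abs_Re_le_cmod[of "p_form (A x) s ?\<sigma> ?G - p_form (A x) s \<omega> ?\<xi>"] by simp
    with 2 have "\<Phi> \<theta> \<delta> x \<le> Re (p_form (A x) s \<omega> ?\<xi>) - C * (norm ?\<xi>)\<^sup>2 + (Kp * MA * E1 * (\<delta> * E2) + \<bar>C\<bar> * (E1 * (\<delta> * E2)))"
      unfolding \<Phi>_def by linarith
    also have "Re (p_form (A x) s \<omega> ?\<xi>) - C * (norm ?\<xi>)\<^sup>2 = (\<psi> x * c \<theta> \<delta> x)\<^sup>2 * H x"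
      unfolding H_def p_form_scaleR norm_scaleR power_mult_distrib power2_abs by (simp add: algebra_simps)
    also have "Kp * MA * E1 * (\<delta> * E2) + \<bar>C\<bar> * (E1 * (\<delta> * E2)) = \<delta> * E * indicator K x"
      using True by (simp add: E_def algebra_simps)
    finally show ?thesis .
  qed
  have \<Phi>: "integrable ?L (\<Phi> \<theta> \<delta>)" "0 \<le> (LINT x|?L. \<Phi> \<theta> \<delta> x)" if \<delta>: "\<delta> > 0" for \<theta> \<delta>
  proof -
    have wg: "has_weak_gradient \<Omega> (v \<theta> \<delta>) (gradient (v \<theta> \<delta>))"
      by (rule has_weak_gradient_gradient[OF \<Omega> v[OF \<delta>]])
    then have L2: "L2_on \<Omega> (gradient (v \<theta> \<delta>))" "v \<theta> \<delta> \<in> borel_measurable ?L"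
      by (auto simp: has_weak_gradient_def L2_on_def)
    have i: "integrable ?L (\<lambda>x. p_form (A x) s (sgn (v \<theta> \<delta> x)) (gradient (v \<theta> \<delta>) x))"
      by (rule integrable_p_form[OF A \<Omega> s L2(2,1)])
    have j: "integrable ?L (\<lambda>x. (norm (gradient (v \<theta> \<delta>) x))\<^sup>2)" using L2(1) by (simp add: L2_on_def)
    have eq: "\<Phi> \<theta> \<delta> = (\<lambda>x. \<delta>\<^sup>2 * (Re (p_form (A x) s (sgn (v \<theta> \<delta> x)) (gradient (v \<theta> \<delta>) x))
        - C * (norm (gradient (v \<theta> \<delta>) x))\<^sup>2))"
      unfolding \<Phi>_def G_def p_form_scaleR norm_scaleR power_mult_distrib power2_abs
      by (simp add: algebra_simps)
    show "integrable ?L (\<Phi> \<theta> \<delta>)"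
      unfolding eq using i j by (intro integrable_mult_right Bochner_Integration.integrable_diff integrable_Re)
    have "(LINT x|?L. \<Phi> \<theta> \<delta> x) = \<delta>\<^sup>2 * (Re (LINT x|?L. p_form (A x) s (sgn (v \<theta> \<delta> x)) (gradient (v \<theta> \<delta>) x))
        - C * (LINT x|?L. (norm (gradient (v \<theta> \<delta>) x))\<^sup>2))"
      unfolding eq using i j by (simp add: integral_Re)
    then show "0 \<le> (LINT x|?L. \<Phi> \<theta> \<delta> x)" using ell[OF v[OF \<delta>]] by simp
  qed
  have \<Omega>s: "\<Omega> \<in> sets lebesgue" using \<Omega> by simp
  have Klm: "K \<in> lmeasurable" using K0(2) by (rule lmeasurable_compact)
  have iK: "integrable ?L (indicator K :: _ \<Rightarrow> real)"
  proof (rule integrable_lebesgue_on_bounded_support[OF \<Omega>s _ Klm, of _ 1])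
    show "(indicator K :: _ \<Rightarrow> real) \<in> borel_measurable ?L"
      using Klm by (intro measurable_restrict_space1) auto
  qed simp
  have iH: "integrable ?L (\<lambda>x. (\<psi> x)\<^sup>2 * H x)"
  proof -
    obtain K1 where K1: "K1 > 0" "\<And>(B :: ('n::finite, 'm::finite) coeff) s \<omega> \<xi>.
      \<bar>s\<bar> \<le> 1 \<Longrightarrow> norm \<omega> \<le> 1 \<Longrightarrow> norm (p_form B s \<omega> \<xi>) \<le> K1 * norm B * (norm \<xi>)\<^sup>2"
      using p_form_bound by blast
    show ?thesis
    proof (rule integrable_lebesgue_on_bounded_support[OF \<Omega>s _ Klm, of _ "N0\<^sup>2 * (K1 * MA * (norm ?X)\<^sup>2 + \<bar>C * (norm ?X)\<^sup>2\<bar>)"])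
      show "(\<lambda>x. (\<psi> x)\<^sup>2 * H x) \<in> borel_measurable ?L"
        unfolding H_def
        by (intro borel_measurable_times borel_measurable_diff borel_measurable_power borel_measurable_const
            borel_measurable_p_form[THEN measurable_compose[OF _ borel_measurable_Re]] A(1)
            continuous_imp_measurable_on_sets_lebesgue smooth_continuous_on K0 \<Omega>s)
      fix x assume x: "x \<in> \<Omega>"
      show "\<bar>(\<psi> x)\<^sup>2 * H x\<bar> \<le> N0\<^sup>2 * (K1 * MA * (norm ?X)\<^sup>2 + \<bar>C * (norm ?X)\<^sup>2\<bar>) * indicator K x"
      proof (cases "x \<in> K")
        case True
        have "norm (p_form (A x) s \<omega> ?X) \<le> K1 * norm (A x) * (norm ?X)\<^sup>2"
          using s \<omega> by (intro K1(2)) auto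
        also have "\<dots> \<le> K1 * MA * (norm ?X)\<^sup>2"
          using K1(1) A(2)[OF x] by (intro mult_right_mono mult_left_mono) auto
        finally have "\<bar>H x\<bar> \<le> K1 * MA * (norm ?X)\<^sup>2 + \<bar>C * (norm ?X)\<^sup>2\<bar>"
          using abs_Re_le_cmod[of "p_form (A x) s \<omega> ?X"] unfolding H_def by linarith
        moreover have "\<bar>(\<psi> x)\<^sup>2\<bar> \<le> N0\<^sup>2"
          using N(1)[OF True] by (simp add: abs_le_square_iff[symmetric])
        ultimately show ?thesis using True by (simp add: abs_mult mult_mono)
      qed (use K0(4) in simp)
    qed
  qed
  show ?thesis
  proof (rule field_le_epsilon)
    fix e :: real assume e: "e > 0"
    define J where "J = (LINT x|?L. indicator K x :: real)"
    \<comment> \<open>The first bound gives \<open>\<delta> \<le> 1\<close> and \<open>\<delta> * norm \<eta> \<le> 1\<close>, the second makes the total error at most \<open>e\<close>.\<close>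
    define \<delta> where "\<delta> = min (1 / (1 + norm \<eta>)) (e / (2 * \<bar>E\<bar> * \<bar>J\<bar> + 1))"
    have dd: "2 * \<bar>E\<bar> * \<bar>J\<bar> + 1 > 0" by (simp add: add_nonneg_pos)
    have \<delta>0: "\<delta> > 0" unfolding \<delta>_def using e dd by (simp add: add_pos_nonneg)
    have n1: "1 + norm \<eta> > 0" by (simp add: add_pos_nonneg)
    have le: "\<delta> \<le> 1 / (1 + norm \<eta>)" "\<delta> \<le> e / (2 * \<bar>E\<bar> * \<bar>J\<bar> + 1)" by (auto simp: \<delta>_def)
    have d1: "\<delta> * (1 + norm \<eta>) \<le> 1" using le(1) n1 by (simp add: pos_le_divide_eq)
    have d2: "\<delta> * (2 * \<bar>E\<bar> * \<bar>J\<bar> + 1) \<le> e" using le(2) dd by (simp add: pos_le_divide_eq)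
    have d\<eta>: "0 \<le> \<delta> * norm \<eta>" using \<delta>0 by simp
    have \<delta>1: "\<delta> \<le> 1" "\<delta> * norm \<eta> \<le> 1"
      using d1 d\<eta> \<delta>0 unfolding distrib_left by linarith+
    \<comment> \<open>The phase \<open>\<pi>/2\<close> turns the cosine into a sine.\<close>
    have cc: "(c 0 \<delta> x)\<^sup>2 + (c (pi / 2) \<delta> x)\<^sup>2 = 1" for x
      by (simp add: c_def cos_add)
    have "0 \<le> (LINT x|?L. \<Phi> 0 \<delta> x + \<Phi> (pi / 2) \<delta> x)"
      using \<Phi>[OF \<delta>0, of 0] \<Phi>[OF \<delta>0, of "pi / 2"] by simp
    also have "\<dots> \<le> (LINT x|?L. (\<psi> x)\<^sup>2 * H x + 2 * \<delta> * E * indicator K x)"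
    proof (rule integral_mono)
      show "integrable ?L (\<lambda>x. \<Phi> 0 \<delta> x + \<Phi> (pi / 2) \<delta> x)"
        by (intro Bochner_Integration.integrable_add \<Phi>(1) \<delta>0)
      show "integrable ?L (\<lambda>x. (\<psi> x)\<^sup>2 * H x + 2 * \<delta> * E * indicator K x)"
        by (intro Bochner_Integration.integrable_add iH integrable_mult_right iK)
      fix x assume "x \<in> space ?L"
      then have x: "x \<in> \<Omega>" by (simp add: space_restrict_space)
      have "\<Phi> 0 \<delta> x + \<Phi> (pi / 2) \<delta> x
          \<le> (\<psi> x)\<^sup>2 * ((c 0 \<delta> x)\<^sup>2 + (c (pi / 2) \<delta> x)\<^sup>2) * H x + 2 * \<delta> * E * indicator K x"
        using pointwise[OF \<delta>0 \<delta>1 x, of 0] pointwise[OF \<delta>0 \<delta>1 x, of "pi / 2"]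
        by (simp add: power_mult_distrib algebra_simps)
      then show "\<Phi> 0 \<delta> x + \<Phi> (pi / 2) \<delta> x \<le> (\<psi> x)\<^sup>2 * H x + 2 * \<delta> * E * indicator K x"
        unfolding cc by simp
    qed
    also have "\<dots> = (LINT x|?L. (\<psi> x)\<^sup>2 * H x) + 2 * \<delta> * E * J"
      unfolding J_def using iH iK by (simp del: integral_indicator)
    finally have 1: "0 \<le> (LINT x|?L. (\<psi> x)\<^sup>2 * H x) + 2 * \<delta> * E * J" .
    have "2 * \<delta> * E * J \<le> \<bar>2 * \<delta> * E * J\<bar>" by simp
    also have "\<dots> = \<delta> * (2 * \<bar>E\<bar> * \<bar>J\<bar>)" using \<delta>0 by (simp add: abs_mult)
    also have "\<dots> \<le> e" using d2 \<delta>0 unfolding distrib_left by linarith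
    finally show "0 \<le> (LINT x|?L. (\<psi> x)\<^sup>2 * H x) + e" using 1 by linarith
  qed
qed

section \<open>The ellipticity conditions and their implications\<close>

text \<open>
  The weak condition as the restriction of the strong one to tensors \<open>q \<otimes> \<eta>\<close>, whose norm is the product of
  the norms of the factors.
\<close>

lemma weak_p_elliptic_iff:
  "weak_p_elliptic \<Omega> A p \<longleftrightarrow>
     (\<exists>C>0. AE x in lebesgue_on \<Omega>. \<forall>\<eta> \<omega> q. norm \<omega> = 1 \<longrightarrow>
        C * (norm (rank_one q \<eta>))\<^sup>2 \<le> Re (p_form (A x) (1 - 2/p) \<omega> (rank_one q \<eta>)))"
  for A :: "real^'n::finite \<Rightarrow> ('n, 'm::finite) coeff"
proof -
  have key: "Re (cinner (symbol_matrix (A x) q *v (\<eta> - (s * Re (cinner \<omega> \<eta>)) *\<^sub>R \<omega>))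
          (\<eta> + (s * Re (cinner \<omega> \<eta>)) *\<^sub>R \<omega>)) = Re (p_form (A x) s \<omega> (rank_one q \<eta>))"
    for x \<eta> \<omega> q s
    unfolding Re_cinner_symbol_matrix p_form_def tensor_at_rank_one
    by (simp add: Re_cinner rank_one_add rank_one_diff rank_one_scaleR)
  show ?thesis
    unfolding weak_p_elliptic_def key norm_rank_one by (simp only: power_mult_distrib mult_ac)
qed

lemma legendre_hadamard_iff:
  "legendre_hadamard \<Omega> A \<longleftrightarrow>
     (\<exists>C>0. AE x in lebesgue_on \<Omega>. \<forall>\<eta> q.
        C * (norm (rank_one q \<eta>))\<^sup>2 \<le> Re (tensor_form (A x) (rank_one q \<eta>) (rank_one q \<eta>)))"
  for A :: "real^'n::finite \<Rightarrow> ('n, 'm::finite) coeff"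
  unfolding legendre_hadamard_def Re_cinner_symbol_matrix norm_rank_one
  by (simp add: power_mult_distrib mult_ac)

lemma strong_p_elliptic_iff:
  "strong_p_elliptic \<Omega> A p \<longleftrightarrow>
     (\<exists>C>0. AE x in lebesgue_on \<Omega>. \<forall>\<xi> \<omega>. norm \<omega> = 1 \<longrightarrow>
        C * (norm \<xi>)\<^sup>2 \<le> Re (p_form (A x) (1 - 2/p) \<omega> \<xi>))"
  unfolding strong_p_elliptic_def p_form_def ..

lemma integral_p_elliptic_iff:
  "integral_p_elliptic \<Omega> A p \<longleftrightarrow>
     (\<exists>C>0. \<forall>v \<in> W12_0 \<Omega>. \<forall>G. has_weak_gradient \<Omega> v G \<longrightarrow>
        C * (LINT x|lebesgue_on \<Omega>. (norm (G x))\<^sup>2)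
          \<le> Re (LINT x|lebesgue_on \<Omega>. p_form (A x) (1 - 2/p) (sgn (v x)) (G x)))"
  unfolding integral_p_elliptic_def p_form_def modulus_tensor_eq ..

lemma ex_norm_1: "\<exists>\<omega> :: complex^'m::finite. norm \<omega> = 1"
  using vector_choose_size[of 1] by (metis zero_le_one)

lemma p_param_bounds:
  fixes p :: real assumes "p > 1" shows "\<bar>1 - 2/p\<bar> < 1"
  using assms by (simp add: abs_less_iff divide_less_eq)

lemma exponent_two_param: "(1 - 2/2 :: real) = 0" by simp

lemma strong_p_elliptic_2_iff: "strong_p_elliptic \<Omega> A 2 \<longleftrightarrow> strongly_elliptic \<Omega> A"
  for A :: "real^'n::finite \<Rightarrow> ('n, 'm::finite) coeff"
  unfolding strong_p_elliptic_iff strongly_elliptic_def exponent_two_param p_form_zero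
  using ex_norm_1[where 'm = 'm] by simp

lemma integral_p_elliptic_2_iff: "integral_p_elliptic \<Omega> A 2 \<longleftrightarrow> integrally_elliptic \<Omega> A"
  unfolding integral_p_elliptic_iff integrally_elliptic_def exponent_two_param p_form_zero ..

lemma weak_p_elliptic_2_iff: "weak_p_elliptic \<Omega> A 2 \<longleftrightarrow> legendre_hadamard \<Omega> A"
  for A :: "real^'n::finite \<Rightarrow> ('n, 'm::finite) coeff"
  unfolding weak_p_elliptic_iff legendre_hadamard_iff exponent_two_param p_form_zero
  using ex_norm_1[where 'm = 'm] by simp

text \<open>
  At the zeros of \<open>v\<close> the direction \<open>sgn v\<close> is 0 and the integrand is the form for \<open>p = 2\<close>, whose
  coercivity comes from averaging.
\<close>

lemma strong_imp_integral_p_elliptic: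
  fixes A :: "real^'n::finite \<Rightarrow> ('n, 'm::finite) coeff"
  assumes \<Omega>: "open \<Omega>" and A: "A \<in> borel_measurable (lebesgue_on \<Omega>)" "\<And>x. x \<in> \<Omega> \<Longrightarrow> norm (A x) \<le> MA"
    and p: "p > 1" and str: "strong_p_elliptic \<Omega> A p"
  shows "integral_p_elliptic \<Omega> A p"
proof -
  define s where "s = 1 - 2/p"
  have s: "\<bar>s\<bar> < 1" unfolding s_def by (rule p_param_bounds[OF p])
  obtain C where C: "C > 0" and AE: "AE x in lebesgue_on \<Omega>. \<forall>\<xi> \<omega>. norm \<omega> = 1 \<longrightarrow>
      C * (norm \<xi>)\<^sup>2 \<le> Re (p_form (A x) s \<omega> \<xi>)"
    using str unfolding strong_p_elliptic_iff s_def by blast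
  define c where "c = min C (C / (4 * (1 + 2 / (1 - s))))"
  have c: "c > 0" using C s by (simp add: c_def add_pos_pos)
  show ?thesis
    unfolding integral_p_elliptic_iff s_def[symmetric]
  proof (intro exI[of _ c] conjI c ballI allI impI)
    fix v :: "real^'n \<Rightarrow> complex^'m" and G assume "has_weak_gradient \<Omega> v G"
    then have m: "v \<in> borel_measurable (lebesgue_on \<Omega>)" and L2: "L2_on \<Omega> G"
      by (auto simp: has_weak_gradient_def L2_on_def)
    have i: "integrable (lebesgue_on \<Omega>) (\<lambda>x. p_form (A x) s (sgn (v x)) (G x))"
      using s by (intro integrable_p_form[OF A \<Omega> _ m L2]) auto
    have j: "integrable (lebesgue_on \<Omega>) (\<lambda>x. (norm (G x))\<^sup>2)" using L2 by (simp add: L2_on_def)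
    have "c * (LINT x|lebesgue_on \<Omega>. (norm (G x))\<^sup>2) = (LINT x|lebesgue_on \<Omega>. c * (norm (G x))\<^sup>2)"
      by simp
    also have "\<dots> \<le> (LINT x|lebesgue_on \<Omega>. Re (p_form (A x) s (sgn (v x)) (G x)))"
    proof (rule integral_mono_AE)
      show "AE x in lebesgue_on \<Omega>. c * (norm (G x))\<^sup>2 \<le> Re (p_form (A x) s (sgn (v x)) (G x))"
        using AE
      proof eventually_elim
        case (elim x)
        show ?case
        proof (cases "v x = 0")
          case True
          have "c * (norm (G x))\<^sup>2 \<le> C / (4 * (1 + 2 / (1 - s))) * (norm (G x))\<^sup>2"
            by (intro mult_right_mono) (auto simp: c_def)
          also have "\<dots> \<le> Re (tensor_form (A x) (G x) (G x))"
            using elim by (intro p_form_coercive_imp_coercive s C) blast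
          finally show ?thesis using True by (simp add: p_form_def)
        next
          case False
          have "c * (norm (G x))\<^sup>2 \<le> C * (norm (G x))\<^sup>2"
            by (intro mult_right_mono) (auto simp: c_def)
          also have "\<dots> \<le> Re (p_form (A x) s (sgn (v x)) (G x))"
            using elim False by (simp add: norm_sgn)
          finally show ?thesis .
        qed
      qed
    qed (use i j in \<open>auto intro: integrable_Re\<close>)
    also have "\<dots> = Re (LINT x|lebesgue_on \<Omega>. p_form (A x) s (sgn (v x)) (G x))"
      using i by (rule integral_Re)
    finally show "c * (LINT x|lebesgue_on \<Omega>. (norm (G x))\<^sup>2)
      \<le> Re (LINT x|lebesgue_on \<Omega>. p_form (A x) s (sgn (v x)) (G x))" .
  qed
qed

text \<open>
  For fixed parameters the inequality holds off a null set that depends on them. A countable dense subset of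
  the set of admissible parameters, together with the continuity of the form in the parameters, gives a null set
  that is independent of them.
\<close>

lemma integral_imp_weak_p_elliptic:
  fixes A :: "real^'n::finite \<Rightarrow> ('n, 'm::finite) coeff"
  assumes \<Omega>: "open \<Omega>" and A: "A \<in> borel_measurable (lebesgue_on \<Omega>)" "\<And>x. x \<in> \<Omega> \<Longrightarrow> norm (A x) \<le> MA"
    and p: "p > 1" and int: "integral_p_elliptic \<Omega> A p"
  shows "weak_p_elliptic \<Omega> A p"
proof -
  define s where "s = 1 - 2/p"
  have s: "\<bar>s\<bar> \<le> 1" unfolding s_def using p_param_bounds[OF p] by simp
  obtain C where C: "C > 0" and ell: "\<forall>v \<in> W12_0 \<Omega>. \<forall>G. has_weak_gradient \<Omega> v G \<longrightarrow>
        C * (LINT x|lebesgue_on \<Omega>. (norm (G x))\<^sup>2)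
          \<le> Re (LINT x|lebesgue_on \<Omega>. p_form (A x) s (sgn (v x)) (G x))"
    using int unfolding integral_p_elliptic_iff s_def by blast
  have test: "C * (LINT x|lebesgue_on \<Omega>. (norm (gradient v x))\<^sup>2)
        \<le> Re (LINT x|lebesgue_on \<Omega>. p_form (A x) s (sgn (v x)) (gradient v x))"
    if "v \<in> test_functions \<Omega>" for v
    using ell test_functions_subset_W12_0[OF \<Omega> that] has_weak_gradient_gradient[OF \<Omega> that] by simp
  obtain K1 where K1: "K1 > 0" "\<And>(B :: ('n, 'm) coeff) s \<omega> \<xi>.
      \<bar>s\<bar> \<le> 1 \<Longrightarrow> norm \<omega> \<le> 1 \<Longrightarrow> norm (p_form B s \<omega> \<xi>) \<le> K1 * norm B * (norm \<xi>)\<^sup>2"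
    using p_form_bound by blast
  define F where "F x z = Re (p_form (A x) s (fst (snd z)) (rank_one (snd (snd z)) (fst z)))
      - C * (norm (rank_one (snd (snd z)) (fst z)))\<^sup>2"
    for x and z :: "(complex^'m) \<times> (complex^'m) \<times> (real^'n)"
  have AE: "AE x in lebesgue_on \<Omega>. 0 \<le> F x z" if z: "norm (fst (snd z)) = 1" for z
  proof -
    obtain \<eta> \<omega> q where zz: "z = (\<eta>, \<omega>, q)" by (metis prod.exhaust)
    have \<omega>: "norm \<omega> = 1" using z zz by simp
    let ?X = "rank_one q \<eta>"
    have "AE x in lebesgue_on \<Omega>. 0 \<le> Re (p_form (A x) s \<omega> ?X) - C * (norm ?X)\<^sup>2"
    proof (rule AE_nonneg_of_test_functions[OF \<Omega>, where M = "K1 * MA * (norm ?X)\<^sup>2 + \<bar>C * (norm ?X)\<^sup>2\<bar>"])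
      show "(\<lambda>x. Re (p_form (A x) s \<omega> ?X) - C * (norm ?X)\<^sup>2) \<in> borel_measurable (lebesgue_on \<Omega>)"
        by (intro borel_measurable_diff borel_measurable_const
            borel_measurable_p_form[THEN measurable_compose[OF _ borel_measurable_Re]] A(1))
      show "\<bar>Re (p_form (A x) s \<omega> ?X) - C * (norm ?X)\<^sup>2\<bar> \<le> K1 * MA * (norm ?X)\<^sup>2 + \<bar>C * (norm ?X)\<^sup>2\<bar>"
        if x: "x \<in> \<Omega>" for x
      proof -
        have "norm (p_form (A x) s \<omega> ?X) \<le> K1 * norm (A x) * (norm ?X)\<^sup>2"
          using s \<omega> by (intro K1(2)) auto
        also have "\<dots> \<le> K1 * MA * (norm ?X)\<^sup>2"
          using K1(1) A(2)[OF x] by (intro mult_right_mono mult_left_mono) auto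
        finally show ?thesis using abs_Re_le_cmod[of "p_form (A x) s \<omega> ?X"] by linarith
      qed
      show "0 \<le> (LINT x|lebesgue_on \<Omega>. (\<psi> x)\<^sup>2 * (Re (p_form (A x) s \<omega> ?X) - C * (norm ?X)\<^sup>2))"
        if "\<psi> \<in> test_functions \<Omega>" "\<And>x. 0 \<le> \<psi> x" for \<psi>
        using oscillation_inequality[OF \<Omega> A s \<omega> test that] .
    qed
    then show ?thesis by (simp add: F_def zz)
  qed
  define S where "S = {z :: (complex^'m) \<times> (complex^'m) \<times> (real^'n). norm (fst (snd z)) = 1}"
  obtain T where T: "countable T" "T \<subseteq> S" "S \<subseteq> closure T" using separable[of S] by blast
  have "AE x in lebesgue_on \<Omega>. \<forall>z\<in>T. 0 \<le> F x z"
    unfolding AE_ball_countable[OF T(1)] using AE T(2) by (auto simp: S_def)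
  then have "AE x in lebesgue_on \<Omega>. \<forall>\<eta> \<omega> q. norm \<omega> = 1 \<longrightarrow>
        C * (norm (rank_one q \<eta>))\<^sup>2 \<le> Re (p_form (A x) s \<omega> (rank_one q \<eta>))"
  proof eventually_elim
    case (elim x)
    have "continuous_on UNIV (F x)"
      unfolding F_def[abs_def] rank_one_def
      by (intro continuous_intros continuous_on_vec_lambda continuous_on_component)
    then have "closed {z. 0 \<le> F x z}" by (intro closed_Collect_le continuous_intros)
    then have "closure T \<subseteq> {z. 0 \<le> F x z}" using elim by (intro closure_minimal) auto
    then have F: "0 \<le> F x z" if "z \<in> S" for z using T(3) that by blast
    show ?case
    proof (intro allI impI)
      fix \<eta> \<omega> :: "complex^'m" and q :: "real^'n" assume "norm \<omega> = 1"
      then show "C * (norm (rank_one q \<eta>))\<^sup>2 \<le> Re (p_form (A x) s \<omega> (rank_one q \<eta>))"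
        using F[of "(\<eta>, \<omega>, q)"] by (simp add: S_def F_def)
    qed
  qed
  then show ?thesis unfolding weak_p_elliptic_iff s_def using C by blast
qed

text \<open>
  A direction \<open>\<omega>\<close> that is orthogonal to \<open>\<eta>\<close> for the real inner product makes the perturbation vanish, and
  \<open>i \<eta>\<close> has this property.
\<close>

lemma weak_imp_legendre_hadamard:
  fixes A :: "real^'n::finite \<Rightarrow> ('n, 'm::finite) coeff"
  assumes "weak_p_elliptic \<Omega> A p"
  shows "legendre_hadamard \<Omega> A"
proof -
  obtain C where C: "C > 0" and AE: "AE x in lebesgue_on \<Omega>. \<forall>\<eta> \<omega> q. norm \<omega> = 1 \<longrightarrow>
        C * (norm (rank_one q \<eta>))\<^sup>2 \<le> Re (p_form (A x) (1 - 2/p) \<omega> (rank_one q \<eta>))"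
    using assms unfolding weak_p_elliptic_iff by blast
  have orth: "\<exists>\<omega>. norm \<omega> = 1 \<and> inner \<omega> \<eta> = 0" for \<eta> :: "complex^'m"
  proof (cases "\<eta> = 0")
    case True
    then show ?thesis using ex_norm_1 by auto
  next
    case False
    define z where "z = (\<chi> \<alpha>. \<i> * \<eta> $ \<alpha>)"
    have "norm z = norm \<eta>" by (simp add: z_def norm_vec_def norm_mult)
    moreover have "inner z \<eta> = 0" by (simp add: z_def inner_vec_def inner_complex_def)
    ultimately show ?thesis using False by (intro exI[of _ "sgn z"]) (auto simp: norm_sgn sgn_div_norm)
  qed
  from AE have "AE x in lebesgue_on \<Omega>. \<forall>\<eta> q.
      C * (norm (rank_one q \<eta>))\<^sup>2 \<le> Re (tensor_form (A x) (rank_one q \<eta>) (rank_one q \<eta>))"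
  proof eventually_elim
    case (elim x)
    show ?case
    proof (intro allI)
      fix \<eta> :: "complex^'m" and q :: "real^'n"
      obtain \<omega> :: "complex^'m" where \<omega>: "norm \<omega> = 1" "inner \<omega> \<eta> = 0" using orth by blast
      have "tensor_at (rank_one q \<eta>) \<omega> = 0"
        unfolding tensor_at_rank_one \<omega>(2) by (simp add: rank_one_def vec_eq_iff)
      then have "p_form (A x) (1 - 2/p) \<omega> (rank_one q \<eta>) = tensor_form (A x) (rank_one q \<eta>) (rank_one q \<eta>)"
        by (simp add: p_form_def)
      then show "C * (norm (rank_one q \<eta>))\<^sup>2 \<le> Re (tensor_form (A x) (rank_one q \<eta>) (rank_one q \<eta>))"
        using elim \<omega>(1) by metis
    qed
  qed
  then show ?thesis unfolding legendre_hadamard_iff using C by blast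
qed

lemma strong_imp_weak_p_elliptic:
  fixes A :: "real^'n::finite \<Rightarrow> ('n, 'm::finite) coeff"
  assumes "strong_p_elliptic \<Omega> A p"
  shows "weak_p_elliptic \<Omega> A p"
proof -
  obtain C where C: "C > 0" and AE: "AE x in lebesgue_on \<Omega>. \<forall>\<xi> \<omega>. norm \<omega> = 1 \<longrightarrow>
      C * (norm \<xi>)\<^sup>2 \<le> Re (p_form (A x) (1 - 2/p) \<omega> \<xi>)"
    using assms unfolding strong_p_elliptic_iff by blast
  from AE have "AE x in lebesgue_on \<Omega>. \<forall>\<eta> \<omega> q. norm \<omega> = 1 \<longrightarrow>
      C * (norm (rank_one q \<eta>))\<^sup>2 \<le> Re (p_form (A x) (1 - 2/p) \<omega> (rank_one q \<eta>))"
    by eventually_elim simp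
  then show ?thesis unfolding weak_p_elliptic_iff using C by blast
qed

lemma conjugate_exponent_param:
  fixes p :: real assumes "p > 1" shows "1 - 2 / (p / (p - 1)) = - (1 - 2/p)"
  using assms by (simp add: field_simps)

text \<open>
  Adjunction exchanges the two arguments of the form up to conjugation, and so changes the sign of \<open>s\<close>; so does
  conjugation of the exponent. The next two lemmas have the same reason.
\<close>

lemma strong_p_elliptic_adjoint:
  assumes "p > 1" "strong_p_elliptic \<Omega> A p"
  shows "strong_p_elliptic \<Omega> (adjoint_coeff A) (p / (p - 1))"
  using assms(2) unfolding strong_p_elliptic_iff conjugate_exponent_param[OF assms(1)] p_form_adjoint
  by (simp add: complex_cnj)

lemma weak_p_elliptic_adjoint:
  assumes "p > 1" "weak_p_elliptic \<Omega> A p"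
  shows "weak_p_elliptic \<Omega> (adjoint_coeff A) (p / (p - 1))"
  using assms(2) unfolding weak_p_elliptic_iff conjugate_exponent_param[OF assms(1)] p_form_adjoint
  by simp

lemma integral_p_elliptic_adjoint:
  assumes "p > 1" "integral_p_elliptic \<Omega> A p"
  shows "integral_p_elliptic \<Omega> (adjoint_coeff A) (p / (p - 1))"
  using assms(2) unfolding integral_p_elliptic_iff conjugate_exponent_param[OF assms(1)] p_form_adjoint
    integral_cnj
  by simp

section \<open>Intervals of exponents\<close>

text \<open>
  The numbers \<open>a + s b - s\<^sup>2 d\<close> stand for the values of a form at the parameter \<open>s\<close>, and \<open>N\<close> for the square
  of the norm of the tensor. Between \<open>s1\<close> and \<open>s2\<close> concavity preserves the lower bound. Near the endpoints
  half of it survives because the slope is at most a multiple of \<open>N\<close>. What matters is the uniformity: the same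
  \<open>\<epsilon>\<close> serves all polynomials, that is, all points, tensors and directions.
\<close>

lemma concave_quadratic_margin:
  fixes K C s1 s2 :: real
  assumes K: "K \<ge> 0" and C: "C > 0" and s1: "\<bar>s1\<bar> \<le> 1" and s2: "\<bar>s2\<bar> \<le> 1"
  obtains \<epsilon> where "\<epsilon> > 0"
    "\<And>a b d N s. \<bar>b\<bar> \<le> K * N \<Longrightarrow> 0 \<le> d \<Longrightarrow> d \<le> K * N \<Longrightarrow> 0 \<le> N \<Longrightarrow>
      C * N \<le> a + s1 * b - s1\<^sup>2 * d \<Longrightarrow> C * N \<le> a + s2 * b - s2\<^sup>2 * d \<Longrightarrow>
      min s1 s2 - \<epsilon> \<le> s \<Longrightarrow> s \<le> max s1 s2 + \<epsilon> \<Longrightarrow> C / 2 * N \<le> a + s * b - s\<^sup>2 * d"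
proof -
  \<comment> \<open>Within distance \<open>\<epsilon> \<le> 1\<close> of an endpoint the value changes by at most \<open>4 * \<epsilon> * K * N\<close>, hence by at most \<open>C / 2 * N\<close>.\<close>
  define \<epsilon> where "\<epsilon> = min 1 (C / (8 * (K + 1)))"
  have \<epsilon>: "\<epsilon> > 0" "\<epsilon> \<le> 1" using K C by (auto simp: \<epsilon>_def)
  have "\<epsilon> \<le> C / (8 * (K + 1))" by (simp add: \<epsilon>_def)
  then have \<epsilon>K: "\<epsilon> * (8 * (K + 1)) \<le> C" using K by (simp add: pos_le_divide_eq)
  have near: "C / 2 * N \<le> a + s * b - s\<^sup>2 * d"
    if b: "\<bar>b\<bar> \<le> K * N" and d: "0 \<le> d" "d \<le> K * N" and N: "0 \<le> N"
      and t: "C * N \<le> a + t * b - t\<^sup>2 * d" "\<bar>t\<bar> \<le> 1" and st: "\<bar>s - t\<bar> \<le> \<epsilon>" for a b d N s t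
  proof -
    have sum: "\<bar>s + t\<bar> \<le> 3" using t(2) st \<epsilon> by linarith
    have "\<bar>(s + t) * d\<bar> \<le> 3 * (K * N)"
      unfolding abs_mult using sum d by (intro mult_mono) auto
    then have "\<bar>b - (s + t) * d\<bar> \<le> 4 * (K * N)" using b by linarith
    then have "\<bar>(s - t) * (b - (s + t) * d)\<bar> \<le> \<epsilon> * (4 * (K * N))"
      unfolding abs_mult using st \<epsilon> by (intro mult_mono) auto
    moreover have "\<epsilon> * (4 * (K * N)) \<le> C / 2 * N"
    proof -
      have "\<epsilon> * (8 * K) \<le> C" using \<epsilon>K \<epsilon> by (simp add: algebra_simps)
      from mult_right_mono[OF this N] show ?thesis by simp
    qed
    moreover have "a + s * b - s\<^sup>2 * d = a + t * b - t\<^sup>2 * d + (s - t) * (b - (s + t) * d)"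
      by (simp add: power2_eq_square algebra_simps)
    ultimately show ?thesis using t(1) by (simp add: abs_le_iff)
  qed
  have between: "C * N \<le> a + s * b - s\<^sup>2 * d"
    if d: "0 \<le> d" and t: "C * N \<le> a + t * b - t\<^sup>2 * d" and u: "C * N \<le> a + u * b - u\<^sup>2 * d"
      and s: "t \<le> s" "s \<le> u" for a b d N s t u
  proof (cases "t = u")
    case False
    with s have tu: "u - t > 0" by simp
    have "(u - t) * (C * N) = (u - s) * (C * N) + (s - t) * (C * N)" by (simp add: algebra_simps)
    also have "\<dots> \<le> (u - s) * (a + t * b - t\<^sup>2 * d) + (s - t) * (a + u * b - u\<^sup>2 * d)"
      using t u s by (intro add_mono mult_left_mono) auto
    also have "\<dots> \<le> (u - s) * (a + t * b - t\<^sup>2 * d) + (s - t) * (a + u * b - u\<^sup>2 * d)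
        + (s - t) * (u - s) * (u - t) * d"
      using s d by simp
    also have "\<dots> = (u - t) * (a + s * b - s\<^sup>2 * d)"
      by (simp add: power2_eq_square algebra_simps)
    finally show ?thesis using tu by simp
  qed (use s t in auto)
  show ?thesis
  proof (rule that[OF \<epsilon>(1)])
    fix a b d N s :: real
    assume b: "\<bar>b\<bar> \<le> K * N" and d: "0 \<le> d" "d \<le> K * N" and N: "0 \<le> N"
      and 1: "C * N \<le> a + s1 * b - s1\<^sup>2 * d" and 2: "C * N \<le> a + s2 * b - s2\<^sup>2 * d"
      and s: "min s1 s2 - \<epsilon> \<le> s" "s \<le> max s1 s2 + \<epsilon>"
    have CN: "C / 2 * N \<le> C * N" using C N by (intro mult_right_mono) auto
    consider "s1 \<le> s" "s \<le> s2" | "s2 \<le> s" "s \<le> s1" | "\<bar>s - s1\<bar> \<le> \<epsilon>" | "\<bar>s - s2\<bar> \<le> \<epsilon>"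
      using s by linarith
    then show "C / 2 * N \<le> a + s * b - s\<^sup>2 * d"
    proof cases
      case 1
      then show ?thesis using between[OF d(1) \<open>C * N \<le> a + s1 * b - s1\<^sup>2 * d\<close> 2 1] CN by linarith
    next
      case 2
      then show ?thesis using between[OF d(1) \<open>C * N \<le> a + s2 * b - s2\<^sup>2 * d\<close> 1 2] CN by linarith
    qed (use near[OF b d N 1 s1] near[OF b d N 2 s2] in auto)
  qed
qed

lemma two_div_lipschitz:
  fixes x y :: real
  assumes "x \<ge> 1" "y \<ge> 1" "y - x \<le> \<epsilon> / 2" "\<epsilon> > 0"
  shows "2 / x \<le> 2 / y + \<epsilon>"
proof -
  have "2 / x - 2 / y = 2 * (y - x) / (x * y)" using assms by (simp add: field_simps)
  also have "\<dots> \<le> \<epsilon>"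
  proof (cases "y \<le> x")
    case True
    then have "2 * (y - x) / (x * y) \<le> 0" using assms by (intro divide_nonpos_nonneg) auto
    then show ?thesis using assms by linarith
  next
    case False
    have "1 * 1 \<le> x * y" using assms by (intro mult_mono) auto
    then have "2 * (y - x) / (x * y) \<le> 2 * (y - x) / 1" using False by (intro divide_left_mono) auto
    then have "2 * (y - x) / (x * y) \<le> 2 * (y - x)" by simp
    also have "\<dots> \<le> \<epsilon>" using assms by simp
    finally show ?thesis .
  qed
  finally show ?thesis by linarith
qed

text \<open>
  Translation of a neighbourhood of the parameters \<open>1 - 2/p\<close> and \<open>1 - 2/q\<close> into an interval of exponents;
  \<open>r \<mapsto> 2/r\<close> has Lipschitz constant 2 on \<open>[1, \<infinity>)\<close>.
\<close>

lemma exponent_interval: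
  fixes p q \<epsilon> :: real
  assumes "p > 1" "q > 1" "\<epsilon> > 0"
  obtains a b where "1 \<le> a" "p \<in> {a<..<b}" "q \<in> {a<..<b}"
    "\<And>r. r \<in> {a<..<b} \<Longrightarrow> \<bar>1 - 2/r\<bar> \<le> 1 \<and>
      min (1 - 2/p) (1 - 2/q) - \<epsilon> \<le> 1 - 2/r \<and> 1 - 2/r \<le> max (1 - 2/p) (1 - 2/q) + \<epsilon>"
proof (rule that[of "max 1 (min p q - \<epsilon>/2)" "max p q + \<epsilon>/2"])
  fix r assume r: "r \<in> {max 1 (min p q - \<epsilon>/2)<..<max p q + \<epsilon>/2}"
  then have "\<bar>1 - 2/r\<bar> < 1" by (intro p_param_bounds) auto
  moreover have "2 / r \<le> 2 / min p q + \<epsilon>" "2 / max p q \<le> 2 / r + \<epsilon>"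
    using r assms by (intro two_div_lipschitz; auto)+
  ultimately show "\<bar>1 - 2/r\<bar> \<le> 1 \<and>
      min (1 - 2/p) (1 - 2/q) - \<epsilon> \<le> 1 - 2/r \<and> 1 - 2/r \<le> max (1 - 2/p) (1 - 2/q) + \<epsilon>"
    by (auto simp: min_def max_def split: if_splits)
qed (use assms in auto)

lemma tensor_at_form_bounds:
  obtains K where "K \<ge> 0"
    "\<And>(B :: ('n::finite, 'm::finite) coeff) \<xi> \<omega>. norm B \<le> MA \<Longrightarrow> norm \<omega> \<le> 1 \<Longrightarrow>
      \<bar>Re (tensor_form B \<xi> (tensor_at \<xi> \<omega>)) - Re (tensor_form B (tensor_at \<xi> \<omega>) \<xi>)\<bar> \<le> K * (norm \<xi>)\<^sup>2 \<and>
      Re (tensor_form B (tensor_at \<xi> \<omega>) (tensor_at \<xi> \<omega>)) \<le> K * (norm \<xi>)\<^sup>2"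
proof -
  obtain K where K: "K > 0"
    "\<And>(B :: ('n, 'm) coeff) \<xi> \<eta>. norm (tensor_form B \<xi> \<eta>) \<le> K * norm B * norm \<xi> * norm \<eta>"
    using tensor_form_bound by blast
  have "\<bar>Re (tensor_form B \<xi> (tensor_at \<xi> \<omega>)) - Re (tensor_form B (tensor_at \<xi> \<omega>) \<xi>)\<bar> \<le> (2 * K * \<bar>MA\<bar>) * (norm \<xi>)\<^sup>2 \<and>
      Re (tensor_form B (tensor_at \<xi> \<omega>) (tensor_at \<xi> \<omega>)) \<le> (2 * K * \<bar>MA\<bar>) * (norm \<xi>)\<^sup>2"
    if B: "norm B \<le> MA" and \<omega>: "norm \<omega> \<le> 1" for B :: "('n, 'm) coeff" and \<xi> \<omega>
  proof -
    have bd: "\<bar>Re (tensor_form B x y)\<bar> \<le> K * \<bar>MA\<bar> * (norm \<xi>)\<^sup>2"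
      if x: "norm x \<le> norm \<xi>" and y: "norm y \<le> norm \<xi>" for x y
    proof -
      have "\<bar>Re (tensor_form B x y)\<bar> \<le> norm (tensor_form B x y)" by (rule abs_Re_le_cmod)
      also have "\<dots> \<le> (K * norm B) * (norm x * norm y)" using K(2)[of B x y] by simp
      also have "\<dots> \<le> (K * \<bar>MA\<bar>) * (norm \<xi> * norm \<xi>)"
        using B K(1) x y by (intro mult_mono mult_nonneg_nonneg) auto
      finally show ?thesis by (simp add: power2_eq_square)
    qed
    note T = norm_tensor_at_le[OF \<omega>, of \<xi>]
    show ?thesis
      using bd[OF order_refl T] bd[OF T order_refl] bd[OF T T] abs_ge_zero[of "Re (tensor_form B \<xi> (tensor_at \<xi> \<omega>))"]
      by (simp add: abs_le_iff)
  qed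
  then show ?thesis using that[of "2 * K * \<bar>MA\<bar>"] K by simp
qed

text \<open>
  The tensor \<open>\<xi>(\<omega>)\<close> is the rank-one tensor with first factor \<open>(Re \<langle>\<omega>, \<xi>\<^sub>h\<rangle>)\<^sub>h\<close>, which is real. This is
  the source of concavity in \<open>s\<close>.
\<close>

lemma AE_tensor_at_nonneg:
  fixes A :: "real^'n::finite \<Rightarrow> ('n, 'm::finite) coeff"
  assumes "legendre_hadamard \<Omega> A"
  shows "AE x in lebesgue_on \<Omega>. \<forall>\<xi> \<omega>. 0 \<le> Re (tensor_form (A x) (tensor_at \<xi> \<omega>) (tensor_at \<xi> \<omega>))"
proof -
  obtain C where C: "C > 0" and AE: "AE x in lebesgue_on \<Omega>. \<forall>\<eta> q.
        C * (norm (rank_one q \<eta>))\<^sup>2 \<le> Re (tensor_form (A x) (rank_one q \<eta>) (rank_one q \<eta>))"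
    using assms unfolding legendre_hadamard_iff by blast
  from AE show ?thesis
  proof eventually_elim
    case (elim x)
    show ?case
    proof (intro allI)
      fix \<xi> :: "complex^'m^'n" and \<omega>
      have "0 \<le> C * (norm (tensor_at \<xi> \<omega>))\<^sup>2" using C by simp
      also have "\<dots> \<le> Re (tensor_form (A x) (tensor_at \<xi> \<omega>) (tensor_at \<xi> \<omega>))"
        unfolding tensor_at_conv_rank_one using elim by blast
      finally show "0 \<le> Re (tensor_form (A x) (tensor_at \<xi> \<omega>) (tensor_at \<xi> \<omega>))" .
    qed
  qed
qed

lemma AE_in_lebesgue_on: "AE x in lebesgue_on \<Omega>. x \<in> \<Omega>"
  by (rule AE_I2) (simp add: space_restrict_space)

text \<open>
  The set \<open>X\<close> allows one proof for two conditions: all tensors give the strong, rank-one tensors the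
  weak condition.
\<close>

lemma pointwise_coercivity_interval:
  fixes A :: "real^'n::finite \<Rightarrow> ('n, 'm::finite) coeff" and X :: "(complex^'m^'n) set"
  assumes A: "\<And>x. x \<in> \<Omega> \<Longrightarrow> norm (A x) \<le> MA"
    and p: "p > 1" and q: "q > 1" and lh: "legendre_hadamard \<Omega> A"
  defines "E \<equiv> \<lambda>r. \<exists>C>0. AE x in lebesgue_on \<Omega>. \<forall>\<xi>\<in>X. \<forall>\<omega>. norm \<omega> = 1 \<longrightarrow>
        C * (norm \<xi>)\<^sup>2 \<le> Re (p_form (A x) (1 - 2/r) \<omega> \<xi>)"
  assumes Ep: "E p" and Eq: "E q"
  shows "\<exists>a b. 1 \<le> a \<and> p \<in> {a<..<b} \<and> q \<in> {a<..<b} \<and> (\<forall>r\<in>{a<..<b}. E r)"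
proof -
  let ?sp = "1 - 2/p" and ?sq = "1 - 2/q"
  obtain C1 where C1: "C1 > 0" "AE x in lebesgue_on \<Omega>. \<forall>\<xi>\<in>X. \<forall>\<omega>. norm \<omega> = 1 \<longrightarrow>
        C1 * (norm \<xi>)\<^sup>2 \<le> Re (p_form (A x) ?sp \<omega> \<xi>)" using Ep unfolding E_def by blast
  obtain C2 where C2: "C2 > 0" "AE x in lebesgue_on \<Omega>. \<forall>\<xi>\<in>X. \<forall>\<omega>. norm \<omega> = 1 \<longrightarrow>
        C2 * (norm \<xi>)\<^sup>2 \<le> Re (p_form (A x) ?sq \<omega> \<xi>)" using Eq unfolding E_def by blast
  define C where "C = min C1 C2"
  have C: "C > 0" using C1 C2 by (simp add: C_def)
  obtain K where K: "K \<ge> 0"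
    "\<And>(B :: ('n, 'm) coeff) \<xi> \<omega>. norm B \<le> MA \<Longrightarrow> norm \<omega> \<le> 1 \<Longrightarrow>
      \<bar>Re (tensor_form B \<xi> (tensor_at \<xi> \<omega>)) - Re (tensor_form B (tensor_at \<xi> \<omega>) \<xi>)\<bar> \<le> K * (norm \<xi>)\<^sup>2 \<and>
      Re (tensor_form B (tensor_at \<xi> \<omega>) (tensor_at \<xi> \<omega>)) \<le> K * (norm \<xi>)\<^sup>2"
    by (rule tensor_at_form_bounds[of MA]) blast
  obtain \<epsilon> where \<epsilon>: "\<epsilon> > 0"
    "\<And>a b d N s. \<bar>b\<bar> \<le> K * N \<Longrightarrow> 0 \<le> d \<Longrightarrow> d \<le> K * N \<Longrightarrow> 0 \<le> N \<Longrightarrow>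
      C * N \<le> a + ?sp * b - ?sp\<^sup>2 * d \<Longrightarrow> C * N \<le> a + ?sq * b - ?sq\<^sup>2 * d \<Longrightarrow>
      min ?sp ?sq - \<epsilon> \<le> s \<Longrightarrow> s \<le> max ?sp ?sq + \<epsilon> \<Longrightarrow> C / 2 * N \<le> a + s * b - s\<^sup>2 * d"
    by (rule concave_quadratic_margin[OF K(1) C less_imp_le[OF p_param_bounds[OF p]] less_imp_le[OF p_param_bounds[OF q]]]) blast
  obtain a b where ab: "1 \<le> a" "p \<in> {a<..<b}" "q \<in> {a<..<b}"
    "\<And>r. r \<in> {a<..<b} \<Longrightarrow> \<bar>1 - 2/r\<bar> \<le> 1 \<and> min ?sp ?sq - \<epsilon> \<le> 1 - 2/r \<and> 1 - 2/r \<le> max ?sp ?sq + \<epsilon>"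
    by (rule exponent_interval[OF p q \<epsilon>(1)]) blast
  have "E r" if r: "r \<in> {a<..<b}" for r
    unfolding E_def
  proof (intro exI[of _ "C / 2"] conjI)
    show "C / 2 > 0" using C by simp
    show "AE x in lebesgue_on \<Omega>. \<forall>\<xi>\<in>X. \<forall>\<omega>. norm \<omega> = 1 \<longrightarrow>
        C / 2 * (norm \<xi>)\<^sup>2 \<le> Re (p_form (A x) (1 - 2/r) \<omega> \<xi>)"
      using C1(2) C2(2) AE_tensor_at_nonneg[OF lh] AE_in_lebesgue_on
    proof eventually_elim
      case (elim x)
      show ?case
      proof (intro ballI allI impI)
        fix \<xi> and \<omega> :: "complex^'m" assume \<xi>: "\<xi> \<in> X" and \<omega>: "norm \<omega> = 1"
        have "C * (norm \<xi>)\<^sup>2 \<le> C1 * (norm \<xi>)\<^sup>2" "C * (norm \<xi>)\<^sup>2 \<le> C2 * (norm \<xi>)\<^sup>2"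
          by (auto simp: C_def intro!: mult_right_mono)
        moreover have "C1 * (norm \<xi>)\<^sup>2 \<le> Re (p_form (A x) ?sp \<omega> \<xi>)" "C2 * (norm \<xi>)\<^sup>2 \<le> Re (p_form (A x) ?sq \<omega> \<xi>)"
          using elim \<xi> \<omega> by blast+
        ultimately have "C * (norm \<xi>)\<^sup>2 \<le> Re (p_form (A x) ?sp \<omega> \<xi>)" "C * (norm \<xi>)\<^sup>2 \<le> Re (p_form (A x) ?sq \<omega> \<xi>)"
          by linarith+
        then show "C / 2 * (norm \<xi>)\<^sup>2 \<le> Re (p_form (A x) (1 - 2/r) \<omega> \<xi>)"
          unfolding p_form_expand
          using elim(3,4) K(2)[OF A[OF elim(4)], of \<omega> \<xi>] \<omega> ab(4)[OF r] by (intro \<epsilon>(2)) auto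
      qed
    qed
  qed
  then show ?thesis using ab by blast
qed

lemma strong_p_elliptic_interval:
  fixes A :: "real^'n::finite \<Rightarrow> ('n, 'm::finite) coeff"
  assumes "\<And>x. x \<in> \<Omega> \<Longrightarrow> norm (A x) \<le> MA" "p > 1" "q > 1"
    "strong_p_elliptic \<Omega> A p" "strong_p_elliptic \<Omega> A q"
  shows "\<exists>a b. 1 \<le> a \<and> p \<in> {a<..<b} \<and> q \<in> {a<..<b} \<and> (\<forall>r\<in>{a<..<b}. strong_p_elliptic \<Omega> A r)"
  using pointwise_coercivity_interval[where X = UNIV, OF assms(1-3)
      weak_imp_legendre_hadamard[OF strong_imp_weak_p_elliptic[OF assms(4)]]] assms(4,5)
  unfolding strong_p_elliptic_iff by simp

lemma weak_p_elliptic_interval: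
  fixes A :: "real^'n::finite \<Rightarrow> ('n, 'm::finite) coeff"
  assumes "\<And>x. x \<in> \<Omega> \<Longrightarrow> norm (A x) \<le> MA" "p > 1" "q > 1"
    "weak_p_elliptic \<Omega> A p" "weak_p_elliptic \<Omega> A q"
  shows "\<exists>a b. 1 \<le> a \<and> p \<in> {a<..<b} \<and> q \<in> {a<..<b} \<and> (\<forall>r\<in>{a<..<b}. weak_p_elliptic \<Omega> A r)"
proof -
  let ?X = "{rank_one q \<eta> | (q :: real^'n) (\<eta> :: complex^'m). True}"
  have "weak_p_elliptic \<Omega> A r \<longleftrightarrow> (\<exists>C>0. AE x in lebesgue_on \<Omega>. \<forall>\<xi>\<in>?X. \<forall>\<omega>. norm \<omega> = 1 \<longrightarrow>
        C * (norm \<xi>)\<^sup>2 \<le> Re (p_form (A x) (1 - 2/r) \<omega> \<xi>))" for r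
  proof -
    have "(\<forall>\<xi>\<in>?X. P \<xi>) \<longleftrightarrow> (\<forall>\<eta> q. P (rank_one q \<eta>))" for P by blast
    then have "(\<forall>\<xi>\<in>?X. \<forall>\<omega>. norm \<omega> = 1 \<longrightarrow> C * (norm \<xi>)\<^sup>2 \<le> Re (p_form (A x) (1 - 2/r) \<omega> \<xi>))
      \<longleftrightarrow> (\<forall>\<eta> \<omega> q. norm \<omega> = 1 \<longrightarrow> C * (norm (rank_one q \<eta>))\<^sup>2 \<le> Re (p_form (A x) (1 - 2/r) \<omega> (rank_one q \<eta>)))" for C x
      by blast
    then show ?thesis unfolding weak_p_elliptic_iff by simp
  qed
  with pointwise_coercivity_interval[where X = ?X, OF assms(1-3) weak_imp_legendre_hadamard[OF assms(4)]] assms(4,5)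
  show ?thesis by simp
qed

lemma abs_integral_le:
  fixes f g :: "'a \<Rightarrow> real"
  assumes "integrable M f" "integrable M g" "AE x in M. \<bar>f x\<bar> \<le> g x"
  shows "\<bar>integral\<^sup>L M f\<bar> \<le> integral\<^sup>L M g"
proof -
  have "\<bar>integral\<^sup>L M f\<bar> \<le> (LINT x|M. \<bar>f x\<bar>)" using integral_norm_bound[of M f] by simp
  also have "\<dots> \<le> integral\<^sup>L M g" using assms by (intro integral_mono_AE integrable_abs) auto
  finally show ?thesis .
qed

text \<open>
  The integrated form is again a quadratic polynomial in \<open>s\<close>. Its concavity is inherited from the pointwise one,
  since the integral condition implies the weak and hence the Legendre-Hadamard condition.
\<close>

lemma integral_p_elliptic_interval:
  fixes A :: "real^'n::finite \<Rightarrow> ('n, 'm::finite) coeff"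
  assumes \<Omega>: "open \<Omega>" and A: "A \<in> borel_measurable (lebesgue_on \<Omega>)" "\<And>x. x \<in> \<Omega> \<Longrightarrow> norm (A x) \<le> MA"
    and p: "p > 1" and q: "q > 1"
    and Ep: "integral_p_elliptic \<Omega> A p" and Eq: "integral_p_elliptic \<Omega> A q"
  shows "\<exists>a b. 1 \<le> a \<and> p \<in> {a<..<b} \<and> q \<in> {a<..<b} \<and> (\<forall>r\<in>{a<..<b}. integral_p_elliptic \<Omega> A r)"
proof -
  let ?L = "lebesgue_on \<Omega>"
  let ?sp = "1 - 2/p" and ?sq = "1 - 2/q"
  have lh: "legendre_hadamard \<Omega> A"
    by (rule weak_imp_legendre_hadamard[OF integral_imp_weak_p_elliptic[OF \<Omega> A p Ep]])
  obtain C1 where C1: "C1 > 0" "\<forall>v \<in> W12_0 \<Omega>. \<forall>G. has_weak_gradient \<Omega> v G \<longrightarrow>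
        C1 * (LINT x|?L. (norm (G x))\<^sup>2) \<le> Re (LINT x|?L. p_form (A x) ?sp (sgn (v x)) (G x))"
    using Ep unfolding integral_p_elliptic_iff by blast
  obtain C2 where C2: "C2 > 0" "\<forall>v \<in> W12_0 \<Omega>. \<forall>G. has_weak_gradient \<Omega> v G \<longrightarrow>
        C2 * (LINT x|?L. (norm (G x))\<^sup>2) \<le> Re (LINT x|?L. p_form (A x) ?sq (sgn (v x)) (G x))"
    using Eq unfolding integral_p_elliptic_iff by blast
  define C where "C = min C1 C2"
  have C: "C > 0" using C1 C2 by (simp add: C_def)
  obtain K where K: "K \<ge> 0"
    "\<And>(B :: ('n, 'm) coeff) \<xi> \<omega>. norm B \<le> MA \<Longrightarrow> norm \<omega> \<le> 1 \<Longrightarrow>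
      \<bar>Re (tensor_form B \<xi> (tensor_at \<xi> \<omega>)) - Re (tensor_form B (tensor_at \<xi> \<omega>) \<xi>)\<bar> \<le> K * (norm \<xi>)\<^sup>2 \<and>
      Re (tensor_form B (tensor_at \<xi> \<omega>) (tensor_at \<xi> \<omega>)) \<le> K * (norm \<xi>)\<^sup>2"
    by (rule tensor_at_form_bounds[of MA]) blast
  obtain \<epsilon> where \<epsilon>: "\<epsilon> > 0"
    "\<And>a b d N s. \<bar>b\<bar> \<le> K * N \<Longrightarrow> 0 \<le> d \<Longrightarrow> d \<le> K * N \<Longrightarrow> 0 \<le> N \<Longrightarrow>
      C * N \<le> a + ?sp * b - ?sp\<^sup>2 * d \<Longrightarrow> C * N \<le> a + ?sq * b - ?sq\<^sup>2 * d \<Longrightarrow>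
      min ?sp ?sq - \<epsilon> \<le> s \<Longrightarrow> s \<le> max ?sp ?sq + \<epsilon> \<Longrightarrow> C / 2 * N \<le> a + s * b - s\<^sup>2 * d"
    by (rule concave_quadratic_margin[OF K(1) C less_imp_le[OF p_param_bounds[OF p]] less_imp_le[OF p_param_bounds[OF q]]]) blast
  obtain a b where ab: "1 \<le> a" "p \<in> {a<..<b}" "q \<in> {a<..<b}"
    "\<And>r. r \<in> {a<..<b} \<Longrightarrow> \<bar>1 - 2/r\<bar> \<le> 1 \<and> min ?sp ?sq - \<epsilon> \<le> 1 - 2/r \<and> 1 - 2/r \<le> max ?sp ?sq + \<epsilon>"
    by (rule exponent_interval[OF p q \<epsilon>(1)]) blast
  have "integral_p_elliptic \<Omega> A r" if r: "r \<in> {a<..<b}" for r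
    unfolding integral_p_elliptic_iff
  proof (intro exI[of _ "C / 2"] conjI ballI allI impI)
    show "C / 2 > 0" using C by simp
    fix v :: "real^'n \<Rightarrow> complex^'m" and G assume v: "v \<in> W12_0 \<Omega>" and wg: "has_weak_gradient \<Omega> v G"
    then have mv: "v \<in> borel_measurable ?L" and L2: "L2_on \<Omega> G" and mG: "G \<in> borel_measurable ?L"
      and iN: "integrable ?L (\<lambda>x. (norm (G x))\<^sup>2)"
      by (auto simp: has_weak_gradient_def L2_on_def)
    define T where "T x = tensor_at (G x) (sgn (v x))" for x
    have mT: "T \<in> borel_measurable ?L"
      unfolding T_def[abs_def] by (intro borel_measurable_tensor_at borel_measurable_sgn_vec mG mv)
    have nT: "norm (T x) \<le> 1 * norm (G x)" for x
      unfolding T_def using norm_tensor_at_le[OF norm_sgn_le_1] by simp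
    have nG: "norm (G x) \<le> 1 * norm (G x)" for x by simp
    have i1: "integrable ?L (\<lambda>x. Re (tensor_form (A x) (G x) (G x)))"
      by (rule integrable_Re[OF integrable_tensor_form[OF A \<Omega> mG nG mG nG iN]])
    have i2: "integrable ?L (\<lambda>x. Re (tensor_form (A x) (G x) (T x)))"
      by (rule integrable_Re[OF integrable_tensor_form[OF A \<Omega> mG nG mT nT iN]])
    have i3: "integrable ?L (\<lambda>x. Re (tensor_form (A x) (T x) (G x)))"
      by (rule integrable_Re[OF integrable_tensor_form[OF A \<Omega> mT nT mG nG iN]])
    have i4: "integrable ?L (\<lambda>x. Re (tensor_form (A x) (T x) (T x)))"
      by (rule integrable_Re[OF integrable_tensor_form[OF A \<Omega> mT nT mT nT iN]])
    note i = i1 i2 i3 i4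
    define N where "N = (LINT x|?L. (norm (G x))\<^sup>2)"
    define \<alpha> where "\<alpha> = (LINT x|?L. Re (tensor_form (A x) (G x) (G x)))"
    define \<beta> where "\<beta> = (LINT x|?L. Re (tensor_form (A x) (G x) (T x)) - Re (tensor_form (A x) (T x) (G x)))"
    define d where "d = (LINT x|?L. Re (tensor_form (A x) (T x) (T x)))"
    have expand: "Re (LINT x|?L. p_form (A x) s (sgn (v x)) (G x)) = \<alpha> + s * \<beta> - s\<^sup>2 * d" if s: "\<bar>s\<bar> \<le> 1" for s
    proof -
      have "Re (LINT x|?L. p_form (A x) s (sgn (v x)) (G x)) = (LINT x|?L. Re (p_form (A x) s (sgn (v x)) (G x)))"
        by (rule integral_Re[symmetric]) (rule integrable_p_form[OF A \<Omega> s mv L2])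
      also have "\<dots> = \<alpha> + s * \<beta> - s\<^sup>2 * d"
        unfolding p_form_expand T_def[symmetric] \<alpha>_def \<beta>_def d_def using i by simp
      finally show ?thesis .
    qed
    have bnd: "AE x in ?L. \<bar>Re (tensor_form (A x) (G x) (T x)) - Re (tensor_form (A x) (T x) (G x))\<bar> \<le> K * (norm (G x))\<^sup>2
        \<and> Re (tensor_form (A x) (T x) (T x)) \<le> K * (norm (G x))\<^sup>2"
      using AE_in_lebesgue_on
    proof eventually_elim
      case (elim x)
      show ?case unfolding T_def by (rule K(2)[OF A(2)[OF elim] norm_sgn_le_1])
    qed
    have "\<bar>\<beta>\<bar> \<le> (LINT x|?L. K * (norm (G x))\<^sup>2)"
      unfolding \<beta>_def using bnd
      by (intro abs_integral_le Bochner_Integration.integrable_diff i integrable_mult_right iN) auto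
    then have \<beta>: "\<bar>\<beta>\<bar> \<le> K * N" by (simp add: N_def)
    have "d \<le> (LINT x|?L. K * (norm (G x))\<^sup>2)"
      unfolding d_def using bnd by (intro integral_mono_AE i integrable_mult_right iN) auto
    then have d: "d \<le> K * N" by (simp add: N_def)
    have d0: "0 \<le> d"
      unfolding d_def using AE_tensor_at_nonneg[OF lh]
      by (intro integral_nonneg_AE) (auto simp: T_def)
    have N: "0 \<le> N" unfolding N_def by simp
    have "C * N \<le> C1 * N" "C * N \<le> C2 * N" using N by (auto simp: C_def intro!: mult_right_mono)
    moreover have "C1 * N \<le> \<alpha> + ?sp * \<beta> - ?sp\<^sup>2 * d"
      unfolding N_def expand[OF less_imp_le[OF p_param_bounds[OF p]], symmetric] using C1(2) v wg by blast
    moreover have "C2 * N \<le> \<alpha> + ?sq * \<beta> - ?sq\<^sup>2 * d"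
      unfolding N_def expand[OF less_imp_le[OF p_param_bounds[OF q]], symmetric] using C2(2) v wg by blast
    ultimately have "C * N \<le> \<alpha> + ?sp * \<beta> - ?sp\<^sup>2 * d" "C * N \<le> \<alpha> + ?sq * \<beta> - ?sq\<^sup>2 * d" by linarith+
    then have "C / 2 * N \<le> \<alpha> + (1 - 2/r) * \<beta> - (1 - 2/r)\<^sup>2 * d"
      using ab(4)[OF r] by (intro \<epsilon>(2) \<beta> d d0 N) auto
    then show "C / 2 * (LINT x|?L. (norm (G x))\<^sup>2) \<le> Re (LINT x|?L. p_form (A x) (1 - 2/r) (sgn (v x)) (G x))"
      using expand[of "1 - 2/r"] ab(4)[OF r] by (simp add: N_def)
  qed
  then show ?thesis using ab by blast
qed

theorem theorem1p1:
  fixes \<Omega> :: "(real^'n::finite) set"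
    and A :: "real^'n \<Rightarrow> complex^'m::finite^'m^'n^'n"
  assumes "open \<Omega>"
    and "A \<in> borel_measurable (lebesgue_on \<Omega>)"
    and "bounded (A ` \<Omega>)"
  shows
    "(\<forall>p>1. strong_p_elliptic \<Omega> A p \<longrightarrow> integral_p_elliptic \<Omega> A p) \<and>
     (\<forall>p>1. integral_p_elliptic \<Omega> A p \<longrightarrow> weak_p_elliptic \<Omega> A p) \<and>
     ((strong_p_elliptic \<Omega> A 2 \<longleftrightarrow> strongly_elliptic \<Omega> A) \<and>
      (integral_p_elliptic \<Omega> A 2 \<longleftrightarrow> integrally_elliptic \<Omega> A) \<and>
      (weak_p_elliptic \<Omega> A 2 \<longleftrightarrow> legendre_hadamard \<Omega> A)) \<and>
     ((\<forall>p>1.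
        (strong_p_elliptic \<Omega> A p \<longrightarrow> strong_p_elliptic \<Omega> (adjoint_coeff A) (p / (p - 1))) \<and>
        (integral_p_elliptic \<Omega> A p \<longrightarrow> integral_p_elliptic \<Omega> (adjoint_coeff A) (p / (p - 1))) \<and>
        (weak_p_elliptic \<Omega> A p \<longrightarrow> weak_p_elliptic \<Omega> (adjoint_coeff A) (p / (p - 1)))) \<and>
      (\<forall>p>1. weak_p_elliptic \<Omega> A p \<longrightarrow> weak_p_elliptic \<Omega> A 2 \<and> legendre_hadamard \<Omega> A)) \<and>
     (\<forall>P \<in> {strong_p_elliptic, integral_p_elliptic, weak_p_elliptic}. \<forall>p>1. \<forall>q>1.
        P \<Omega> A p \<and> P \<Omega> A q \<longrightarrow>
        (\<exists>a b. 1 \<le> a \<and> p \<in> {a<..<b} \<and> q \<in> {a<..<b} \<and> (\<forall>r\<in>{a<..<b}. P \<Omega> A r)))"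
proof -
  obtain MA where MA: "\<And>x. x \<in> \<Omega> \<Longrightarrow> norm (A x) \<le> MA"
    using assms(3) unfolding bounded_iff by blast
  note A = assms(1,2) MA
  show ?thesis
  proof (intro conjI allI impI ballI)
    fix p :: real assume p: "p > 1"
    show "integral_p_elliptic \<Omega> A p" if "strong_p_elliptic \<Omega> A p"
      using strong_imp_integral_p_elliptic[OF A p that] .
    show "weak_p_elliptic \<Omega> A p" if "integral_p_elliptic \<Omega> A p"
      using integral_imp_weak_p_elliptic[OF A p that] .
    show "strong_p_elliptic \<Omega> (adjoint_coeff A) (p / (p - 1))" if "strong_p_elliptic \<Omega> A p"
      using strong_p_elliptic_adjoint[OF p that] .
    show "integral_p_elliptic \<Omega> (adjoint_coeff A) (p / (p - 1))" if "integral_p_elliptic \<Omega> A p"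
      using integral_p_elliptic_adjoint[OF p that] .
    show "weak_p_elliptic \<Omega> (adjoint_coeff A) (p / (p - 1))" if "weak_p_elliptic \<Omega> A p"
      using weak_p_elliptic_adjoint[OF p that] .
    show "weak_p_elliptic \<Omega> A 2" "legendre_hadamard \<Omega> A" if "weak_p_elliptic \<Omega> A p"
      unfolding weak_p_elliptic_2_iff by (rule weak_imp_legendre_hadamard[OF that])+
  next
    fix P and p q :: real
    assume P: "P \<in> {strong_p_elliptic, integral_p_elliptic, weak_p_elliptic}"
      and p: "p > 1" and q: "q > 1" and PP: "P \<Omega> A p \<and> P \<Omega> A q"
    from P consider "P = strong_p_elliptic" | "P = integral_p_elliptic" | "P = weak_p_elliptic" by blast
    then show "\<exists>a b. 1 \<le> a \<and> p \<in> {a<..<b} \<and> q \<in> {a<..<b} \<and> (\<forall>r\<in>{a<..<b}. P \<Omega> A r)"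
    proof cases
      case 1
      show ?thesis using PP unfolding 1 by (intro strong_p_elliptic_interval[OF MA p q]) simp_all
    next
      case 2
      show ?thesis using PP unfolding 2 by (intro integral_p_elliptic_interval[OF A p q]) simp_all
    next
      case 3
      show ?thesis using PP unfolding 3 by (intro weak_p_elliptic_interval[OF MA p q]) simp_all
    qed
  qed (rule strong_p_elliptic_2_iff integral_p_elliptic_2_iff weak_p_elliptic_2_iff)+
qed

end
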